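(* Let $\mathcal{Q}\subset\mathbb{C}\langle Z_{i,j}\rangle$ be a family of noncommutative polynomials with $\mathcal{N}_{\mathcal{Q}}\neq\{0\}$, let $\mathcal{V}_{\mathcal{Q}}\subset\mathbf{D}_{\mathbf{f}}^{\mathbf{m}}$ be the associated abstract noncommutative variety, and let $\mathbf{S}=\{\mathbf{S}_{i,j}\}$ be its universal model. Let $\mathbf{A}=(A_1,\ldots,A_k)\in B(\mathcal{H})^{n_1}\times_c\cdots\times_c B(\mathcal{H})^{n_k}$, $A_i=(A_{i,1},\ldots,A_{i,n_i})$, be such that each $\Phi_{f_i,A_i}$ is well-defined and $q(\mathbf{A})=0$ for any $q\in\mathcal{Q}$. Let $$\mathcal{S}^{w^*}:=\overline{\mathrm{span}}^{w^*}\{\mathbf{S}_{(\alpha)}\mathbf{S}_{(\beta)}^*:\ (\alpha),(\beta)\in\mathbb{F}_{n_1}^+\times\cdots\times\mathbb{F}_{n_k}^+\},$$ and let $CP^{w^*}(\mathbf{A},\mathcal{V}_{\mathcal{Q}})$ be the set of all $w^*$-continuous completely positive linear maps $\varphi:\mathcal{S}^{w^*}\to B(\mathcal{H})$ such that $$\varphi(\mathbf{S}_{(\alpha)}\mathbf{S}_{(\beta)}^* )=A_{(\alpha)}\varphi(I)A_{(\beta)}^*,\qquad(\alpha),(\beta)\in\mathbb{F}_{n_1}^+\times\cdots\times\mathbb{F}_{n_k}^+.$$ Then the map $$\Gamma:CP^{w^*}(\mathbf{A},\mathcal{V}_{\mathcal{Q}})\to\mathcal{C}^{pure}_{\geq}(\mathbf{\Delta}_{\mathbf{f},\mathbf{A}}^{\mathbf{m}})^+,\qquad\Gamma(\varphi):=\varphi(I),$$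 is a (well-defined) bijection. In addition, if $D\in\mathcal{C}^{pure}_{\geq}(\mathbf{\Delta}_{\mathbf{f},\mathbf{A}}^{\mathbf{m}})^+$, then $\Gamma^{-1}(D)$ coincides with the constrained noncommutative Berezin transform $$\mathbf{B}_{\omega}[\chi]:=\mathbf{K}_{\omega}^*(\chi\otimes I)\mathbf{K}_{\omega},\qquad\chi\in\mathcal{S}^{w^*},$$ where $\omega:=(\mathbf{f},\mathbf{m},\mathbf{A},R,\mathcal{Q})$ and $R:=\mathbf{\Delta}_{\mathbf{f},\mathbf{A}}^{\mathbf{m}}(D)$.
   Context: Hilbert spaces are complex, $\mathcal{H}$ separable. $\mathbb{N}=\{1,2,\ldots\}$, $\mathbb{Z}_+=\{0,1,\ldots\}$; fix $k\in\mathbb{N}$ and $n_i,m_i\in\mathbb{N}$, $\mathbf{m}=(m_1,\ldots,m_k)$. For $\mathbf{p},\mathbf{m}\in\mathbb{Z}_+^k$, $\mathbf{p}\le\mathbf{m}$ is meant coordinatewise. $\mathbb{F}_{n_i}^+$ is the free monoid on generators $g_1^i,\ldots,g_{n_i}^i$ with identity $g_0^i$; $|\alpha|$ is word length. For an $n_i$-tuple $(X_{i,1},\ldots,X_{i,n_i})$ and $\alpha=g^i_{j_1}\cdots g^i_{j_p}$, $X_{i,\alpha}:=X_{i,j_1}\cdots X_{i,j_p}$, $X_{i,g_0^i}:=I$. For $(\alpha)=(\alpha_1,\ldots,\alpha_k)$, $X_{(\alpha)}:=X_{1,\alpha_1}\cdots X_{k,\alpha_k}$. $\mathbf{f}=(f_1,\ldots,f_k)$,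 where each $f_i=\sum_{\alpha\in\mathbb{F}_{n_i}^+}a_{i,\alpha}Z_{i,\alpha}$ is a positive regular free holomorphic function: a formal power series in noncommuting $Z_{i,1},\ldots,Z_{i,n_i}$ with $a_{i,\alpha}\ge0$, $a_{i,g_0^i}=0$, $a_{i,g_j^i}>0$ for $j=1,\ldots,n_i$, and $\limsup_{p\to\infty}(\sum_{|\alpha|=p}|a_{i,\alpha}|^2)^{1/2p}<\infty$. $B(\mathcal{H})^{n_1}\times_c\cdots\times_cB(\mathcal{H})^{n_k}$ is the set of tuples $\mathbf{X}=(X_1,\ldots,X_k)$, $X_i=(X_{i,1},\ldots,X_{i,n_i})$, such that for $s\ne t$ the entries of $X_s$ commute with those of $X_t$. $\Phi_{f_i,X_i}$ is well-defined if $\sum_\alpha a_{i,\alpha}X_{i,\alpha}X_{i,\alpha}^*$ converges in the weak operator topology (WOT); then $\Phi_{f_i,X_i}(Y):=\sum_\alpha a_{i,\alpha}X_{i,\alpha}YX_{i,\alpha}^*$ (WOT). $\mathbf{\Delta}_{\mathbf{f},\mathbf{X}}^{\mathbf{p}}:=(id-\Phi_{f_1,X_1})^{p_1}\circ\cdots\circ(id-\Phi_{f_k,X_k})^{p_k}$. The cone $\mathcal{C}_{\ge}(\mathbf{\Delta}_{\mathbf{f},\mathbf{A}}^{\mathbf{m}})^+$ is $\{X\in B(\mathcal{H}):X\ge0,\ \mathbf{\Delta}_{\mathbf{f},\mathbf{A}}^{\mathbf{p}}(X)\ge0\text{ for }0\le\mathbf{p}\le\mathbf{m}\}$, and $\mathcal{C}^{pure}_{\ge}(\mathbf{\Delta}_{\mathbf{f},\mathbf{A}}^{\mathbf{m}})^+$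 is the set of its elements $X$ such that, for each $i$, $\Phi_{f_i,A_i}^s(X)\to0$ weakly as $s\to\infty$. The polydomain $\mathbf{D}_{\mathbf{f}}^{\mathbf{m}}(\mathcal{H})$ is the set of $\mathbf{X}\in B(\mathcal{H})^{n_1}\times_c\cdots\times_cB(\mathcal{H})^{n_k}$ with $\Phi_{f_i,X_i}$ well-defined and $\mathbf{\Delta}_{\mathbf{f},\mathbf{X}}^{\mathbf{p}}(I)\ge0$ for $0\le\mathbf{p}\le\mathbf{m}$. Universal model of $\mathbf{D}_{\mathbf{f}}^{\mathbf{m}}$: $F^2(H_{n_i})$ is the full Fock space over an $n_i$-dimensional Hilbert space, with orthonormal basis $\{e^i_\alpha\}_{\alpha\in\mathbb{F}_{n_i}^+}$, $e^i_{g_0^i}=1$. Put $b_{i,g_0^i}^{(m_i)}:=1$ and, for $|\alpha|\ge1$, $$b_{i,\alpha}^{(m_i)}:=\sum_{p=1}^{|\alpha|}\ \sum_{\gamma_1\cdots\gamma_p=\alpha,\ |\gamma_1|\ge1,\ldots,|\gamma_p|\ge1}a_{i,\gamma_1}\cdots a_{i,\gamma_p}\binom{p+m_i-1}{m_i-1}.$$ $W_{i,j}e^i_\alpha:=\sqrt{b_{i,\alpha}^{(m_i)}/b_{i,g_j^i\alpha}^{(m_i)}}\,e^i_{g_j^i\alpha}$, and $\mathbf{W}_{i,j}:=I\otimes\cdots\otimes W_{i,j}\otimes\cdots\otimes I$ ($W_{i,j}$ in the $i$-th position) on $\bigotimes_{i=1}^kF^2(H_{n_i})$. Variety: $\mathbb{C}\langle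 Z_{i,j}\rangle$ is the algebra of polynomials in indeterminates $Z_{i,j}$ ($1\le i\le k$, $1\le j\le n_i$), where $Z_{s,j}$ and $Z_{t,l}$ commute for $s\neq t$ and are otherwise noncommuting. $\mathcal{M}_{\mathcal{Q}}:=\overline{\mathrm{span}}\{\mathbf{W}_{(\alpha)}q(\mathbf{W})\mathbf{W}_{(\beta)}(\mathbb{C}):(\alpha),(\beta)\in\mathbb{F}_{n_1}^+\times\cdots\times\mathbb{F}_{n_k}^+,\ q\in\mathcal{Q}\}$ (where $\mathbb{C}$ denotes the scalar multiples of the vacuum $1\otimes\cdots\otimes1$), $\mathcal{N}_{\mathcal{Q}}:=[\bigotimes_iF^2(H_{n_i})]\ominus\mathcal{M}_{\mathcal{Q}}$, which is invariant under each $\mathbf{W}_{i,j}^*$; $\mathbf{S}_{i,j}:=P_{\mathcal{N}_{\mathcal{Q}}}\mathbf{W}_{i,j}|_{\mathcal{N}_{\mathcal{Q}}}$. $\mathcal{V}_{\mathcal{Q}}(\mathcal{H}):=\{\mathbf{X}\in\mathbf{D}_{\mathbf{f}}^{\mathbf{m}}(\mathcal{H}):g(\mathbf{X})=0\ \forall g\in\mathcal{Q}\}$, with universal model $\mathbf{S}=\{\mathbf{S}_{i,j}\}$. Berezin kernel: for $\omega=(\mathbf{f},\mathbf{m},\mathbf{A},R,\mathcal{Q})$ with $q(\mathbf{A})=0$ for $q\in\mathcal{Q}$ and $R\ge0$ such that $\sum_{(s_1,\ldots,s_k)\in\mathbb{Z}_+^k}\prod_i\binom{s_i+m_i-1}{m_i-1}\Phi_{f_1,A_1}^{s_1}\circ\cdots\circ\Phi_{f_k,A_k}^{s_k}(R)\le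 bI$ for some $b>0$ ("compatible tuple"; this holds for the $\omega$ in the statement), $\mathbf{K}_\omega:\mathcal{H}\to\mathcal{N}_{\mathcal{Q}}\otimes\overline{R^{1/2}\mathcal{H}}$ is $\mathbf{K}_\omega:=(P_{\mathcal{N}_{\mathcal{Q}}}\otimes I)\mathbf{K}_{\mathbf{f},\mathbf{A}}^R$ with $$\mathbf{K}_{\mathbf{f},\mathbf{A}}^Rh:=\sum_{\beta_i\in\mathbb{F}_{n_i}^+,\,i=1,\ldots,k}\sqrt{b_{1,\beta_1}^{(m_1)}}\cdots\sqrt{b_{k,\beta_k}^{(m_k)}}\,e^1_{\beta_1}\otimes\cdots\otimes e^k_{\beta_k}\otimes R^{1/2}A_{1,\beta_1}^*\cdots A_{k,\beta_k}^*h.$$ *)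

theory Defs
  imports "HOL-Analysis.Analysis" "HOL-Library.Poly_Mapping"
begin

section \<open>Complex Hilbert spaces\<close>

class complex_vec = real_vector +
  fixes scaleC :: "complex \<Rightarrow> 'a \<Rightarrow> 'a"  (infixr \<open>*\<^sub>C\<close> 75)
  assumes scaleC_add_right: "c *\<^sub>C (x + y) = c *\<^sub>C x + c *\<^sub>C y"
    and scaleC_add_left: "(c + d) *\<^sub>C x = c *\<^sub>C x + d *\<^sub>C x"
    and scaleC_scaleC: "c *\<^sub>C (d *\<^sub>C x) = (c * d) *\<^sub>C x"
    and scaleR_scaleC: "scaleR r x = complex_of_real r *\<^sub>C x"

lemma scaleC_one [simp]: "1 *\<^sub>C x = (x :: 'a::complex_vec)"
  using scaleR_scaleC[of 1 x] by simp

lemma scaleC_scaleR: "c *\<^sub>C (r *\<^sub>R x) = r *\<^sub>R (c *\<^sub>C x)" for x :: "'a::complex_vec"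
  by (simp add: scaleR_scaleC scaleC_scaleC mult.commute)

global_interpretation complex_vec: vector_space "scaleC :: complex \<Rightarrow> 'a \<Rightarrow> 'a::complex_vec"
  defines cspan = complex_vec.span
  by unfold_locales (simp_all add: scaleC_add_right scaleC_add_left scaleC_scaleC)

text \<open>
  The complex inner product is linear in its first argument. Its real part is the inner product
  of \<^class>\<open>real_inner\<close>, so norm, metric and topology are those of the library.
\<close>

class complex_hilbert = complex_vec + real_inner + complete_space +
  fixes cinner :: "'a \<Rightarrow> 'a \<Rightarrow> complex"
  assumes cinner_commute: "cinner x y = cnj (cinner y x)"
    and cinner_add_left: "cinner (x + y) z = cinner x z + cinner y z"
    and cinner_scaleC_left: "cinner (c *\<^sub>C x) y = c * cinner x y"
    and Re_cinner: "Re (cinner x y) = inner x y"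

instantiation complex :: complex_hilbert
begin

definition scaleC_complex :: "complex \<Rightarrow> complex \<Rightarrow> complex"
  where "scaleC_complex c x = c * x"

definition cinner_complex :: "complex \<Rightarrow> complex \<Rightarrow> complex"
  where "cinner_complex x y = x * cnj y"

instance
proof
  fix x y z c d :: complex and r :: real
  show "c *\<^sub>C (x + y) = c *\<^sub>C x + c *\<^sub>C y"
    by (simp only: scaleC_complex_def distrib_left)
  show "(c + d) *\<^sub>C x = c *\<^sub>C x + d *\<^sub>C x"
    by (simp only: scaleC_complex_def distrib_right)
  show "c *\<^sub>C d *\<^sub>C x = (c * d) *\<^sub>C x"
    by (simp only: scaleC_complex_def mult.assoc)
  show "r *\<^sub>R x = complex_of_real r *\<^sub>C x"
    by (simp only: scaleC_complex_def scaleR_conv_of_real)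
  show "cinner x y = cnj (cinner y x)"
    by (simp only: cinner_complex_def complex_cnj_mult complex_cnj_cnj mult.commute)
  show "cinner (x + y) z = cinner x z + cinner y z"
    by (simp only: cinner_complex_def distrib_right)
  show "cinner (c *\<^sub>C x) y = c * cinner x y"
    by (simp only: cinner_complex_def scaleC_complex_def mult.assoc)
  show "Re (cinner x y) = inner x y"
    by (simp add: cinner_complex_def inner_complex_def)
qed

end

lemma cinner_self: "cinner x x = complex_of_real ((norm x)\<^sup>2)" for x :: "'a::complex_hilbert"
proof -
  have "Im (cinner x x) = 0"
    using arg_cong[OF cinner_commute[of x x], of Im] by simp
  then show ?thesis
    by (simp add: complex_eq_iff Re_cinner power2_norm_eq_inner)
qed

lemma cinner_scaleC_right: "cinner x (c *\<^sub>C y) = cnj c * cinner x y" for x :: "'a::complex_hilbert"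
  by (subst (1 2) cinner_commute) (simp add: cinner_scaleC_left)

lemma norm_scaleC: "norm (c *\<^sub>C x) = cmod c * norm x" for x :: "'a::complex_hilbert"
proof -
  have "cinner (c *\<^sub>C x) (c *\<^sub>C x) = (c * cnj c) * cinner x x"
    by (simp add: cinner_scaleC_left cinner_scaleC_right mult.assoc)
  also have "\<dots> = complex_of_real ((cmod c * norm x)\<^sup>2)"
    by (simp only: complex_norm_square[symmetric] cinner_self power_mult_distrib of_real_mult of_real_power)
  finally have "(norm (c *\<^sub>C x))\<^sup>2 = (cmod c * norm x)\<^sup>2"
    unfolding cinner_self of_real_eq_iff .
  then show ?thesis
    by (simp add: power2_eq_iff_nonneg)
qed

lemma Im_cinner: "Im (cinner x y) = Re (cinner x (\<i> *\<^sub>C y))" for x :: "'a::complex_hilbert"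
  by (simp add: cinner_scaleC_right)

section \<open>The Hilbert space of square summable families\<close>

typedef (overloaded) ('i, 'h::complex_hilbert) l2 =
  "{f :: 'i \<Rightarrow> 'h. (\<lambda>i. (norm (f i))\<^sup>2) summable_on UNIV}"
  morphisms l2_apply Abs_l2
  by (rule exI[of _ "\<lambda>_. 0"]) simp

setup_lifting type_definition_l2

lemma l2_eqI: "(\<And>i. l2_apply x i = l2_apply y i) \<Longrightarrow> x = y"
  by transfer auto

lemma l2_norm_summable: "(\<lambda>i. (norm (l2_apply x i))\<^sup>2) summable_on UNIV"
  using l2_apply[of x] by simp

lemma sq_sum_bound: "(norm (x + y))\<^sup>2 \<le> 2 * (norm x)\<^sup>2 + 2 * (norm y)\<^sup>2"
  for x y :: "'a::real_normed_vector"
proof -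
  have "(norm (x + y))\<^sup>2 \<le> (norm x + norm y)\<^sup>2"
    by (simp add: norm_triangle_ineq power_mono)
  also have "\<dots> \<le> 2 * (norm x)\<^sup>2 + 2 * (norm y)\<^sup>2"
    using sum_squares_bound[of "norm x" "norm y"] by (simp add: power2_sum)
  finally show ?thesis .
qed

lemma summable_on_dominated:
  fixes f g :: "'i \<Rightarrow> real"
  assumes "g summable_on UNIV" "\<And>i. 0 \<le> f i" "\<And>i. f i \<le> g i"
  shows "f summable_on UNIV"
  using summable_on_comparison_test[OF assms(1), of f] assms by simp

lemma sq_summable_add:
  fixes f g :: "'i \<Rightarrow> 'h::real_normed_vector"
  assumes "(\<lambda>i. (norm (f i))\<^sup>2) summable_on UNIV" "(\<lambda>i. (norm (g i))\<^sup>2) summable_on UNIV"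
  shows "(\<lambda>i. (norm (f i + g i))\<^sup>2) summable_on UNIV"
proof (rule summable_on_dominated)
  show "(\<lambda>i. 2 * (norm (f i))\<^sup>2 + 2 * (norm (g i))\<^sup>2) summable_on UNIV"
    by (intro summable_on_add summable_on_cmult_right assms)
qed (simp_all add: sq_sum_bound)

instantiation l2 :: (type, complex_hilbert) complex_vec
begin

lift_definition zero_l2 :: "('a, 'b) l2" is "\<lambda>_. 0" by simp
lift_definition plus_l2 :: "('a, 'b) l2 \<Rightarrow> ('a, 'b) l2 \<Rightarrow> ('a, 'b) l2" is "\<lambda>f g i. f i + g i"
  by (rule sq_summable_add)
lift_definition uminus_l2 :: "('a, 'b) l2 \<Rightarrow> ('a, 'b) l2" is "\<lambda>f i. - f i" by simp
lift_definition minus_l2 :: "('a, 'b) l2 \<Rightarrow> ('a, 'b) l2 \<Rightarrow> ('a, 'b) l2" is "\<lambda>f g i. f i - g i"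
  using sq_summable_add[of _ "\<lambda>i. - _ i"] by simp
lift_definition scaleC_l2 :: "complex \<Rightarrow> ('a, 'b) l2 \<Rightarrow> ('a, 'b) l2" is "\<lambda>c f i. c *\<^sub>C f i"
  by (simp add: norm_scaleC power_mult_distrib summable_on_cmult_right)
lift_definition scaleR_l2 :: "real \<Rightarrow> ('a, 'b) l2 \<Rightarrow> ('a, 'b) l2" is "\<lambda>r f i. r *\<^sub>R f i"
  by (simp add: power_mult_distrib summable_on_cmult_right)

instance
proof
  fix x y z :: "('a, 'b) l2" and a b :: real and c d :: complex
  show "x + y + z = x + (y + z)" by transfer (simp add: add.assoc)
  show "x + y = y + x" by transfer (simp add: add.commute)
  show "0 + x = x" by transfer simp
  show "- x + x = 0" by transfer simp
  show "x - y = x + - y" by transfer simp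
  show "a *\<^sub>R (x + y) = a *\<^sub>R x + a *\<^sub>R y" by transfer (simp add: scaleR_add_right)
  show "(a + b) *\<^sub>R x = a *\<^sub>R x + b *\<^sub>R x" by transfer (simp add: scaleR_add_left)
  show "a *\<^sub>R b *\<^sub>R x = (a * b) *\<^sub>R x" by transfer simp
  show "1 *\<^sub>R x = x" by transfer simp
  show "c *\<^sub>C (x + y) = c *\<^sub>C x + c *\<^sub>C y" by transfer (simp add: scaleC_add_right)
  show "(c + d) *\<^sub>C x = c *\<^sub>C x + d *\<^sub>C x" by transfer (simp add: scaleC_add_left)
  show "c *\<^sub>C d *\<^sub>C x = (c * d) *\<^sub>C x" by transfer (simp add: scaleC_scaleC)
  show "a *\<^sub>R x = complex_of_real a *\<^sub>C x" by transfer (simp add: scaleR_scaleC)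
qed

end

lemma inner_l2_summable:
  "(\<lambda>i. inner (l2_apply x i) (l2_apply y i)) summable_on UNIV"
  for x y :: "('i, 'h::complex_hilbert) l2"
proof (rule abs_summable_summable, rule summable_on_dominated)
  show "(\<lambda>i. (norm (l2_apply x i))\<^sup>2 + (norm (l2_apply y i))\<^sup>2) summable_on UNIV"
    by (intro summable_on_add l2_norm_summable)
  fix i
  have nn: "0 \<le> norm (l2_apply x i) * norm (l2_apply y i)" by simp
  have "\<bar>inner (l2_apply x i) (l2_apply y i)\<bar> \<le> norm (l2_apply x i) * norm (l2_apply y i)"
    by (rule Cauchy_Schwarz_ineq2)
  also have "\<dots> \<le> (norm (l2_apply x i))\<^sup>2 + (norm (l2_apply y i))\<^sup>2"
    using sum_squares_bound[of "norm (l2_apply x i)" "norm (l2_apply y i)"] nn by linarith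
  finally show "norm (inner (l2_apply x i) (l2_apply y i)) \<le> \<dots>" by simp
qed simp

lemma cinner_l2_summable:
  "(\<lambda>i. cinner (l2_apply x i) (l2_apply y i)) summable_on UNIV"
  for x y :: "('i, 'h::complex_hilbert) l2"
proof -
  have im: "Im (cinner (l2_apply x i) (l2_apply y i)) = inner (l2_apply x i) (l2_apply (\<i> *\<^sub>C y) i)" for i
    by (simp add: Im_cinner Re_cinner scaleC_l2.rep_eq)
  have "(\<lambda>i. complex_of_real (inner (l2_apply x i) (l2_apply y i))
      + \<i> * complex_of_real (inner (l2_apply x i) (l2_apply (\<i> *\<^sub>C y) i))) summable_on UNIV"
    by (intro summable_on_add summable_on_cmult_right summable_on_of_real inner_l2_summable)
  also have "(\<lambda>i. complex_of_real (inner (l2_apply x i) (l2_apply y i))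
      + \<i> * complex_of_real (inner (l2_apply x i) (l2_apply (\<i> *\<^sub>C y) i)))
      = (\<lambda>i. cinner (l2_apply x i) (l2_apply y i))"
    by (rule ext) (simp add: complex_eq_iff Re_cinner im)
  finally show ?thesis .
qed

instantiation l2 :: (type, complex_hilbert) real_inner
begin

definition inner_l2 :: "('a, 'b) l2 \<Rightarrow> ('a, 'b) l2 \<Rightarrow> real"
  where "inner_l2 x y = (\<Sum>\<^sub>\<infinity>i. inner (l2_apply x i) (l2_apply y i))"
definition norm_l2 :: "('a, 'b) l2 \<Rightarrow> real"
  where "norm_l2 x = sqrt (inner x x)"
definition sgn_l2 :: "('a, 'b) l2 \<Rightarrow> ('a, 'b) l2"
  where "sgn_l2 x = x /\<^sub>R norm x"
definition dist_l2 :: "('a, 'b) l2 \<Rightarrow> ('a, 'b) l2 \<Rightarrow> real"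
  where "dist_l2 x y = norm (x - y)"
definition uniformity_l2 :: "(('a, 'b) l2 \<times> ('a, 'b) l2) filter"
  where "uniformity_l2 = (INF e\<in>{0<..}. principal {(x, y). dist x y < e})"
definition open_l2 :: "('a, 'b) l2 set \<Rightarrow> bool"
  where "open_l2 U = (\<forall>x\<in>U. \<forall>\<^sub>F (x', y) in uniformity. x' = x \<longrightarrow> y \<in> U)"

instance
proof
  fix x y z :: "('a, 'b) l2" and r :: real
  show "dist x y = norm (x - y)" by (rule dist_l2_def)
  show "sgn x = x /\<^sub>R norm x" by (rule sgn_l2_def)
  show "(uniformity :: (('a, 'b) l2 \<times> ('a, 'b) l2) filter)
      = (INF e\<in>{0<..}. principal {(x, y). dist x y < e})" by (rule uniformity_l2_def)
  show "open U = (\<forall>x\<in>U. \<forall>\<^sub>F (x', y) in uniformity. x' = x \<longrightarrow> y \<in> U)" for U :: "('a, 'b) l2 set"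
    by (rule open_l2_def)
  show "inner x y = inner y x" by (simp add: inner_l2_def inner_commute)
  show "inner (x + y) z = inner x z + inner y z"
    by (simp add: inner_l2_def plus_l2.rep_eq inner_add_left infsum_add inner_l2_summable)
  show "inner (r *\<^sub>R x) y = r * inner x y"
    by (simp add: inner_l2_def scaleR_l2.rep_eq infsum_cmult_right')
  show "0 \<le> inner x x" by (simp add: inner_l2_def infsum_nonneg)
  show "inner x x = 0 \<longleftrightarrow> x = 0"
  proof
    assume "inner x x = 0"
    then have "inner (l2_apply x i) (l2_apply x i) = 0" for i
      using nonneg_infsum_le_0D[of "\<lambda>i. inner (l2_apply x i) (l2_apply x i)" UNIV i]
        inner_l2_summable[of x x] by (simp add: inner_l2_def)
    then show "x = 0" by (intro l2_eqI) (simp add: zero_l2.rep_eq)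
  qed (simp add: inner_l2_def zero_l2.rep_eq)
  show "norm x = sqrt (inner x x)" by (rule norm_l2_def)
qed

end

lemma norm_l2_sq: "(norm x)\<^sup>2 = (\<Sum>\<^sub>\<infinity>i. (norm (l2_apply x i))\<^sup>2)"
  for x :: "('i, 'h::complex_hilbert) l2"
  by (simp add: power2_norm_eq_inner inner_l2_def)

lemma sum_le_norm_l2: "finite F \<Longrightarrow> (\<Sum>i\<in>F. (norm (l2_apply x i))\<^sup>2) \<le> (norm x)\<^sup>2"
  for x :: "('i, 'h::complex_hilbert) l2"
  unfolding norm_l2_sq by (rule finite_sum_le_infsum) (auto simp: l2_norm_summable)

lemma norm_l2_apply_le: "norm (l2_apply x i) \<le> norm x"
  for x :: "('i, 'h::complex_hilbert) l2"
  using sum_le_norm_l2[of "{i}" x] by (simp add: power2_le_iff_abs_le)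

instance l2 :: (type, complex_hilbert) complete_space
proof
  fix X :: "nat \<Rightarrow> ('a, 'b) l2"
  assume X: "Cauchy X"
  have "Cauchy (\<lambda>n. l2_apply (X n) i)" for i
  proof (rule metric_CauchyI)
    fix e :: real assume "0 < e"
    then obtain M where M: "\<forall>m\<ge>M. \<forall>n\<ge>M. dist (X m) (X n) < e"
      using X by (auto simp: Cauchy_def)
    have "dist (l2_apply (X m) i) (l2_apply (X n) i) \<le> dist (X m) (X n)" for m n
      using norm_l2_apply_le[of "X m - X n" i] by (simp add: dist_norm minus_l2.rep_eq)
    then show "\<exists>M. \<forall>m\<ge>M. \<forall>n\<ge>M. dist (l2_apply (X m) i) (l2_apply (X n) i) < e"
      using M by (meson le_less_trans)
  qed
  then have "\<forall>i. \<exists>l. (\<lambda>n. l2_apply (X n) i) \<longlonglongrightarrow> l"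
    using Cauchy_convergent_iff convergent_def by blast
  then obtain f where f: "\<And>i. (\<lambda>n. l2_apply (X n) i) \<longlonglongrightarrow> f i" by metis
  have bound: "(\<Sum>i\<in>F. (norm (l2_apply (X m) i - f i))\<^sup>2) \<le> e\<^sup>2"
    if M: "\<forall>m\<ge>M. \<forall>n\<ge>M. dist (X m) (X n) < e" and m: "m \<ge> M" and F: "finite F" for F e m M
  proof (rule LIMSEQ_le_const2)
    show "(\<lambda>n. \<Sum>i\<in>F. (norm (l2_apply (X m) i - l2_apply (X n) i))\<^sup>2)
        \<longlonglongrightarrow> (\<Sum>i\<in>F. (norm (l2_apply (X m) i - f i))\<^sup>2)"
      by (intro tendsto_intros f)
    have "(\<Sum>i\<in>F. (norm (l2_apply (X m) i - l2_apply (X n) i))\<^sup>2) \<le> e\<^sup>2" if "n \<ge> M" for n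
    proof -
      have "(\<Sum>i\<in>F. (norm (l2_apply (X m - X n) i))\<^sup>2) \<le> (norm (X m - X n))\<^sup>2"
        by (rule sum_le_norm_l2[OF F])
      also have "\<dots> \<le> e\<^sup>2"
        using M m that by (intro power_mono) (auto simp: dist_norm less_imp_le)
      finally show ?thesis by (simp add: minus_l2.rep_eq)
    qed
    then show "\<exists>N. \<forall>n\<ge>N. (\<Sum>i\<in>F. (norm (l2_apply (X m) i - l2_apply (X n) i))\<^sup>2) \<le> e\<^sup>2" by blast
  qed
  have summ: "(\<lambda>i. (norm (l2_apply (X m) i - f i))\<^sup>2) summable_on UNIV"
    if M: "\<forall>m\<ge>M. \<forall>n\<ge>M. dist (X m) (X n) < e" and m: "m \<ge> M" for e m M
    by (rule nonneg_bdd_above_summable_on)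
       (auto simp: bdd_above_def intro!: exI[of _ "e\<^sup>2"] bound[OF M m])
  obtain M1 where M1: "\<forall>m\<ge>M1. \<forall>n\<ge>M1. dist (X m) (X n) < 1"
    using X zero_less_one unfolding Cauchy_def by blast
  have "(\<lambda>i. (norm (l2_apply (X M1) i + - (l2_apply (X M1) i - f i)))\<^sup>2) summable_on UNIV"
    using summ[OF M1 order_refl]
    by (intro sq_summable_add l2_norm_summable) (simp add: norm_minus_commute)
  then have fs: "(\<lambda>i. (norm (f i))\<^sup>2) summable_on UNIV" by simp
  have ap: "l2_apply (Abs_l2 f) = f" using fs by (simp add: Abs_l2_inverse)
  have "X \<longlonglongrightarrow> Abs_l2 f"
  proof (rule metric_LIMSEQ_I)
    fix e :: real assume e: "0 < e"
    then obtain M where M: "\<forall>m\<ge>M. \<forall>n\<ge>M. dist (X m) (X n) < e / 2"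
      using X unfolding Cauchy_def by (meson half_gt_zero)
    have "dist (X m) (Abs_l2 f) < e" if m: "m \<ge> M" for m
    proof -
      have "(norm (X m - Abs_l2 f))\<^sup>2 = (\<Sum>\<^sub>\<infinity>i. (norm (l2_apply (X m) i - f i))\<^sup>2)"
        by (simp add: norm_l2_sq minus_l2.rep_eq ap)
      also have "\<dots> \<le> (e / 2)\<^sup>2"
        by (rule infsum_le_finite_sums[OF summ[OF M m]]) (use bound[OF M m] in auto)
      finally have "norm (X m - Abs_l2 f) \<le> e / 2"
        using e by (simp add: power2_le_iff_abs_le)
      then show ?thesis using e by (simp add: dist_norm)
    qed
    then show "\<exists>M. \<forall>m\<ge>M. dist (X m) (Abs_l2 f) < e" by blast
  qed
  then show "convergent X" by (auto simp: convergent_def)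
qed

instantiation l2 :: (type, complex_hilbert) complex_hilbert
begin

definition cinner_l2 :: "('a, 'b) l2 \<Rightarrow> ('a, 'b) l2 \<Rightarrow> complex"
  where "cinner_l2 x y = (\<Sum>\<^sub>\<infinity>i. cinner (l2_apply x i) (l2_apply y i))"

instance
proof
  fix x y z :: "('a, 'b) l2" and c :: complex
  show "cinner x y = cnj (cinner y x)"
    unfolding cinner_l2_def infsum_cnj[symmetric] by (simp add: cinner_commute[symmetric])
  show "cinner (x + y) z = cinner x z + cinner y z"
    by (simp add: cinner_l2_def plus_l2.rep_eq cinner_add_left infsum_add cinner_l2_summable)
  show "cinner (c *\<^sub>C x) y = c * cinner x y"
    by (simp add: cinner_l2_def scaleC_l2.rep_eq cinner_scaleC_left infsum_cmult_right')
  show "Re (cinner x y) = inner x y"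
    unfolding cinner_l2_def inner_l2_def
    by (subst infsum_Re[symmetric]) (simp_all add: cinner_l2_summable Re_cinner)
qed

end

text \<open>
  \<open>('i, complex) l2\<close> has the orthonormal basis \<open>ket\<close>, and \<open>('i, 'h) l2\<close> is the Hilbert space
  tensor product of \<open>('i, complex) l2\<close> and \<open>'h\<close>.
\<close>

lift_definition ket :: "'i \<Rightarrow> ('i, complex) l2" is "\<lambda>v i. if i = v then 1 else 0"
proof -
  fix v :: 'i
  have "(\<lambda>i. (norm (if i = v then 1 else 0 :: complex))\<^sup>2) summable_on {v}" by simp
  then show "(\<lambda>i. (norm (if i = v then 1 else 0 :: complex))\<^sup>2) summable_on UNIV"
    by (rule summable_on_cong_neutral[THEN iffD1, rotated -1]) auto
qed

lift_definition tensor_vec :: "('i, complex) l2 \<Rightarrow> 'h \<Rightarrow> ('i, 'h::complex_hilbert) l2"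
  (infixr \<open>\<otimes>\<^sub>v\<close> 70) is "\<lambda>x h i. x i *\<^sub>C h"
  by (simp add: norm_scaleC power_mult_distrib summable_on_cmult_left)

section \<open>Bounded operators\<close>

typedef (overloaded) ('a::complex_hilbert, 'b::complex_hilbert) bop =
  "{T :: 'a \<Rightarrow>\<^sub>L 'b. \<forall>c x. blinfun_apply T (c *\<^sub>C x) = c *\<^sub>C blinfun_apply T x}"
  morphisms blinfun_of_bop Abs_bop
  by (rule exI[of _ 0]) simp

setup_lifting type_definition_bop

lift_definition bop_apply :: "('a::complex_hilbert, 'b::complex_hilbert) bop \<Rightarrow> 'a \<Rightarrow> 'b"
  (infixr \<open>\<cdot>\<close> 75) is blinfun_apply .

lemma bop_eqI: "(\<And>x. S \<cdot> x = T \<cdot> x) \<Longrightarrow> S = T"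
  by transfer (rule blinfun_eqI)

lemma bounded_linear_scaleC: "bounded_linear (\<lambda>x. c *\<^sub>C blinfun_apply T x)"
  for T :: "'a::complex_hilbert \<Rightarrow>\<^sub>L 'b::complex_hilbert"
proof (rule bounded_linear_intro[where K = "cmod c * norm T"])
  show "norm (c *\<^sub>C blinfun_apply T x) \<le> norm x * (cmod c * norm T)" for x
    using mult_left_mono[OF norm_blinfun[of T x], of "cmod c"]
    by (simp add: norm_scaleC mult_ac)
  show "c *\<^sub>C blinfun_apply T (r *\<^sub>R x) = r *\<^sub>R (c *\<^sub>C blinfun_apply T x)" for r x
    by (simp add: blinfun.scaleR_right scaleC_scaleR)
qed (simp add: blinfun.add_right scaleC_add_right)

instantiation bop :: (complex_hilbert, complex_hilbert) complex_vec
begin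

lift_definition zero_bop :: "('a, 'b) bop" is 0 by simp
lift_definition plus_bop :: "('a, 'b) bop \<Rightarrow> ('a, 'b) bop \<Rightarrow> ('a, 'b) bop" is "(+)"
  by (simp add: blinfun.add_left scaleC_add_right)
lift_definition uminus_bop :: "('a, 'b) bop \<Rightarrow> ('a, 'b) bop" is uminus
  by (simp add: blinfun.minus_left)
lift_definition minus_bop :: "('a, 'b) bop \<Rightarrow> ('a, 'b) bop \<Rightarrow> ('a, 'b) bop" is "(-)"
  by (simp add: blinfun.diff_left complex_vec.scale_right_diff_distrib)
lift_definition scaleR_bop :: "real \<Rightarrow> ('a, 'b) bop \<Rightarrow> ('a, 'b) bop" is scaleR
  by (simp add: blinfun.scaleR_left scaleR_scaleC scaleC_scaleC mult.commute)
lift_definition scaleC_bop :: "complex \<Rightarrow> ('a, 'b) bop \<Rightarrow> ('a, 'b) bop"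
  is "\<lambda>c T. Blinfun (\<lambda>x. c *\<^sub>C blinfun_apply T x)"
  by (simp add: bounded_linear_Blinfun_apply bounded_linear_scaleC scaleC_scaleC mult.commute)

lemma bop_apply_plus: "(S + T) \<cdot> x = S \<cdot> x + T \<cdot> x" for S T :: "('a, 'b) bop"
  by transfer (simp add: blinfun.add_left)

lemma bop_apply_scaleR: "(r *\<^sub>R T) \<cdot> x = r *\<^sub>R (T \<cdot> x)" for T :: "('a, 'b) bop"
  by transfer (simp add: blinfun.scaleR_left)

lemma bop_apply_scaleC: "(c *\<^sub>C T) \<cdot> x = c *\<^sub>C (T \<cdot> x)" for T :: "('a, 'b) bop"
  by transfer (simp add: bounded_linear_Blinfun_apply bounded_linear_scaleC)

instance
proof
  fix x y z :: "('a, 'b) bop" and a b :: real and c d :: complex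
  show "x + y + z = x + (y + z)" by transfer simp
  show "x + y = y + x" by transfer simp
  show "0 + x = x" by transfer simp
  show "- x + x = 0" by transfer simp
  show "x - y = x + - y" by transfer simp
  show "a *\<^sub>R (x + y) = a *\<^sub>R x + a *\<^sub>R y" by transfer (simp add: scaleR_add_right)
  show "(a + b) *\<^sub>R x = a *\<^sub>R x + b *\<^sub>R x" by transfer (simp add: scaleR_add_left)
  show "a *\<^sub>R b *\<^sub>R x = (a * b) *\<^sub>R x" by transfer simp
  show "1 *\<^sub>R x = x" by transfer simp
  show "c *\<^sub>C (x + y) = c *\<^sub>C x + c *\<^sub>C y"
    by (rule bop_eqI) (simp add: bop_apply_plus bop_apply_scaleC scaleC_add_right)
  show "(c + d) *\<^sub>C x = c *\<^sub>C x + d *\<^sub>C x"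
    by (rule bop_eqI) (simp add: bop_apply_plus bop_apply_scaleC scaleC_add_left)
  show "c *\<^sub>C d *\<^sub>C x = (c * d) *\<^sub>C x"
    by (rule bop_eqI) (simp add: bop_apply_scaleC scaleC_scaleC)
  show "a *\<^sub>R x = complex_of_real a *\<^sub>C x"
    by (rule bop_eqI) (simp add: bop_apply_scaleC bop_apply_scaleR scaleR_scaleC)
qed

end

lift_definition bop_id :: "('a::complex_hilbert, 'a) bop" is id_blinfun by simp

lift_definition bop_comp ::
  "('b::complex_hilbert, 'c::complex_hilbert) bop \<Rightarrow> ('a::complex_hilbert, 'b) bop \<Rightarrow> ('a, 'c) bop"
  (infixr \<open>\<bullet>\<^sub>o\<close> 70) is "(o\<^sub>L)" by simp

definition adj :: "('a::complex_hilbert, 'b::complex_hilbert) bop \<Rightarrow> ('b, 'a) bop" where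
  "adj T = (THE S. \<forall>x y. cinner (T \<cdot> x) y = cinner x (S \<cdot> y))"

text \<open>Orthogonal projection onto a closed subspace \<open>M\<close>.\<close>

definition ortho_proj :: "'a::complex_hilbert set \<Rightarrow> ('a, 'a) bop" where
  "ortho_proj M = (THE P. \<forall>x. P \<cdot> x \<in> M \<and> (\<forall>y\<in>M. cinner (x - P \<cdot> x) y = 0))"

definition pos_op :: "('a::complex_hilbert, 'a) bop \<Rightarrow> bool" where
  "pos_op T \<longleftrightarrow> (\<forall>x. cinner (T \<cdot> x) x \<in> \<real>\<^sub>\<ge>\<^sub>0)"

definition sqrt_op :: "('a::complex_hilbert, 'a) bop \<Rightarrow> ('a, 'a) bop" where
  "sqrt_op R = (THE S. pos_op S \<and> S \<bullet>\<^sub>o S = R)"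

text \<open>\<open>T \<otimes> I\<close>, as an operator on the tensor product with \<open>'h\<close>.\<close>

definition tensor_id ::
  "(('i, complex) l2, ('i, complex) l2) bop \<Rightarrow> (('i, 'h) l2, ('i, 'h::complex_hilbert) l2) bop" where
  "tensor_id T = (THE S. \<forall>x h. S \<cdot> (x \<otimes>\<^sub>v h) = (T \<cdot> x) \<otimes>\<^sub>v h)"

definition wot :: "('a::complex_hilbert, 'b::complex_hilbert) bop topology" where
  "wot = pullback_topology UNIV (\<lambda>T (x, y). cinner (T \<cdot> x) y) euclidean"

text \<open>
  The \<open>w*\<close>-topology comes from the predual of trace class operators, each of which has the form
  \<open>\<Sum>i. \<langle>\<cdot>, y i\<rangle> x i\<close> with square summable \<open>x\<close>, \<open>y\<close>; it is therefore generated by the following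
  functionals.
\<close>

definition wstar :: "('a::complex_hilbert, 'b::complex_hilbert) bop topology" where
  "wstar = pullback_topology UNIV
     (\<lambda>T (x :: (nat, 'a) l2, y :: (nat, 'b) l2).
        \<Sum>\<^sub>\<infinity>i. cinner (T \<cdot> l2_apply x i) (l2_apply y i)) euclidean"

text \<open>
  For a closed subspace \<open>N\<close>, the algebra \<open>B(N)\<close> is represented by the operators of the ambient
  space that vanish on the orthogonal complement of \<open>N\<close> and have range in \<open>N\<close>. This is compatible
  with products, adjoints, positivity and the \<open>w*\<close>-topology; the identity of \<open>B(N)\<close> becomes
  \<open>ortho_proj N\<close>.
\<close>

definition bops_on :: "'a::complex_hilbert set \<Rightarrow> ('a, 'a) bop set" where
  "bops_on N = {T. T = ortho_proj N \<bullet>\<^sub>o T \<bullet>\<^sub>o ortho_proj N}"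

definition wstar_on :: "'a::complex_hilbert set \<Rightarrow> ('a, 'a) bop topology" where
  "wstar_on N = subtopology wstar (bops_on N)"

definition pos_matrix_on :: "'a::complex_hilbert set \<Rightarrow> nat \<Rightarrow> (nat \<Rightarrow> nat \<Rightarrow> ('a, 'a) bop) \<Rightarrow> bool" where
  "pos_matrix_on N r T \<longleftrightarrow>
     (\<forall>x. (\<forall>i<r. x i \<in> N) \<longrightarrow> (\<Sum>i<r. \<Sum>j<r. cinner (T i j \<cdot> x j) (x i)) \<in> \<real>\<^sub>\<ge>\<^sub>0)"

definition clinear_map_on :: "'a::complex_vec set \<Rightarrow> ('a \<Rightarrow> 'b::complex_vec) \<Rightarrow> bool" where
  "clinear_map_on V \<phi> \<longleftrightarrow>
     (\<forall>x\<in>V. \<forall>y\<in>V. \<phi> (x + y) = \<phi> x + \<phi> y) \<and> (\<forall>c. \<forall>x\<in>V. \<phi> (c *\<^sub>C x) = c *\<^sub>C \<phi> x)"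

definition completely_positive_on ::
  "'a::complex_hilbert set \<Rightarrow> ('a, 'a) bop set \<Rightarrow> (('a, 'a) bop \<Rightarrow> ('h::complex_hilbert, 'h) bop) \<Rightarrow> bool" where
  "completely_positive_on N \<S> \<phi> \<longleftrightarrow>
     (\<forall>r T. (\<forall>i<r. \<forall>j<r. T i j \<in> \<S>) \<longrightarrow> pos_matrix_on N r T
        \<longrightarrow> pos_matrix_on UNIV r (\<lambda>i j. \<phi> (T i j)))"

section \<open>Words, power series and polynomials\<close>

text \<open>
  Indices are counted from \<open>0\<close>: \<open>i < k\<close> and \<open>j < n i\<close>. A word of the free monoid on \<open>n\<close> generators
  is a list of letters \<open>j < n\<close>, and an element of the product of the \<open>k\<close> free monoids is a list
  of \<open>k\<close> words.
\<close>

definition words :: "nat \<Rightarrow> nat list set" where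
  "words n = {\<alpha>. set \<alpha> \<subseteq> {..<n}}"

definition mwords :: "nat \<Rightarrow> (nat \<Rightarrow> nat) \<Rightarrow> nat list list set" where
  "mwords k n = {w. length w = k \<and> (\<forall>i<k. w ! i \<in> words (n i))}"

definition positive_regular :: "nat \<Rightarrow> (nat list \<Rightarrow> real) \<Rightarrow> bool" where
  "positive_regular n a \<longleftrightarrow>
     (\<forall>\<alpha>\<in>words n. 0 \<le> a \<alpha>) \<and> a [] = 0 \<and> (\<forall>j<n. 0 < a [j]) \<and>
     limsup (\<lambda>p. ereal ((\<Sum>\<alpha> | \<alpha> \<in> words n \<and> length \<alpha> = p. \<bar>a \<alpha>\<bar>\<^sup>2) powr (1 / (2 * real p)))) < \<infinity>"

text \<open>
  \<open>X\<^sub>\<alpha>\<close> and \<open>X\<^sub>(\<^sub>\<alpha>\<^sub>)\<close>; the argument \<open>E\<close> is the identity of the algebra in which the words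
  are evaluated.
\<close>

definition word_op ::
  "('a::complex_hilbert, 'a) bop \<Rightarrow> (nat \<Rightarrow> ('a, 'a) bop) \<Rightarrow> nat list \<Rightarrow> ('a, 'a) bop" where
  "word_op E X \<alpha> = foldr (\<lambda>j T. X j \<bullet>\<^sub>o T) \<alpha> E"

definition mword_op ::
  "('a::complex_hilbert, 'a) bop \<Rightarrow> nat \<Rightarrow> (nat \<Rightarrow> nat \<Rightarrow> ('a, 'a) bop) \<Rightarrow> nat list list \<Rightarrow> ('a, 'a) bop" where
  "mword_op E k X w = foldr (\<lambda>i T. word_op E (X i) (w ! i) \<bullet>\<^sub>o T) [0..<k] E"

text \<open>
  Since \<open>Z\<^sub>s\<^sub>j\<close> and \<open>Z\<^sub>t\<^sub>l\<close> commute for \<open>s \<noteq> t\<close>, the monomials \<open>Z\<^sub>(\<^sub>\<alpha>\<^sub>)\<close> form a linear basis of the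
  polynomial algebra, and a polynomial is given by its coefficients in this basis.
\<close>

definition polys :: "nat \<Rightarrow> (nat \<Rightarrow> nat) \<Rightarrow> (nat list list \<Rightarrow>\<^sub>0 complex) set" where
  "polys k n = {q. Poly_Mapping.keys q \<subseteq> mwords k n}"

definition poly_op ::
  "nat \<Rightarrow> (nat \<Rightarrow> nat \<Rightarrow> ('a::complex_hilbert, 'a) bop) \<Rightarrow> (nat list list \<Rightarrow>\<^sub>0 complex) \<Rightarrow> ('a, 'a) bop" where
  "poly_op k X q = (\<Sum>w\<in>Poly_Mapping.keys q. Poly_Mapping.lookup q w *\<^sub>C mword_op bop_id k X w)"

section \<open>The maps \<open>\<Phi>\<close>, the defect maps and the cones\<close>

definition commuting_tuple ::
  "nat \<Rightarrow> (nat \<Rightarrow> nat) \<Rightarrow> (nat \<Rightarrow> nat \<Rightarrow> ('a::complex_hilbert, 'a) bop) \<Rightarrow> bool" where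
  "commuting_tuple k n X \<longleftrightarrow>
     (\<forall>s<k. \<forall>t<k. s \<noteq> t \<longrightarrow> (\<forall>i<n s. \<forall>j<n t. X s i \<bullet>\<^sub>o X t j = X t j \<bullet>\<^sub>o X s i))"

text \<open>
  The series \<open>\<Sum>\<^sub>\<alpha> a\<^sub>\<alpha> X\<^sub>\<alpha> Y X\<^sub>\<alpha>\<^sup>*\<close> is summed along the finite sets of words. As the coefficients are
  nonnegative, for \<open>Y = I\<close> it converges in this sense iff it does when summed by word length.
\<close>

definition Phi_sums_to ::
  "nat \<Rightarrow> (nat list \<Rightarrow> real) \<Rightarrow> (nat \<Rightarrow> ('a::complex_hilbert, 'a) bop) \<Rightarrow> ('a, 'a) bop \<Rightarrow> ('a, 'a) bop \<Rightarrow> bool" where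
  "Phi_sums_to n a X Y L \<longleftrightarrow>
     limitin wot
       (\<lambda>F. \<Sum>\<alpha>\<in>F. a \<alpha> *\<^sub>R (word_op bop_id X \<alpha> \<bullet>\<^sub>o Y \<bullet>\<^sub>o adj (word_op bop_id X \<alpha>)))
       L (finite_subsets_at_top (words n))"

definition Phi_well_defined ::
  "nat \<Rightarrow> (nat list \<Rightarrow> real) \<Rightarrow> (nat \<Rightarrow> ('a::complex_hilbert, 'a) bop) \<Rightarrow> bool" where
  "Phi_well_defined n a X \<longleftrightarrow> (\<exists>L. Phi_sums_to n a X bop_id L)"

definition Phi ::
  "nat \<Rightarrow> (nat list \<Rightarrow> real) \<Rightarrow> (nat \<Rightarrow> ('a::complex_hilbert, 'a) bop) \<Rightarrow> ('a, 'a) bop \<Rightarrow> ('a, 'a) bop" where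
  "Phi n a X Y = (THE L. Phi_sums_to n a X Y L)"

definition Delta ::
  "nat \<Rightarrow> (nat \<Rightarrow> nat) \<Rightarrow> (nat \<Rightarrow> nat list \<Rightarrow> real) \<Rightarrow> (nat \<Rightarrow> nat \<Rightarrow> ('a::complex_hilbert, 'a) bop)
     \<Rightarrow> (nat \<Rightarrow> nat) \<Rightarrow> ('a, 'a) bop \<Rightarrow> ('a, 'a) bop" where
  "Delta k n f X p = foldr (\<lambda>i G. ((\<lambda>Y. Y - Phi (n i) (f i) (X i) Y) ^^ p i) \<circ> G) [0..<k] id"

definition defect_cone ::
  "nat \<Rightarrow> (nat \<Rightarrow> nat) \<Rightarrow> (nat \<Rightarrow> nat) \<Rightarrow> (nat \<Rightarrow> nat list \<Rightarrow> real)
     \<Rightarrow> (nat \<Rightarrow> nat \<Rightarrow> ('a::complex_hilbert, 'a) bop) \<Rightarrow> ('a, 'a) bop set" where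
  "defect_cone k n m f A = {X. pos_op X \<and> (\<forall>p. (\<forall>i<k. p i \<le> m i) \<longrightarrow> pos_op (Delta k n f A p X))}"

definition pure_defect_cone ::
  "nat \<Rightarrow> (nat \<Rightarrow> nat) \<Rightarrow> (nat \<Rightarrow> nat) \<Rightarrow> (nat \<Rightarrow> nat list \<Rightarrow> real)
     \<Rightarrow> (nat \<Rightarrow> nat \<Rightarrow> ('a::complex_hilbert, 'a) bop) \<Rightarrow> ('a, 'a) bop set" where
  "pure_defect_cone k n m f A =
     {X \<in> defect_cone k n m f A. \<forall>i<k. limitin wot (\<lambda>s. (Phi (n i) (f i) (A i) ^^ s) X) 0 sequentially}"

section \<open>The universal model\<close>

definition b_coeff :: "(nat list \<Rightarrow> real) \<Rightarrow> nat \<Rightarrow> nat list \<Rightarrow> real" where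
  "b_coeff a m \<alpha> =
     (if \<alpha> = [] then 1
      else \<Sum>p = 1..length \<alpha>. \<Sum>\<gamma> | length \<gamma> = p \<and> concat \<gamma> = \<alpha> \<and> (\<forall>\<beta>\<in>set \<gamma>. length \<beta> \<ge> 1).
             (\<Prod>\<beta>\<leftarrow>\<gamma>. a \<beta>) * real ((p + m - 1) choose (m - 1)))"

type_synonym fock = "(nat list list, complex) l2"

text \<open>
  The basis vector \<open>e\<^sup>1\<^sub>\<beta>\<^sub>1 \<otimes> \<dots> \<otimes> e\<^sup>k\<^sub>\<beta>\<^sub>k\<close> is \<open>ket [\<beta>\<^sub>1, \<dots>, \<beta>\<^sub>k]\<close>. As the type of lists also has elements
  outside \<open>mwords k n\<close>, the tensor product of the Fock spaces is a closed subspace of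
  \<^typ>\<open>fock\<close>, and the operators \<open>\<^bold>W\<^sub>i\<^sub>j\<close> are extended by \<open>0\<close> on its orthogonal complement.
\<close>

definition fock_tensor :: "nat \<Rightarrow> (nat \<Rightarrow> nat) \<Rightarrow> fock set" where
  "fock_tensor k n = {x. \<forall>w. w \<notin> mwords k n \<longrightarrow> l2_apply x w = 0}"

definition W_op ::
  "nat \<Rightarrow> (nat \<Rightarrow> nat) \<Rightarrow> (nat \<Rightarrow> nat) \<Rightarrow> (nat \<Rightarrow> nat list \<Rightarrow> real) \<Rightarrow> nat \<Rightarrow> nat \<Rightarrow> (fock, fock) bop" where
  "W_op k n m f i j = (THE T. \<forall>w. T \<cdot> ket w =
     (if w \<in> mwords k n
      then sqrt (b_coeff (f i) (m i) (w ! i) / b_coeff (f i) (m i) (j # w ! i))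
             *\<^sub>R ket (w[i := j # w ! i])
      else 0))"

definition M_space ::
  "nat \<Rightarrow> (nat \<Rightarrow> nat) \<Rightarrow> (nat \<Rightarrow> nat) \<Rightarrow> (nat \<Rightarrow> nat list \<Rightarrow> real)
     \<Rightarrow> (nat list list \<Rightarrow>\<^sub>0 complex) set \<Rightarrow> fock set" where
  "M_space k n m f Q = closure (cspan
     {mword_op bop_id k (W_op k n m f) \<alpha> \<cdot> poly_op k (W_op k n m f) q
        \<cdot> mword_op bop_id k (W_op k n m f) \<beta> \<cdot> ket (replicate k []) | \<alpha> \<beta> q.
      \<alpha> \<in> mwords k n \<and> \<beta> \<in> mwords k n \<and> q \<in> Q})"

definition N_space ::
  "nat \<Rightarrow> (nat \<Rightarrow> nat) \<Rightarrow> (nat \<Rightarrow> nat) \<Rightarrow> (nat \<Rightarrow> nat list \<Rightarrow> real)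
     \<Rightarrow> (nat list list \<Rightarrow>\<^sub>0 complex) set \<Rightarrow> fock set" where
  "N_space k n m f Q = {x \<in> fock_tensor k n. \<forall>y\<in>M_space k n m f Q. cinner x y = 0}"

definition S_op ::
  "nat \<Rightarrow> (nat \<Rightarrow> nat) \<Rightarrow> (nat \<Rightarrow> nat) \<Rightarrow> (nat \<Rightarrow> nat list \<Rightarrow> real)
     \<Rightarrow> (nat list list \<Rightarrow>\<^sub>0 complex) set \<Rightarrow> nat \<Rightarrow> nat \<Rightarrow> (fock, fock) bop" where
  "S_op k n m f Q i j =
     ortho_proj (N_space k n m f Q) \<bullet>\<^sub>o W_op k n m f i j \<bullet>\<^sub>o ortho_proj (N_space k n m f Q)"

definition S_mword ::
  "nat \<Rightarrow> (nat \<Rightarrow> nat) \<Rightarrow> (nat \<Rightarrow> nat) \<Rightarrow> (nat \<Rightarrow> nat list \<Rightarrow> real)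
     \<Rightarrow> (nat list list \<Rightarrow>\<^sub>0 complex) set \<Rightarrow> nat list list \<Rightarrow> (fock, fock) bop" where
  "S_mword k n m f Q w = mword_op (ortho_proj (N_space k n m f Q)) k (S_op k n m f Q) w"

definition S_wstar ::
  "nat \<Rightarrow> (nat \<Rightarrow> nat) \<Rightarrow> (nat \<Rightarrow> nat) \<Rightarrow> (nat \<Rightarrow> nat list \<Rightarrow> real)
     \<Rightarrow> (nat list list \<Rightarrow>\<^sub>0 complex) set \<Rightarrow> (fock, fock) bop set" where
  "S_wstar k n m f Q = wstar_on (N_space k n m f Q) closure_of cspan
     {S_mword k n m f Q \<alpha> \<bullet>\<^sub>o adj (S_mword k n m f Q \<beta>) | \<alpha> \<beta>. \<alpha> \<in> mwords k n \<and> \<beta> \<in> mwords k n}"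

text \<open>
  Maps with domain \<open>S_wstar\<close> are represented as extensional functions; \<open>ortho_proj (N_space \<dots>)\<close> is the
  identity \<open>I\<close> of \<open>B(N\<^sub>Q)\<close>.
\<close>

definition CP_wstar ::
  "nat \<Rightarrow> (nat \<Rightarrow> nat) \<Rightarrow> (nat \<Rightarrow> nat) \<Rightarrow> (nat \<Rightarrow> nat list \<Rightarrow> real)
     \<Rightarrow> (nat list list \<Rightarrow>\<^sub>0 complex) set \<Rightarrow> (nat \<Rightarrow> nat \<Rightarrow> ('h::complex_hilbert, 'h) bop)
     \<Rightarrow> ((fock, fock) bop \<Rightarrow> ('h, 'h) bop) set" where
  "CP_wstar k n m f Q A = {\<phi> \<in> extensional (S_wstar k n m f Q).
     clinear_map_on (S_wstar k n m f Q) \<phi> \<and>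
     completely_positive_on (N_space k n m f Q) (S_wstar k n m f Q) \<phi> \<and>
     continuous_map (subtopology (wstar_on (N_space k n m f Q)) (S_wstar k n m f Q)) wstar \<phi> \<and>
     (\<forall>\<alpha>\<in>mwords k n. \<forall>\<beta>\<in>mwords k n.
        \<phi> (S_mword k n m f Q \<alpha> \<bullet>\<^sub>o adj (S_mword k n m f Q \<beta>)) =
        mword_op bop_id k A \<alpha> \<bullet>\<^sub>o \<phi> (ortho_proj (N_space k n m f Q)) \<bullet>\<^sub>o adj (mword_op bop_id k A \<beta>))}"

section \<open>The Berezin transform\<close>

definition kernel ::
  "nat \<Rightarrow> (nat \<Rightarrow> nat) \<Rightarrow> (nat \<Rightarrow> nat) \<Rightarrow> (nat \<Rightarrow> nat list \<Rightarrow> real)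
     \<Rightarrow> (nat \<Rightarrow> nat \<Rightarrow> ('h::complex_hilbert, 'h) bop) \<Rightarrow> ('h, 'h) bop
     \<Rightarrow> ('h, (nat list list, 'h) l2) bop" where
  "kernel k n m f A R = (THE K. \<forall>h.
     ((\<lambda>w. (\<Prod>i<k. sqrt (b_coeff (f i) (m i) (w ! i))) *\<^sub>R
           (ket w \<otimes>\<^sub>v (sqrt_op R
              \<cdot> foldr (\<lambda>i T. adj (word_op bop_id (A i) (w ! i)) \<bullet>\<^sub>o T) [0..<k] bop_id \<cdot> h)))
      has_sum (K \<cdot> h)) (mwords k n))"

text \<open>
  The tensor product of \<open>N\<^sub>Q\<close> with the closure of the range of \<open>R\<^sup>1\<^sup>/\<^sup>2\<close> is a closed subspace of
  \<^typ>\<open>(nat list list, 'h) l2\<close> containing the range of the constrained kernel and reducing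
  \<open>\<chi> \<otimes> I\<close>, so both may be taken on the larger space.
\<close>

definition constrained_kernel ::
  "nat \<Rightarrow> (nat \<Rightarrow> nat) \<Rightarrow> (nat \<Rightarrow> nat) \<Rightarrow> (nat \<Rightarrow> nat list \<Rightarrow> real)
     \<Rightarrow> (nat list list \<Rightarrow>\<^sub>0 complex) set
     \<Rightarrow> (nat \<Rightarrow> nat \<Rightarrow> ('h::complex_hilbert, 'h) bop) \<Rightarrow> ('h, 'h) bop
     \<Rightarrow> ('h, (nat list list, 'h) l2) bop" where
  "constrained_kernel k n m f Q A R = tensor_id (ortho_proj (N_space k n m f Q)) \<bullet>\<^sub>o kernel k n m f A R"

definition berezin ::
  "nat \<Rightarrow> (nat \<Rightarrow> nat) \<Rightarrow> (nat \<Rightarrow> nat) \<Rightarrow> (nat \<Rightarrow> nat list \<Rightarrow> real)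
     \<Rightarrow> (nat list list \<Rightarrow>\<^sub>0 complex) set
     \<Rightarrow> (nat \<Rightarrow> nat \<Rightarrow> ('h::complex_hilbert, 'h) bop) \<Rightarrow> ('h, 'h) bop
     \<Rightarrow> (fock, fock) bop \<Rightarrow> ('h, 'h) bop" where
  "berezin k n m f Q A R T =
     adj (constrained_kernel k n m f Q A R) \<bullet>\<^sub>o tensor_id T \<bullet>\<^sub>o constrained_kernel k n m f Q A R"

end

theory Submission
  imports Defs
begin

text \<open>
  For pure \<open>D\<close> and \<open>R = \<Delta>\<^sup>m(D)\<close>, summing geometric series one coordinate at a time gives
  \<open>D = \<Sum>\<^sub>w b\<^sub>w A\<^sub>w R A\<^sub>w\<^sup>*\<close>; the partial defects met on the way lie below \<open>D\<close> and so inherit purity.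
  Hence \<open>K\<^sup>*K = D\<close> for the kernel \<open>K\<close>. As \<open>K\<close> intertwines \<open>A\<^sub>i\<^sub>j\<^sup>*\<close> with \<open>W\<^sub>i\<^sub>j\<^sup>* \<otimes> I\<close>, the relations
  \<open>q(A) = 0\<close> force its range into \<open>N\<^sub>Q \<otimes> H\<close>, so \<open>K\<close> is already the constrained kernel and
  \<open>K\<^sup>*(S\<^sub>\<alpha> S\<^sub>\<beta>\<^sup>* \<otimes> I)K = A\<^sub>\<alpha> D A\<^sub>\<beta>\<^sup>*\<close>. Slicing \<open>H\<close> along a countable Parseval sequence turns
  \<open>K\<^sup>*(\<chi> \<otimes> I)K\<close> into \<open>V\<^sup>*(I \<otimes> \<chi>)V\<close> with \<open>V : H \<rightarrow> l\<^sup>2(\<nat>, N\<^sub>Q)\<close>, which is visibly completely positive and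
  \<open>w*\<close>-continuous.

  Conversely, a map \<open>\<phi>\<close> as in the theorem carries \<open>\<Phi>\<close> of \<open>S\<close> to \<open>\<Phi>\<close> of \<open>A\<close>, so \<open>\<Delta>\<^sup>p(\<phi>(I)) = \<phi>(\<Delta>\<^sup>p(I))\<close>. On
  \<open>N\<^sub>Q\<close> the quadratic form of \<open>\<Delta>\<^sup>p(I)\<close> is diagonal: up to the factor \<open>1 / b\<^sub>w\<close>, each \<open>\<Phi>\<close> convolves the entries
  with \<open>f\<^sub>i\<close>, and \<open>b\<close> collects the coefficients of \<open>(1 - f\<^sub>i)\<close> to the power \<open>-m\<^sub>i\<close>. So \<open>\<Delta>\<^sup>p(I)\<close> has the
  nonnegative entries belonging to the powers \<open>-(m\<^sub>i - p\<^sub>i)\<close>, and the iterates of \<open>\<Phi>\<close> on \<open>I\<close> tend to \<open>0\<close>.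
\<close>

section \<open>Complex Hilbert spaces\<close>

text \<open>Adjoints, projections, square roots, \<open>tensor_id\<close>, \<open>W_op\<close>,
  \<open>Phi\<close> and \<open>kernel\<close> are definite descriptions, so a bounded operator has
  to be constructed for each. Most of them come from one device, the column
  \<open>x \<mapsto> (T i x)\<close> with a bound on its square sums (\<open>col_op\<close>).
  Convergence of \<Phi> is assumed only at the identity and only in the weak operator topology,
  while the maps in \<open>CP_wstar\<close> are merely weak* continuous. The sum at the identity is
  therefore read as a bound for a column \<open>V\<close>; the formula
  \<open>\<Phi>(Y) = adj V (I \<otimes> Y) V\<close> then gives weak* convergence for every
  \<open>Y\<close>. Defects subtract, so their series cannot be rearranged freely. The
  rearrangements behind the coefficient identities are made on quadratic forms with nonnegative
  terms, where Tonelli applies; polarization leads back to operators. Weak* functionals are given by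
  sequences indexed by the naturals, so \<open>T \<otimes> I\<close> is reached through countably
  many slices. This is where separability enters.\<close>

instance complex_hilbert \<subseteq> banach ..

lemma cinner_add_right: "cinner x (y + z) = cinner x y + cinner x z"
  by (subst (1 2 3) cinner_commute) (simp add: cinner_add_left)

lemma cinner_zero_left [simp]: "cinner 0 x = 0"
  using cinner_add_left[of 0 0 x] by simp

lemma cinner_zero_right [simp]: "cinner x 0 = 0"
  using cinner_add_right[of x 0 0] by simp

lemma cinner_minus_left [simp]: "cinner (- x) y = - cinner x y"
  using cinner_add_left[of x "- x" y] by (simp add: eq_neg_iff_add_eq_0 add.commute)

lemma cinner_minus_right [simp]: "cinner x (- y) = - cinner x y"
  using cinner_add_right[of x y "- y"] by (simp add: eq_neg_iff_add_eq_0 add.commute)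

lemma cinner_diff_left: "cinner (x - y) z = cinner x z - cinner y z"
  using cinner_add_left[of x "- y" z] by simp

lemma cinner_diff_right: "cinner x (y - z) = cinner x y - cinner x z"
  using cinner_add_right[of x y "- z"] by simp

lemma cinner_scaleR_left: "cinner (r *\<^sub>R x) y = of_real r * cinner x y"
  by (simp add: scaleR_scaleC cinner_scaleC_left)

lemma cinner_scaleR_right: "cinner x (r *\<^sub>R y) = of_real r * cinner x y"
  by (simp add: scaleR_scaleC cinner_scaleC_right)

lemma cinner_sum_left: "cinner (\<Sum>i\<in>I. f i) y = (\<Sum>i\<in>I. cinner (f i) y)"
  by (induction I rule: infinite_finite_induct) (simp_all add: cinner_add_left)

lemma cinner_sum_right: "cinner y (\<Sum>i\<in>I. f i) = (\<Sum>i\<in>I. cinner y (f i))"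
  by (induction I rule: infinite_finite_induct) (simp_all add: cinner_add_right)

lemmas cinner_simps = cinner_add_left cinner_add_right cinner_diff_left cinner_diff_right
  cinner_scaleC_left cinner_scaleC_right cinner_scaleR_left cinner_scaleR_right

lemma cinner_eq_zero_commute: "cinner x y = 0 \<longleftrightarrow> cinner y x = 0"
  by (subst cinner_commute) simp

lemma cinner_self_eq_zero [simp]: "cinner x x = 0 \<longleftrightarrow> x = 0"
  by (simp add: cinner_self)

text \<open>A unimodular factor on \<open>x\<close> makes the inner product real and nonnegative,
  which reduces the claim to the Cauchy-Schwarz inequality for \<open>inner\<close>.\<close>

lemma cmod_cinner_le: "cmod (cinner x y) \<le> norm x * norm y"
proof (cases "cinner x y = 0")
  case False
  define u where "u = cnj (sgn (cinner x y))"
  have u: "cmod u = 1" using False by (simp add: u_def norm_sgn)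
  have "u * cinner x y = of_real ((cmod (cinner x y))\<^sup>2) / of_real (cmod (cinner x y))"
    unfolding u_def sgn_eq complex_norm_square by simp
  then have "u * cinner x y = of_real (cmod (cinner x y))"
    using False by (simp add: power2_eq_square)
  then have "cmod (cinner x y) = Re (cinner (u *\<^sub>C x) y)"
    by (simp add: cinner_scaleC_left)
  also have "\<dots> \<le> norm (u *\<^sub>C x) * norm y"
    unfolding Re_cinner by (rule norm_cauchy_schwarz)
  finally show ?thesis using u by (simp add: norm_scaleC)
qed simp

lemma bounded_bilinear_cinner: "bounded_bilinear (cinner :: 'a::complex_hilbert \<Rightarrow> 'a \<Rightarrow> complex)"
  by unfold_locales
     (auto simp: cinner_simps scaleR_conv_of_real intro!: exI[of _ 1] cmod_cinner_le)

lemmas bounded_linear_cinner_left = bounded_bilinear.bounded_linear_left[OF bounded_bilinear_cinner]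
lemmas bounded_linear_cinner_right = bounded_bilinear.bounded_linear_right[OF bounded_bilinear_cinner]
lemmas tendsto_cinner = bounded_bilinear.tendsto[OF bounded_bilinear_cinner]

lemma cinner_ext_left: "(\<And>z. cinner x z = cinner y z) \<Longrightarrow> x = y"
  using cinner_self_eq_zero[of "x - y"] by (simp add: cinner_diff_left)

lemma cinner_ext_right: "(\<And>z. cinner z x = cinner z y) \<Longrightarrow> x = y"
  using cinner_self_eq_zero[of "x - y"] by (simp add: cinner_diff_right)

section \<open>Polarization and the parallelogram law\<close>

lemma polarization4:
  assumes add: "\<And>x y z. B (x + y) z = B x z + B y z" "\<And>x y z. B x (y + z) = B x y + B x z"
    and sc: "\<And>c x y. B (c *\<^sub>C x) y = c * B x y" "\<And>c x y. B x (c *\<^sub>C y) = cnj c * B x y"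
  shows "4 * B x y = B (x + y) (x + y) - B (x - y) (x - y)
     + \<i> * B (x + \<i> *\<^sub>C y) (x + \<i> *\<^sub>C y) - \<i> * B (x - \<i> *\<^sub>C y) (x - \<i> *\<^sub>C y)"
proof -
  have diff: "B (x - y) z = B x z - B y z" "B z (x - y) = B z x - B z y" for x y z
    using add(1)[of "x - y" y z] add(2)[of z "x - y" y] by simp_all
  show ?thesis by (simp add: add diff sc algebra_simps)
qed

text \<open>The four vectors are those of the polarization identity. Together the two identities
  bound a sesquilinear form by its quadratic form, see \<open>pos_form_le\<close>.\<close>

lemma parallelogram4:
  fixes x y :: "'a::complex_hilbert"
  shows "(norm (x + y))\<^sup>2 + (norm (x - y))\<^sup>2 + (norm (x + \<i> *\<^sub>C y))\<^sup>2 + (norm (x - \<i> *\<^sub>C y))\<^sup>2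
    = 4 * (norm x)\<^sup>2 + 4 * (norm y)\<^sup>2"
proof -
  have "complex_of_real ((norm (x + y))\<^sup>2 + (norm (x - y))\<^sup>2 + (norm (x + \<i> *\<^sub>C y))\<^sup>2
      + (norm (x - \<i> *\<^sub>C y))\<^sup>2) = of_real (4 * (norm x)\<^sup>2 + 4 * (norm y)\<^sup>2)"
    unfolding of_real_add cinner_self[symmetric] of_real_mult
    by (simp add: cinner_simps algebra_simps)
  then show ?thesis unfolding of_real_eq_iff .
qed

section \<open>The algebra of bounded operators\<close>

lemma bop_add_right: "T \<cdot> (x + y) = T \<cdot> x + T \<cdot> y"
  by transfer (rule blinfun.add_right)

lemma bop_scaleC_right: "T \<cdot> (c *\<^sub>C x) = c *\<^sub>C (T \<cdot> x)"
  by transfer simp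

lemma bop_scaleR_right: "T \<cdot> (r *\<^sub>R x) = r *\<^sub>R (T \<cdot> x)"
  by transfer (rule blinfun.scaleR_right)

lemma bop_zero_right [simp]: "T \<cdot> 0 = 0"
  by transfer (rule blinfun.zero_right)

lemma bop_diff_right: "T \<cdot> (x - y) = T \<cdot> x - T \<cdot> y"
  by transfer (rule blinfun.diff_right)

lemma bop_sum_right: "T \<cdot> (\<Sum>i\<in>I. f i) = (\<Sum>i\<in>I. T \<cdot> f i)"
  by (induction I rule: infinite_finite_induct) (simp_all add: bop_add_right)

lemma bounded_linear_bop: "bounded_linear (\<lambda>x. T \<cdot> x)"
  by transfer (simp add: blinfun.bounded_linear_right)

lemma bop_apply_zero [simp]: "0 \<cdot> x = 0"
  by transfer simp

lemma bop_apply_uminus: "(- T) \<cdot> x = - (T \<cdot> x)"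
  by transfer (simp add: blinfun.minus_left)

lemma bop_apply_minus: "(S - T) \<cdot> x = S \<cdot> x - T \<cdot> x"
  by transfer (simp add: blinfun.diff_left)

lemma bop_apply_id [simp]: "bop_id \<cdot> x = x"
  by transfer simp

lemma bop_apply_comp [simp]: "(S \<bullet>\<^sub>o T) \<cdot> x = S \<cdot> (T \<cdot> x)"
  by transfer simp

lemma bop_apply_sum: "(\<Sum>i\<in>I. f i) \<cdot> x = (\<Sum>i\<in>I. f i \<cdot> x)"
  by (induction I rule: infinite_finite_induct) (simp_all add: bop_apply_plus)

lemmas bop_apply_simps = bop_apply_plus bop_apply_minus bop_apply_uminus bop_apply_scaleR
  bop_apply_scaleC bop_apply_sum

lemma bop_comp_assoc: "(R \<bullet>\<^sub>o S) \<bullet>\<^sub>o T = R \<bullet>\<^sub>o (S \<bullet>\<^sub>o T)"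
  by (rule bop_eqI) simp

lemma bop_comp_id [simp]: "T \<bullet>\<^sub>o bop_id = T" "bop_id \<bullet>\<^sub>o T = T"
  by (rule bop_eqI; simp)+

lemma bop_comp_zero [simp]: "T \<bullet>\<^sub>o 0 = 0" "0 \<bullet>\<^sub>o T = 0"
  by (rule bop_eqI; simp)+

lemma ex_bop:
  assumes "bounded_linear f" "\<And>c x. f (c *\<^sub>C x) = c *\<^sub>C f x"
  shows "\<exists>T. \<forall>x. T \<cdot> x = f x"
proof -
  have "bop_apply (Abs_bop (Blinfun f)) = f"
    using assms by (simp add: bop_apply.rep_eq Abs_bop_inverse bounded_linear_Blinfun_apply)
  then show ?thesis by (metis)
qed

definition bop_norm :: "('a::complex_hilbert, 'b::complex_hilbert) bop \<Rightarrow> real" where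
  "bop_norm T = norm (blinfun_of_bop T)"

lemma bop_norm_nonneg [simp]: "0 \<le> bop_norm T"
  by (simp add: bop_norm_def)

lemma norm_bop_le: "norm (T \<cdot> x) \<le> bop_norm T * norm x"
  unfolding bop_norm_def by transfer (rule norm_blinfun)

lemma cmod_cinner_bop_le: "cmod (cinner (T \<cdot> x) y) \<le> bop_norm T * norm x * norm y"
  by (rule order_trans[OF cmod_cinner_le mult_right_mono[OF norm_bop_le]]) simp

lemma tendsto_bop: "(f \<longlongrightarrow> l) F \<Longrightarrow> ((\<lambda>i. T \<cdot> f i) \<longlongrightarrow> T \<cdot> l) F"
  by (rule bounded_linear.tendsto[OF bounded_linear_bop])

lemma bop_eqI_cinner: "(\<And>x y. cinner (S \<cdot> x) y = cinner (T \<cdot> x) y) \<Longrightarrow> S = T"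
  by (rule bop_eqI, rule cinner_ext_left)

lemma bop_form_polarization:
  "4 * cinner (T \<cdot> x) y = cinner (T \<cdot> (x + y)) (x + y)
     - cinner (T \<cdot> (x - y)) (x - y)
     + \<i> * cinner (T \<cdot> (x + \<i> *\<^sub>C y)) (x + \<i> *\<^sub>C y)
     - \<i> * cinner (T \<cdot> (x - \<i> *\<^sub>C y)) (x - \<i> *\<^sub>C y)"
  by (rule polarization4[of "\<lambda>x. cinner (T \<cdot> x)"])
     (simp_all add: cinner_simps bop_add_right bop_scaleC_right)

abbreviation qform :: "('a::complex_hilbert, 'a) bop \<Rightarrow> 'a \<Rightarrow> real" where
  "qform T x \<equiv> Re (cinner (T \<cdot> x) x)"

text \<open>Over the complex numbers polarization recovers the whole form from its diagonal, without
  any self-adjointness.\<close>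

lemma bop_eqI_quadratic:
  assumes "\<And>x. cinner (S \<cdot> x) x = cinner (T \<cdot> x) x"
  shows "S = T"
proof (rule bop_eqI_cinner)
  fix x y
  show "cinner (S \<cdot> x) y = cinner (T \<cdot> x) y"
    using bop_form_polarization[of S x y] bop_form_polarization[of T x y] unfolding assms
    by (metis mult_left_cancel zero_neq_numeral)
qed

section \<open>Projections, adjoints and square roots\<close>

text \<open>A sequence in \<open>M\<close> that minimizes the distance to \<open>x\<close> is Cauchy
  by the parallelogram law, and its limit is the foot of the perpendicular. The real version serves
  both the Riesz representation and the complex projections.\<close>

lemma orthogonal_decomposition:
  fixes M :: "'a::{real_inner,complete_space} set"
  assumes M: "subspace M" "closed M"
  shows "\<exists>y\<in>M. \<forall>z\<in>M. inner (x - y) z = 0"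
proof -
  define D where "D = (\<lambda>y. (norm (x - y))\<^sup>2) ` M"
  define d where "d = Inf D"
  have ne: "D \<noteq> {}" and bdd: "bdd_below D"
    using subspace_0[OF M(1)] by (auto simp: D_def intro!: bdd_belowI[of _ 0])
  have d_le: "d \<le> (norm (x - y))\<^sup>2" if "y \<in> M" for y
    unfolding d_def by (rule cInf_lower) (use that bdd in \<open>auto simp: D_def\<close>)
  have "\<exists>y\<in>M. (norm (x - y))\<^sup>2 < d + 1 / real (Suc n)" for n
    using cInf_lessD[OF ne, of "d + 1 / real (Suc n)"] by (auto simp: d_def[symmetric]) (auto simp: D_def)
  then obtain y where y: "\<And>n. y n \<in> M" "\<And>n. (norm (x - y n))\<^sup>2 < d + 1 / real (Suc n)"
    by metis
  \<comment> \<open>The parallelogram law for \<open>x - y i\<close> and \<open>x - y j\<close>; the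
    midpoint lies in \<open>M\<close>, so its squared distance to \<open>x\<close> is at least
    \<open>d\<close>.\<close>
  have par: "(norm (y i - y j))\<^sup>2 < 2 / real (Suc i) + 2 / real (Suc j)" for i j
  proof -
    have "(1/2) *\<^sub>R (y i + y j) \<in> M"
      using y M by (simp add: subspace_scale subspace_add)
    then have "d \<le> (norm (x - (1/2) *\<^sub>R (y i + y j)))\<^sup>2" by (rule d_le)
    moreover have "(norm (y i - y j))\<^sup>2 = 2 * (norm (x - y i))\<^sup>2 + 2 * (norm (x - y j))\<^sup>2
        - 4 * (norm (x - (1/2) *\<^sub>R (y i + y j)))\<^sup>2"
      by (simp add: power2_norm_eq_inner inner_simps inner_commute field_simps)
    ultimately show ?thesis using y(2)[of i] y(2)[of j] by simp
  qed
  have "Cauchy y"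
  proof (rule metric_CauchyI)
    fix e :: real assume e: "0 < e"
    obtain N where N: "4 / e\<^sup>2 < real N" using reals_Archimedean2 by blast
    have "dist (y i) (y j) < e" if "i \<ge> N" "j \<ge> N" for i j
    proof -
      have s: "2 / real (Suc k) \<le> e\<^sup>2 / 2" if "k \<ge> N" for k
      proof -
        have "4 / e\<^sup>2 < real (Suc k)" using N that by linarith
        then have "4 < real (Suc k) * e\<^sup>2" using e by (simp add: divide_less_eq)
        then show ?thesis by (simp add: divide_simps del: of_nat_Suc) (simp add: mult.commute)
      qed
      have "(norm (y i - y j))\<^sup>2 < e\<^sup>2"
        using par[of i j] s[OF that(1)] s[OF that(2)] by linarith
      then show ?thesis using e by (simp add: dist_norm power_less_imp_less_base)
    qed
    then show "\<exists>M. \<forall>m\<ge>M. \<forall>n\<ge>M. dist (y m) (y n) < e" by blast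
  qed
  then obtain l where l: "y \<longlonglongrightarrow> l" using Cauchy_convergent_iff convergent_def by blast
  have lM: "l \<in> M" using M(2) y(1) l by (meson closed_sequentially)
  have "(norm (x - l))\<^sup>2 \<le> d"
  proof (rule LIMSEQ_le)
    show "(\<lambda>n. (norm (x - y n))\<^sup>2) \<longlonglongrightarrow> (norm (x - l))\<^sup>2" by (intro tendsto_intros l)
    show "(\<lambda>n. d + 1 / real (Suc n)) \<longlonglongrightarrow> d"
      using tendsto_add[OF tendsto_const LIMSEQ_Suc[OF lim_1_over_n]] by simp
    show "\<exists>N. \<forall>n\<ge>N. (norm (x - y n))\<^sup>2 \<le> d + 1 / real (Suc n)" using y(2) less_imp_le by blast
  qed
  have "inner (x - l) z = 0" if z: "z \<in> M" for z
  proof (cases "z = 0")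
    case False
    \<comment> \<open>The value of \<open>t\<close> that minimizes the distance from
      \<open>x\<close> to \<open>l + t *\<^sub>R z\<close>.\<close>
    define t where "t = inner (x - l) z / (norm z)\<^sup>2"
    have "l + t *\<^sub>R z \<in> M" using lM z M by (simp add: subspace_scale subspace_add)
    then have "(norm (x - l))\<^sup>2 \<le> (norm (x - (l + t *\<^sub>R z)))\<^sup>2"
      using d_le \<open>_ \<le> d\<close> by (blast intro: order_trans)
    also have "\<dots> = (norm (x - l))\<^sup>2 - 2 * t * inner (x - l) z + t\<^sup>2 * (norm z)\<^sup>2"
    proof -
      have "x - (l + t *\<^sub>R z) = (x - l) - t *\<^sub>R z" by simp
      then show ?thesis
        by (simp only: power2_norm_eq_inner inner_diff_left[of "x - l"] inner_diff_right[of _ "x - l"]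
            inner_scaleR_left inner_scaleR_right) (simp add: inner_commute power2_eq_square algebra_simps)
    qed
    also have "\<dots> = (norm (x - l))\<^sup>2 - (inner (x - l) z)\<^sup>2 / (norm z)\<^sup>2"
      using False by (simp add: t_def power2_eq_square field_simps)
    finally show ?thesis using False by (simp add: divide_le_0_iff)
  qed simp
  with lM show ?thesis by blast
qed

text \<open>The component \<open>u\<close> of a vector orthogonal to the closed kernel of
  \<open>f\<close> represents \<open>f\<close> up to a factor, because
  \<open>x - (f x / f u) *\<^sub>R u\<close> lies in the kernel.\<close>

lemma riesz_representation:
  fixes f :: "'a::{real_inner,complete_space} \<Rightarrow> real"
  assumes "bounded_linear f"
  shows "\<exists>z. \<forall>x. f x = inner x z"
proof (cases "\<forall>x. f x = 0")
  case True
  then show ?thesis by (intro exI[of _ 0]) simp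
next
  case False
  interpret bounded_linear f by fact
  obtain x0 where x0: "f x0 \<noteq> 0" using False by blast
  have "subspace {x. f x = 0}" by (auto simp: subspace_def add scaleR)
  moreover have "closed {x. f x = 0}"
    by (intro closed_Collect_eq continuous_on) (auto intro: continuous_on_id)
  ultimately obtain y where y: "f y = 0" "\<And>z. f z = 0 \<Longrightarrow> inner (x0 - y) z = 0"
    using orthogonal_decomposition[of "{x. f x = 0}" x0] by blast
  define u where "u = x0 - y"
  have fu: "f u \<noteq> 0" and u: "inner u z = 0" if "f z = 0" for z
    using x0 y that by (auto simp: u_def diff)
  have u0: "f u \<noteq> 0" using x0 y by (auto simp: u_def diff)
  then have nu: "norm u \<noteq> 0" using zero by force
  have "f x = inner x ((f u / (norm u)\<^sup>2) *\<^sub>R u)" for x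
  proof -
    have "f (x - (f x / f u) *\<^sub>R u) = 0" using u0 by (simp add: diff scaleR)
    then have "inner u (x - (f x / f u) *\<^sub>R u) = 0" by (rule u)
    then have "inner x u = f x / f u * (norm u)\<^sup>2"
      by (simp add: inner_simps inner_commute power2_norm_eq_inner)
    then show ?thesis using u0 nu by (simp add: field_simps)
  qed
  then show ?thesis by blast
qed

text \<open>The real Riesz representation matches the real parts; replacing \<open>x\<close> by
  \<open>\<i> *\<^sub>C x\<close> then matches the imaginary parts.\<close>

lemma adj_ex: "\<exists>S. \<forall>x y. cinner (T \<cdot> x) y = cinner x (S \<cdot> y)"
proof -
  have "\<exists>z. \<forall>x. inner (T \<cdot> x) y = inner x z" for y
    by (rule riesz_representation)
       (rule bounded_linear_compose[OF bounded_linear_inner_left bounded_linear_bop])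
  then obtain g where g: "\<And>x y. inner (T \<cdot> x) y = inner x (g y)" by metis
  have c: "cinner (T \<cdot> x) y = cinner x (g y)" for x y
  proof (rule complex_eqI)
    show "Re (cinner (T \<cdot> x) y) = Re (cinner x (g y))" using g by (simp add: Re_cinner)
    have "Re (cinner (T \<cdot> (\<i> *\<^sub>C x)) y) = Re (cinner (\<i> *\<^sub>C x) (g y))" using g by (simp add: Re_cinner)
    then show "Im (cinner (T \<cdot> x) y) = Im (cinner x (g y))"
      by (simp add: bop_scaleC_right cinner_scaleC_left)
  qed
  have sc: "g (c *\<^sub>C y) = c *\<^sub>C g y" for c y
    by (rule cinner_ext_right) (simp add: c[symmetric] cinner_scaleC_right)
  have "bounded_linear g"
  proof (rule bounded_linear_intro[where K = "bop_norm T"])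
    show "g (x + y) = g x + g y" for x y
      by (rule cinner_ext_right) (simp add: c[symmetric] cinner_add_right)
    show "g (r *\<^sub>R x) = r *\<^sub>R g x" for r x by (simp add: scaleR_scaleC sc)
    show "norm (g y) \<le> norm y * bop_norm T" for y
    proof (cases "g y = 0")
      case False
      have "(norm (g y))\<^sup>2 = inner (T \<cdot> g y) y" by (simp add: g power2_norm_eq_inner)
      also have "\<dots> \<le> norm (T \<cdot> g y) * norm y" by (rule norm_cauchy_schwarz)
      also have "\<dots> \<le> (bop_norm T * norm (g y)) * norm y" by (intro mult_right_mono norm_bop_le) simp
      finally show ?thesis using False by (simp add: power2_eq_square mult.commute mult.left_commute)
    qed simp
  qed
  from ex_bop[OF this sc] c show ?thesis by metis
qed

lemma adj_unique:
  assumes "\<And>x y. cinner (T \<cdot> x) y = cinner x (S \<cdot> y)"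
  shows "adj T = S"
  unfolding adj_def
proof (rule the_equality)
  show "\<forall>x y. cinner (T \<cdot> x) y = cinner x (S \<cdot> y)" using assms by blast
  show "S' = S" if "\<forall>x y. cinner (T \<cdot> x) y = cinner x (S' \<cdot> y)" for S'
    by (rule bop_eqI, rule cinner_ext_right) (use that assms in metis)
qed

lemma cinner_adj_right: "cinner x (adj T \<cdot> y) = cinner (T \<cdot> x) y"
  using adj_ex[of T] adj_unique[of T] by metis

lemma cinner_adj_left: "cinner (adj T \<cdot> x) y = cinner x (T \<cdot> y)"
  by (subst (1 2) cinner_commute) (simp add: cinner_adj_right)

lemma adj_adj [simp]: "adj (adj T) = T"
  by (rule adj_unique) (simp add: cinner_adj_left)

lemma adj_comp [simp]: "adj (S \<bullet>\<^sub>o T) = adj T \<bullet>\<^sub>o adj S"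
  by (rule adj_unique) (simp add: cinner_adj_right)

lemma adj_id [simp]: "adj bop_id = bop_id"
  by (rule adj_unique) simp

section \<open>Orthogonal projections onto closed subspaces\<close>

lemma ortho_proj_ex:
  assumes M: "complex_vec.subspace M" "closed M"
  shows "\<exists>P. \<forall>x. P \<cdot> x \<in> M \<and> (\<forall>y\<in>M. cinner (x - P \<cdot> x) y = 0)"
proof -
  have sub: "subspace M"
    using M(1) by (auto simp: subspace_def complex_vec.subspace_def scaleR_scaleC)
  obtain p where p: "\<And>x. p x \<in> M" "\<And>x z. z \<in> M \<Longrightarrow> inner (x - p x) z = 0"
    using orthogonal_decomposition[OF sub M(2)] by metis
  have c: "cinner (x - p x) z = 0" if z: "z \<in> M" for x z
  proof (rule complex_eqI)
    show "Re (cinner (x - p x) z) = Re 0" using p(2)[OF z] by (simp add: Re_cinner)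
    have "\<i> *\<^sub>C z \<in> M" using z M by (simp add: complex_vec.subspace_scale)
    then show "Im (cinner (x - p x) z) = Im 0" using p(2) by (simp add: Im_cinner Re_cinner del: cinner_diff_left)
  qed
  have uniq: "p x = y" if "y \<in> M" "\<And>z. z \<in> M \<Longrightarrow> cinner (x - y) z = 0" for x y
  proof -
    have "p x - y \<in> M" using p that M by (simp add: complex_vec.subspace_diff)
    then have "cinner (x - y) (p x - y) - cinner (x - p x) (p x - y) = 0" using c that by simp
    then have "cinner (p x - y) (p x - y) = 0" unfolding cinner_diff_left[symmetric] by simp
    then show ?thesis by simp
  qed
  have sc: "p (c *\<^sub>C x) = c *\<^sub>C p x" for c x
  proof (rule uniq)
    show "c *\<^sub>C p x \<in> M" using p M by (simp add: complex_vec.subspace_scale)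
    show "cinner (c *\<^sub>C x - c *\<^sub>C p x) z = 0" if "z \<in> M" for z
      using c[OF that, of x] by (simp add: complex_vec.scale_right_diff_distrib[symmetric] cinner_scaleC_left)
  qed
  have "bounded_linear p"
  proof (rule bounded_linear_intro[where K = 1])
    show "p (x + y) = p x + p y" for x y
    proof (rule uniq)
      show "p x + p y \<in> M" using p M by (simp add: complex_vec.subspace_add)
      show "cinner (x + y - (p x + p y)) z = 0" if "z \<in> M" for z
        using c[OF that, of x] c[OF that, of y] by (simp add: cinner_simps)
    qed
    show "p (r *\<^sub>R x) = r *\<^sub>R p x" for r x by (simp add: scaleR_scaleC sc)
    show "norm (p x) \<le> norm x * 1" for x
    proof -
      have "cinner (x - p x) (p x) = 0" using c p by blast
      then have "(norm (p x))\<^sup>2 = inner x (p x)"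
        by (simp add: power2_norm_eq_inner Re_cinner[symmetric] cinner_simps)
      also have "\<dots> \<le> norm x * norm (p x)" by (rule norm_cauchy_schwarz)
      finally show ?thesis
        by (cases "p x = 0") (auto simp: power2_eq_square)
    qed
  qed
  from ex_bop[OF this sc] p c show ?thesis by metis
qed

lemma ortho_proj_unique:
  assumes M: "complex_vec.subspace M" and "\<And>x. P \<cdot> x \<in> M" "\<And>x y. y \<in> M \<Longrightarrow> cinner (x - P \<cdot> x) y = 0"
  shows "ortho_proj M = P"
  unfolding ortho_proj_def
proof (rule the_equality)
  show "\<forall>x. P \<cdot> x \<in> M \<and> (\<forall>y\<in>M. cinner (x - P \<cdot> x) y = 0)" using assms by blast
  fix P' assume P': "\<forall>x. P' \<cdot> x \<in> M \<and> (\<forall>y\<in>M. cinner (x - P' \<cdot> x) y = 0)"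
  show "P' = P"
  proof (rule bop_eqI)
    fix x
    have "P' \<cdot> x - P \<cdot> x \<in> M" using P' assms by (simp add: complex_vec.subspace_diff)
    then have "cinner (x - P \<cdot> x) (P' \<cdot> x - P \<cdot> x) - cinner (x - P' \<cdot> x) (P' \<cdot> x - P \<cdot> x) = 0"
      using P' assms by simp
    then have "cinner (P' \<cdot> x - P \<cdot> x) (P' \<cdot> x - P \<cdot> x) = 0" unfolding cinner_diff_left[symmetric] by simp
    then show "P' \<cdot> x = P \<cdot> x" by simp
  qed
qed

context
  fixes M :: "'a::complex_hilbert set"
  assumes M: "complex_vec.subspace M" "closed M"
begin

lemma ortho_proj_in: "ortho_proj M \<cdot> x \<in> M"
  and ortho_proj_orth: "y \<in> M \<Longrightarrow> cinner (x - ortho_proj M \<cdot> x) y = 0"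
  using ortho_proj_ex[OF M] ortho_proj_unique[OF M(1)] by metis+

lemma ortho_proj_id: "x \<in> M \<Longrightarrow> ortho_proj M \<cdot> x = x"
proof -
  assume x: "x \<in> M"
  have "x - ortho_proj M \<cdot> x \<in> M"
    using x ortho_proj_in M by (simp add: complex_vec.subspace_diff)
  then have "cinner (x - ortho_proj M \<cdot> x) (x - ortho_proj M \<cdot> x) = 0" by (rule ortho_proj_orth)
  then show ?thesis by simp
qed

lemma ortho_proj_idem [simp]: "ortho_proj M \<bullet>\<^sub>o ortho_proj M = ortho_proj M"
  by (rule bop_eqI) (simp add: ortho_proj_id ortho_proj_in)

lemma ortho_proj_selfadj [simp]: "adj (ortho_proj M) = ortho_proj M"
proof (rule adj_unique)
  fix x y
  have "cinner (x - ortho_proj M \<cdot> x) (ortho_proj M \<cdot> y) = 0"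
    and "cinner (y - ortho_proj M \<cdot> y) (ortho_proj M \<cdot> x) = 0"
    by (intro ortho_proj_orth ortho_proj_in)+
  then show "cinner (ortho_proj M \<cdot> x) y = cinner x (ortho_proj M \<cdot> y)"
    by (simp add: cinner_simps) (metis cinner_commute)
qed

lemma norm_ortho_proj_le: "norm (ortho_proj M \<cdot> x) \<le> norm x"
proof -
  have "(norm (ortho_proj M \<cdot> x))\<^sup>2 = inner x (ortho_proj M \<cdot> x)"
    using ortho_proj_orth[OF ortho_proj_in, of x x]
    by (simp add: power2_norm_eq_inner Re_cinner[symmetric] cinner_simps)
  also have "\<dots> \<le> norm x * norm (ortho_proj M \<cdot> x)" by (rule norm_cauchy_schwarz)
  finally show ?thesis
    by (cases "ortho_proj M \<cdot> x = 0") (auto simp: power2_eq_square)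
qed

end

section \<open>Positive operators and their square roots\<close>

lemma pos_op_iff: "pos_op T \<longleftrightarrow> (\<forall>x. cinner (T \<cdot> x) x = of_real (qform T x) \<and> 0 \<le> qform T x)"
  unfolding pos_op_def complex_nonneg_Reals_iff by (auto simp: complex_eq_iff)

lemma pos_op_Re: "pos_op T \<Longrightarrow> 0 \<le> qform T x"
  by (simp add: pos_op_iff)

lemma pos_op_selfadj: "pos_op T \<Longrightarrow> adj T = T"
  by (rule bop_eqI_quadratic) (metis cinner_adj_left cinner_commute complex_cnj_complex_of_real pos_op_iff)

lemma pos_op_sym: "pos_op T \<Longrightarrow> cinner (T \<cdot> x) y = cinner x (T \<cdot> y)"
  using cinner_adj_left[of T x y] by (simp add: pos_op_selfadj)

lemma selfadj_cinner_real: "adj T = T \<Longrightarrow> cinner (T \<cdot> x) x = of_real (qform T x)"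
  using cinner_adj_left[of T x x] cinner_commute[of x "T \<cdot> x"] by (simp add: complex_eq_iff)

text \<open>Scalar majorant of \<open>op_sqrt_iter\<close>: the operator \<open>A\<close> is
  replaced by the bound 1 on its norm. Being monotone and bounded, it is Cauchy, and this forces the
  operator iterates to converge.\<close>

definition csqrt_iter :: "nat \<Rightarrow> real" where
  "csqrt_iter n = ((\<lambda>x. (1 + x\<^sup>2) / 2) ^^ n) 0"

lemma csqrt_iter_Suc: "csqrt_iter (Suc n) = (1 + (csqrt_iter n)\<^sup>2) / 2"
  by (simp add: csqrt_iter_def)

lemma csqrt_iter_bounds: "0 \<le> csqrt_iter n \<and> csqrt_iter n \<le> 1"
proof (induction n)
  case (Suc n)
  then have "(csqrt_iter n)\<^sup>2 \<le> 1" by (simp add: power_le_one)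
  then show ?case by (simp add: csqrt_iter_Suc)
qed (simp add: csqrt_iter_def)

lemma csqrt_iter_mono: "csqrt_iter n \<le> csqrt_iter (Suc n)"
proof (induction n)
  case (Suc n)
  then show ?case
    unfolding csqrt_iter_Suc[of "Suc n"] csqrt_iter_Suc[of n] using csqrt_iter_bounds[of n]
    by (simp add: power_mono csqrt_iter_Suc)
qed (simp add: csqrt_iter_def)

lemma csqrt_iter_Cauchy: "Cauchy csqrt_iter"
proof -
  have "incseq csqrt_iter" using csqrt_iter_mono by (rule incseq_SucI)
  moreover have "Bseq csqrt_iter" using csqrt_iter_bounds by (intro BseqI[of 1]) auto
  ultimately show ?thesis by (simp add: Bseq_monoseq_convergent convergent_Cauchy monoseq_iff)
qed

definition op_sqrt_iter :: "('a::complex_hilbert, 'a) bop \<Rightarrow> nat \<Rightarrow> ('a, 'a) bop" where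
  "op_sqrt_iter A n = ((\<lambda>X. (1/2) *\<^sub>R (A + X \<bullet>\<^sub>o X)) ^^ n) 0"

lemma op_sqrt_iter_0 [simp]: "op_sqrt_iter A 0 = 0"
  and op_sqrt_iter_Suc: "op_sqrt_iter A (Suc n) \<cdot> x =
    (1/2) *\<^sub>R (A \<cdot> x + op_sqrt_iter A n \<cdot> (op_sqrt_iter A n \<cdot> x))"
  by (simp_all add: op_sqrt_iter_def bop_apply_simps)

context
  fixes A :: "('a::complex_hilbert, 'a) bop"
  assumes A_le: "norm (A \<cdot> x) \<le> norm x"
begin

lemma op_sqrt_iter_norm: "norm (op_sqrt_iter A n \<cdot> x) \<le> csqrt_iter n * norm x"
proof (induction n arbitrary: x)
  case (Suc n)
  have "norm (op_sqrt_iter A n \<cdot> (op_sqrt_iter A n \<cdot> x)) \<le> csqrt_iter n * (csqrt_iter n * norm x)"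
    by (rule order_trans[OF Suc mult_left_mono[OF Suc]]) (simp add: csqrt_iter_bounds)
  then have "norm (A \<cdot> x + op_sqrt_iter A n \<cdot> (op_sqrt_iter A n \<cdot> x)) \<le> norm x + csqrt_iter n * (csqrt_iter n * norm x)"
    using A_le[of x] by (intro order_trans[OF norm_triangle_ineq]) linarith
  then show ?case
    unfolding op_sqrt_iter_Suc norm_scaleR by (simp add: csqrt_iter_Suc power2_eq_square field_simps)
qed (simp add: csqrt_iter_bounds)

text \<open>The identity \<open>Y\<^sup>2 - X\<^sup>2 = Y (Y - X) + (Y - X) X\<close> holds without
  commutation. Bounding each factor by its scalar counterpart gives the increment of the scalar
  iteration.\<close>

lemma op_sqrt_iter_step:
  "norm (op_sqrt_iter A (Suc n) \<cdot> x - op_sqrt_iter A n \<cdot> x)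
     \<le> (csqrt_iter (Suc n) - csqrt_iter n) * norm x"
proof (induction n arbitrary: x)
  case 0
  show ?case using A_le[of x] by (simp add: op_sqrt_iter_Suc csqrt_iter_Suc) (simp add: csqrt_iter_def)
next
  case (Suc n)
  let ?X = "op_sqrt_iter A n" and ?Y = "op_sqrt_iter A (Suc n)"
  let ?a = "csqrt_iter n" and ?b = "csqrt_iter (Suc n)"
  have eq: "op_sqrt_iter A (Suc (Suc n)) \<cdot> x - ?Y \<cdot> x =
      (1/2) *\<^sub>R (?Y \<cdot> (?Y \<cdot> x - ?X \<cdot> x) + (?Y \<cdot> (?X \<cdot> x) - ?X \<cdot> (?X \<cdot> x)))"
  proof -
    have a: "op_sqrt_iter A (Suc (Suc n)) \<cdot> x = (1/2) *\<^sub>R (A \<cdot> x + ?Y \<cdot> (?Y \<cdot> x))"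
      by (rule op_sqrt_iter_Suc)
    have b: "A \<cdot> x = 2 *\<^sub>R (?Y \<cdot> x) - ?X \<cdot> (?X \<cdot> x)"
      by (simp add: op_sqrt_iter_Suc)
    show ?thesis unfolding a b by (simp add: bop_diff_right algebra_simps)
  qed
  have "norm (?Y \<cdot> (?Y \<cdot> x - ?X \<cdot> x)) \<le> ?b * ((?b - ?a) * norm x)"
    by (rule order_trans[OF op_sqrt_iter_norm mult_left_mono[OF Suc]]) (simp add: csqrt_iter_bounds)
  moreover have "norm (?Y \<cdot> (?X \<cdot> x) - ?X \<cdot> (?X \<cdot> x)) \<le> (?b - ?a) * (?a * norm x)"
    by (rule order_trans[OF Suc mult_left_mono[OF op_sqrt_iter_norm]]) (simp add: csqrt_iter_mono)
  ultimately have "norm (op_sqrt_iter A (Suc (Suc n)) \<cdot> x - ?Y \<cdot> x)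
      \<le> (1/2) * (?b * ((?b - ?a) * norm x) + (?b - ?a) * (?a * norm x))"
    unfolding eq norm_scaleR by (intro mult_mono order_trans[OF norm_triangle_ineq]) auto
  also have "\<dots> = (csqrt_iter (Suc (Suc n)) - ?b) * norm x"
    unfolding csqrt_iter_Suc[of "Suc n"] by (subst (5) csqrt_iter_Suc) (simp add: algebra_simps power2_eq_square)
  finally show ?case .
qed

lemma op_sqrt_iter_diff:
  assumes "i \<le> j"
  shows "norm (op_sqrt_iter A j \<cdot> x - op_sqrt_iter A i \<cdot> x) \<le> (csqrt_iter j - csqrt_iter i) * norm x"
  using assms
proof (induction j rule: dec_induct)
  case (step j)
  have "norm (op_sqrt_iter A (Suc j) \<cdot> x - op_sqrt_iter A i \<cdot> x)
      \<le> norm (op_sqrt_iter A (Suc j) \<cdot> x - op_sqrt_iter A j \<cdot> x) + norm (op_sqrt_iter A j \<cdot> x - op_sqrt_iter A i \<cdot> x)"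
    by (rule order_trans[OF _ norm_triangle_ineq]) simp
  also have "\<dots> \<le> (csqrt_iter (Suc j) - csqrt_iter j) * norm x + (csqrt_iter j - csqrt_iter i) * norm x"
    by (intro add_mono step op_sqrt_iter_step)
  finally show ?case by (simp add: algebra_simps)
qed simp

lemma op_sqrt_iter_convergent: "convergent (\<lambda>n. op_sqrt_iter A n \<cdot> x)"
proof -
  have "Cauchy (\<lambda>n. op_sqrt_iter A n \<cdot> x)"
  proof (rule metric_CauchyI)
    fix e :: real assume e: "0 < e"
    have "0 < e / (norm x + 1)" using e by (simp add: add_nonneg_pos)
    then obtain N where N: "\<And>i j. i \<ge> N \<Longrightarrow> j \<ge> N \<Longrightarrow> dist (csqrt_iter i) (csqrt_iter j) < e / (norm x + 1)"
      using csqrt_iter_Cauchy unfolding Cauchy_def by meson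
    have *: "norm (op_sqrt_iter A j \<cdot> x - op_sqrt_iter A i \<cdot> x) < e" if "N \<le> i" "i \<le> j" for i j
    proof -
      have "\<bar>csqrt_iter j - csqrt_iter i\<bar> < e / (norm x + 1)" using N[of j i] that by (simp add: dist_real_def)
      then have "(csqrt_iter j - csqrt_iter i) * (norm x + 1) < e"
        by (simp add: pos_less_divide_eq add_nonneg_pos abs_less_iff)
      moreover have "csqrt_iter i \<le> csqrt_iter j"
        using \<open>i \<le> j\<close> by (induction j rule: dec_induct) (use csqrt_iter_mono order_trans in blast)+
      ultimately show ?thesis using op_sqrt_iter_diff[OF \<open>i \<le> j\<close>, of x] by (simp add: algebra_simps)
    qed
    show "\<exists>M. \<forall>m\<ge>M. \<forall>n\<ge>M. dist (op_sqrt_iter A m \<cdot> x) (op_sqrt_iter A n \<cdot> x) < e"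
      by (rule exI[of _ N]) (metis * dist_commute dist_norm nat_le_linear)
  qed
  then show ?thesis by (simp add: Cauchy_convergent_iff)
qed

lemma op_sqrt_limit:
  "\<exists>X. (\<forall>x. (\<lambda>n. op_sqrt_iter A n \<cdot> x) \<longlonglongrightarrow> X \<cdot> x) \<and> (\<forall>x. norm (X \<cdot> x) \<le> norm x)"
proof -
  obtain g where g: "\<And>x. (\<lambda>n. op_sqrt_iter A n \<cdot> x) \<longlonglongrightarrow> g x"
    using op_sqrt_iter_convergent unfolding convergent_def by metis
  have bound: "norm (g x) \<le> norm x" for x
  proof (rule LIMSEQ_le_const2[OF tendsto_norm[OF g]])
    have "norm (op_sqrt_iter A n \<cdot> x) \<le> norm x" for n
      using op_sqrt_iter_norm[of n x] mult_right_mono[of "csqrt_iter n" 1 "norm x"] csqrt_iter_bounds[of n]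
      by simp
    then show "\<exists>N. \<forall>n\<ge>N. norm (op_sqrt_iter A n \<cdot> x) \<le> norm x" by blast
  qed
  have "g (c *\<^sub>C x) = c *\<^sub>C g x" for c x
  proof (rule LIMSEQ_unique[OF g])
    have "bounded_linear (\<lambda>y::'a. c *\<^sub>C y)"
      by (rule bounded_linear_intro[where K = "cmod c"])
         (auto simp: scaleC_add_right scaleC_scaleR norm_scaleC)
    then show "(\<lambda>n. op_sqrt_iter A n \<cdot> c *\<^sub>C x) \<longlonglongrightarrow> c *\<^sub>C g x"
      using bounded_linear.tendsto[OF _ g] by (simp add: bop_scaleC_right)
  qed
  moreover have "bounded_linear g"
  proof (rule bounded_linear_intro[where K = 1])
    show "g (x + y) = g x + g y" for x y
      by (rule LIMSEQ_unique[OF g]) (use tendsto_add[OF g g] in \<open>simp add: bop_add_right\<close>)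
    show "g (r *\<^sub>R x) = r *\<^sub>R g x" for r x
      by (rule LIMSEQ_unique[OF g]) (use tendsto_scaleR[OF tendsto_const g] in \<open>simp add: bop_scaleR_right\<close>)
  qed (simp add: bound)
  ultimately obtain X where "\<And>x. X \<cdot> x = g x" using ex_bop by blast
  then show ?thesis by (intro exI[of _ X]) (simp add: g bound)
qed

end

lemma bop_norm_bound_pos: "0 < bop_norm T + 1"
  by (simp add: add_nonneg_pos)

text \<open>For \<open>B = I - R\<close> the quadratic form lies between 0 and the squared norm.
  Polarizing with a vector \<open>z\<close> parallel to \<open>B x\<close> and as long as
  \<open>x\<close> turns this into a norm bound.\<close>

lemma selfadj_contraction:
  assumes R: "pos_op R" and le: "\<And>x. qform R x \<le> (norm x)\<^sup>2"
  shows "norm ((bop_id - R) \<cdot> x) \<le> norm x"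
proof (cases "(bop_id - R) \<cdot> x = 0")
  case False
  define B where "B = bop_id - R"
  have sa: "adj B = B"
    by (rule adj_unique) (simp add: B_def bop_apply_simps cinner_simps pos_op_sym[OF R])
  have nn: "0 \<le> qform B y" and le1: "qform B y \<le> (norm y)\<^sup>2" for y
    using le[of y] pos_op_Re[OF R, of y] by (simp_all add: B_def bop_apply_simps cinner_simps cinner_self)
  \<comment> \<open>Chosen so that \<open>z\<close> has the norm of \<open>x\<close>; then the
    parallelogram-type estimate ends at \<open>4 * (norm x)\<^sup>2\<close>.\<close>
  define t where "t = norm x / norm (B \<cdot> x)"
  define z where "z = t *\<^sub>R (B \<cdot> x)"
  have nBx: "norm (B \<cdot> x) \<noteq> 0" using False by (simp add: B_def)
  have nz: "norm z = norm x" using nBx by (simp add: z_def t_def)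
  have re: "Re (cinner (B \<cdot> x) z) = t * (norm (B \<cdot> x))\<^sup>2"
    by (simp add: z_def cinner_simps cinner_self)
  have sym: "Re (cinner (B \<cdot> z) x) = Re (cinner (B \<cdot> x) z)"
    using cinner_adj_left[of B z x] cinner_commute[of z "B \<cdot> x"] by (simp add: sa)
  have "4 * Re (cinner (B \<cdot> x) z) = qform B (x + z) - qform B (x - z)"
    using sym by (simp add: cinner_simps bop_add_right bop_diff_right)
  also have "\<dots> \<le> (norm (x + z))\<^sup>2" using le1[of "x + z"] nn[of "x - z"] by linarith
  also have "\<dots> \<le> (norm x + norm z)\<^sup>2" by (simp add: norm_triangle_ineq power_mono)
  also have "\<dots> = 4 * (norm x)\<^sup>2" by (simp add: nz power2_eq_square)
  finally have "t * (norm (B \<cdot> x))\<^sup>2 \<le> (norm x)\<^sup>2" using re by simp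
  then have "norm x * norm (B \<cdot> x) \<le> (norm x)\<^sup>2" using nBx by (simp add: t_def power2_eq_square)
  moreover have "norm x \<noteq> 0" using nBx by auto
  ultimately show ?thesis by (simp add: B_def power2_eq_square)
qed simp

text \<open>The square root of a contraction \<open>R\<close> is \<open>I - X\<close>, where \<open>X\<close> is the limit of the iteration
  \<open>X \<mapsto> (A + X\<^sup>2) / 2\<close> with \<open>A = I - R\<close>; in norm it is dominated by the same iteration on numbers.\<close>

lemma sqrt_op_contraction_ex:
  assumes R: "pos_op R" and le: "\<And>x. qform R x \<le> (norm x)\<^sup>2"
  shows "\<exists>S. pos_op S \<and> S \<bullet>\<^sub>o S = R \<and> (\<forall>T. T \<bullet>\<^sub>o R = R \<bullet>\<^sub>o T \<longrightarrow> T \<bullet>\<^sub>o S = S \<bullet>\<^sub>o T)"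
proof -
  define A where "A = bop_id - R"
  have A_le: "norm (A \<cdot> x) \<le> norm x" for x
    unfolding A_def by (rule selfadj_contraction[OF R le])
  obtain X where X: "\<And>x. (\<lambda>n. op_sqrt_iter A n \<cdot> x) \<longlonglongrightarrow> X \<cdot> x" "\<And>x. norm (X \<cdot> x) \<le> norm x"
    using op_sqrt_limit[OF A_le] by blast
  have adjA: "adj A = A"
    by (rule adj_unique) (simp add: A_def bop_apply_simps cinner_simps pos_op_sym[OF R])
  have sa_n: "cinner (op_sqrt_iter A n \<cdot> x) y = cinner x (op_sqrt_iter A n \<cdot> y)" for n x y
  proof (induction n arbitrary: x y)
    case (Suc n)
    show ?case using cinner_adj_left[of A x y] by (simp add: op_sqrt_iter_Suc cinner_simps Suc adjA)
  qed simp
  have sa: "cinner (X \<cdot> x) y = cinner x (X \<cdot> y)" for x y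
    by (rule LIMSEQ_unique[OF tendsto_cinner[OF X(1) tendsto_const]])
       (unfold sa_n, rule tendsto_cinner[OF tendsto_const X(1)])
  have XX: "(\<lambda>n. op_sqrt_iter A n \<cdot> (op_sqrt_iter A n \<cdot> x)) \<longlonglongrightarrow> X \<cdot> (X \<cdot> x)" for x
  proof (rule Lim_transform2[OF X(1)])
    show "(\<lambda>n. op_sqrt_iter A n \<cdot> (X \<cdot> x) - op_sqrt_iter A n \<cdot> (op_sqrt_iter A n \<cdot> x)) \<longlonglongrightarrow> 0"
    proof (rule Lim_null_comparison)
      show "\<forall>\<^sub>F n in sequentially. norm (op_sqrt_iter A n \<cdot> (X \<cdot> x) - op_sqrt_iter A n \<cdot> (op_sqrt_iter A n \<cdot> x))
          \<le> norm (X \<cdot> x - op_sqrt_iter A n \<cdot> x)"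
      proof (rule always_eventually, rule allI)
        fix n
        show "norm (op_sqrt_iter A n \<cdot> (X \<cdot> x) - op_sqrt_iter A n \<cdot> (op_sqrt_iter A n \<cdot> x))
            \<le> norm (X \<cdot> x - op_sqrt_iter A n \<cdot> x)"
          using op_sqrt_iter_norm[OF A_le, of n "X \<cdot> x - op_sqrt_iter A n \<cdot> x"]
            mult_right_mono[of "csqrt_iter n" 1 "norm (X \<cdot> x - op_sqrt_iter A n \<cdot> x)"] csqrt_iter_bounds[of n]
          by (simp add: bop_diff_right)
      qed
      show "(\<lambda>n. norm (X \<cdot> x - op_sqrt_iter A n \<cdot> x)) \<longlonglongrightarrow> 0"
        using tendsto_norm[OF tendsto_diff[OF tendsto_const X(1)], of "X \<cdot> x" x] by simp
    qed
  qed
  \<comment> \<open>The limit satisfies \<open>2 X = A + X\<^sup>2\<close>, which is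
    \<open>(I - X)\<^sup>2 = I - A = R\<close>.\<close>
  have fixpt: "2 *\<^sub>R (X \<cdot> x) = A \<cdot> x + X \<cdot> (X \<cdot> x)" for x
  proof -
    have "(\<lambda>n. op_sqrt_iter A (Suc n) \<cdot> x) \<longlonglongrightarrow> (1/2) *\<^sub>R (A \<cdot> x + X \<cdot> (X \<cdot> x))"
      unfolding op_sqrt_iter_Suc by (intro tendsto_intros XX)
    from LIMSEQ_unique[OF LIMSEQ_Suc[OF X(1)] this]
    have "2 *\<^sub>R (X \<cdot> x) = 2 *\<^sub>R ((1/2) *\<^sub>R (A \<cdot> x + X \<cdot> (X \<cdot> x)))" by (rule arg_cong)
    then show ?thesis by (simp only: scaleR_scaleR) simp
  qed
  have "pos_op (bop_id - X)"
    unfolding pos_op_iff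
  proof safe
    fix x
    have "adj (bop_id - X) = bop_id - X"
      by (rule adj_unique) (simp add: bop_apply_simps cinner_simps sa)
    then show "cinner ((bop_id - X) \<cdot> x) x = of_real (qform (bop_id - X) x)"
      by (rule selfadj_cinner_real)
    have "qform X x \<le> norm (X \<cdot> x) * norm x"
      unfolding Re_cinner by (rule norm_cauchy_schwarz)
    also have "\<dots> \<le> norm x * norm x" by (intro mult_right_mono X) simp
    finally show "0 \<le> qform (bop_id - X) x"
      by (simp add: bop_apply_simps cinner_simps cinner_self power2_eq_square)
  qed
  moreover have "(bop_id - X) \<bullet>\<^sub>o (bop_id - X) = R"
  proof (rule bop_eqI)
    fix x show "((bop_id - X) \<bullet>\<^sub>o (bop_id - X)) \<cdot> x = R \<cdot> x"
      using fixpt[of x] by (simp add: bop_apply_simps bop_diff_right A_def scaleR_2 algebra_simps)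
  qed
  \<comment> \<open>Every iterate is a polynomial in \<open>A = I - R\<close>, so whatever commutes
    with \<open>R\<close> commutes with the limit.\<close>
  moreover have "T \<bullet>\<^sub>o (bop_id - X) = (bop_id - X) \<bullet>\<^sub>o T" if T: "T \<bullet>\<^sub>o R = R \<bullet>\<^sub>o T" for T
  proof (rule bop_eqI)
    fix x
    have TR: "T \<cdot> (R \<cdot> y) = R \<cdot> (T \<cdot> y)" for y using arg_cong[OF T, of "\<lambda>S. S \<cdot> y"] by simp
    have "T \<cdot> (op_sqrt_iter A n \<cdot> y) = op_sqrt_iter A n \<cdot> (T \<cdot> y)" for n y
    proof (induction n arbitrary: y)
      case (Suc n)
      then show ?case
        by (simp add: op_sqrt_iter_Suc bop_scaleR_right bop_add_right A_def bop_apply_simps bop_diff_right TR)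
    qed simp
    then have "T \<cdot> (X \<cdot> x) = X \<cdot> (T \<cdot> x)"
      using LIMSEQ_unique[OF X(1)[of "T \<cdot> x"]] tendsto_bop[OF X(1), of T x] by simp
    then show "(T \<bullet>\<^sub>o (bop_id - X)) \<cdot> x = ((bop_id - X) \<bullet>\<^sub>o T) \<cdot> x"
      by (simp add: bop_apply_simps bop_diff_right)
  qed
  ultimately show ?thesis by blast
qed

lemma pos_op_scaleR: "pos_op T \<Longrightarrow> 0 \<le> r \<Longrightarrow> pos_op (r *\<^sub>R T)"
  unfolding pos_op_iff by (auto simp: bop_apply_simps cinner_simps complex_eq_iff)

lemma Re_cinner_bop_le: "qform T x \<le> bop_norm T * (norm x)\<^sup>2"
  using order_trans[OF complex_Re_le_cmod cmod_cinner_bop_le[of T x x]]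
  by (simp add: power2_eq_square mult.assoc)

text \<open>Rescaling reduces to contractions. The commutation clause is kept for the uniqueness
  proof: any other root of \<open>R\<close> commutes with \<open>R\<close>, hence with this
  one.\<close>

lemma sqrt_op_ex:
  assumes R: "pos_op R"
  shows "\<exists>S. pos_op S \<and> S \<bullet>\<^sub>o S = R \<and> (\<forall>T. T \<bullet>\<^sub>o R = R \<bullet>\<^sub>o T \<longrightarrow> T \<bullet>\<^sub>o S = S \<bullet>\<^sub>o T)"
proof -
  \<comment> \<open>The added 1 keeps the scaling factor positive even for
    \<open>R = 0\<close>.\<close>
  define c where "c = bop_norm R + 1"
  have c: "0 < c" unfolding c_def by (rule bop_norm_bound_pos)
  have pos: "pos_op ((1 / c) *\<^sub>R R)" using R c by (simp add: pos_op_scaleR)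
  have le: "qform ((1 / c) *\<^sub>R R) x \<le> (norm x)\<^sup>2" for x
  proof -
    have "qform R x \<le> c * (norm x)\<^sup>2"
      using Re_cinner_bop_le[of R x] zero_le_power2[of "norm x"] unfolding c_def distrib_right by linarith
    then show ?thesis using c by (simp add: bop_apply_simps cinner_simps field_simps)
  qed
  obtain S where S: "pos_op S" "S \<bullet>\<^sub>o S = (1 / c) *\<^sub>R R"
      "\<And>T. T \<bullet>\<^sub>o ((1 / c) *\<^sub>R R) = ((1 / c) *\<^sub>R R) \<bullet>\<^sub>o T \<Longrightarrow> T \<bullet>\<^sub>o S = S \<bullet>\<^sub>o T"
    using sqrt_op_contraction_ex[OF pos le] by blast
  have comp_scale: "(r *\<^sub>R U) \<bullet>\<^sub>o V = r *\<^sub>R (U \<bullet>\<^sub>o V)" "U \<bullet>\<^sub>o (r *\<^sub>R V) = r *\<^sub>R (U \<bullet>\<^sub>o V)"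
    for r and U V :: "('a, 'a) bop"
    by (rule bop_eqI; simp add: bop_apply_simps bop_scaleR_right)+
  have "pos_op (sqrt c *\<^sub>R S)" using S(1) c by (simp add: pos_op_scaleR)
  moreover have "(sqrt c *\<^sub>R S) \<bullet>\<^sub>o (sqrt c *\<^sub>R S) = R"
    using c by (simp add: comp_scale S(2))
  moreover have "T \<bullet>\<^sub>o (sqrt c *\<^sub>R S) = (sqrt c *\<^sub>R S) \<bullet>\<^sub>o T" if "T \<bullet>\<^sub>o R = R \<bullet>\<^sub>o T" for T
    using S(3)[of T] that by (simp add: comp_scale)
  ultimately show ?thesis by blast
qed

text \<open>With a root \<open>U\<close> of \<open>S\<close> the form equals the squared norm of
  \<open>U \<cdot> y\<close>.\<close>

lemma pos_op_cinner_zero: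
  assumes "pos_op S" "cinner (S \<cdot> y) y = 0"
  shows "S \<cdot> y = 0"
proof -
  obtain U where U: "pos_op U" "U \<bullet>\<^sub>o U = S" using sqrt_op_ex[OF assms(1)] by blast
  have "cinner (U \<cdot> y) (U \<cdot> y) = cinner (S \<cdot> y) y"
    using cinner_adj_right[of "U \<cdot> y" U y] by (simp add: pos_op_selfadj[OF U(1)] U(2)[symmetric])
  then have "U \<cdot> y = 0" using assms by simp
  then show ?thesis by (simp add: U(2)[symmetric])
qed

text \<open>Let \<open>T\<close> be a second positive root and \<open>y = T x - S x\<close>. Since
  \<open>T\<close> and \<open>S\<close> commute,
  \<open>(T + S) y = T\<^sup>2 x - S\<^sup>2 x = 0\<close>. Positivity makes \<open>T y\<close> and
  \<open>S y\<close> vanish separately, and then \<open>y\<close> is orthogonal to itself.\<close>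

lemma sqrt_op_works:
  assumes R: "pos_op R"
  shows "pos_op (sqrt_op R)" "sqrt_op R \<bullet>\<^sub>o sqrt_op R = R"
proof -
  obtain S where S: "pos_op S" "S \<bullet>\<^sub>o S = R" "\<And>T. T \<bullet>\<^sub>o R = R \<bullet>\<^sub>o T \<Longrightarrow> T \<bullet>\<^sub>o S = S \<bullet>\<^sub>o T"
    using sqrt_op_ex[OF R] by blast
  have "sqrt_op R = S"
    unfolding sqrt_op_def
  proof (rule the_equality)
    show "pos_op S \<and> S \<bullet>\<^sub>o S = R" using S by blast
    fix T assume T: "pos_op T \<and> T \<bullet>\<^sub>o T = R"
    have "T \<bullet>\<^sub>o R = R \<bullet>\<^sub>o T" using T by (metis bop_comp_assoc)
    then have TS: "T \<cdot> (S \<cdot> x) = S \<cdot> (T \<cdot> x)" for x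
      using arg_cong[OF S(3), of T "\<lambda>V. V \<cdot> x"] by simp
    have TT: "T \<cdot> (T \<cdot> x) = S \<cdot> (S \<cdot> x)" for x
      using T S(2) bop_apply_comp by metis
    show "T = S"
    proof (rule bop_eqI)
      fix x
      define y where "y = T \<cdot> x - S \<cdot> x"
      have "T \<cdot> y + S \<cdot> y = 0" by (simp add: y_def bop_diff_right TS TT)
      then have z: "cinner (T \<cdot> y) y + cinner (S \<cdot> y) y = 0" by (simp add: cinner_add_left[symmetric])
      have "qform T y = 0" "qform S y = 0"
        using arg_cong[OF z, of Re] pos_op_Re[of T y] pos_op_Re[of S y] T S(1) by auto
      then have "cinner (T \<cdot> y) y = 0" "cinner (S \<cdot> y) y = 0"
        using T S(1) unfolding pos_op_iff by (metis of_real_eq_0_iff)+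
      then have "T \<cdot> y = 0" "S \<cdot> y = 0" using T S(1) by (auto intro!: pos_op_cinner_zero)
      then have "cinner (T \<cdot> x) y = 0" "cinner (S \<cdot> x) y = 0"
        using T S(1) by (simp_all only: pos_op_sym cinner_zero_right)
      then have "cinner (T \<cdot> x - S \<cdot> x) y = 0" by (simp only: cinner_diff_left diff_self)
      then have "y = 0" unfolding y_def[symmetric] by simp
      then show "T \<cdot> x = S \<cdot> x" by (simp add: y_def)
    qed
  qed
  then show "pos_op (sqrt_op R)" "sqrt_op R \<bullet>\<^sub>o sqrt_op R = R"
    using S(1,2) by simp_all
qed

lemma cinner_sqrt_op:
  assumes "pos_op R"
  shows "cinner (sqrt_op R \<cdot> x) (sqrt_op R \<cdot> y) = cinner (R \<cdot> x) y"
proof -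
  have "cinner (sqrt_op R \<cdot> x) (sqrt_op R \<cdot> y) = cinner ((sqrt_op R \<bullet>\<^sub>o sqrt_op R) \<cdot> x) y"
    using cinner_adj_right[of "sqrt_op R \<cdot> x" "sqrt_op R" y] sqrt_op_works(1)[OF assms]
    by (simp add: pos_op_selfadj)
  then show ?thesis by (simp add: sqrt_op_works(2)[OF assms])
qed

section \<open>Square summable families\<close>

text \<open>Tonelli: nonnegativity turns iterated summability into joint summability, after which
  the double series may be regrouped.\<close>

lemma has_sum_nonneg_Sigma:
  fixes f :: "'a \<Rightarrow> 'b \<Rightarrow> real"
  assumes f: "\<And>x. x \<in> A \<Longrightarrow> (f x has_sum g x) (B x)" and g: "(g has_sum S) A"
    and nonneg: "\<And>x y. x \<in> A \<Longrightarrow> y \<in> B x \<Longrightarrow> 0 \<le> f x y"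
  shows "((\<lambda>(x, y). f x y) has_sum S) (Sigma A B)"
proof (rule has_sum_SigmaI[where g = g])
  show "(\<lambda>(x, y). f x y) summable_on Sigma A B"
    by (rule summable_on_SigmaI[where g = g]) (use assms in \<open>auto intro: has_sum_imp_summable\<close>)
qed (use assms in auto)

lemma has_sum_nonneg_swap:
  fixes f :: "'a \<Rightarrow> 'b \<Rightarrow> real"
  assumes f: "\<And>x. x \<in> A \<Longrightarrow> (f x has_sum g x) B" and g: "(g has_sum S) A"
    and nonneg: "\<And>x y. x \<in> A \<Longrightarrow> y \<in> B \<Longrightarrow> 0 \<le> f x y"
    and h: "\<And>y. y \<in> B \<Longrightarrow> ((\<lambda>x. f x y) has_sum h y) A"
  shows "(h has_sum S) B"
proof (rule has_sum_SigmaD)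
  show "((\<lambda>(y, x). f x y) has_sum S) (B \<times> A)"
    using has_sum_nonneg_Sigma[OF f g nonneg] has_sum_swap[where f = "\<lambda>(x, y). f x y" and A = A and B = B and S = S] by simp
qed (use h in auto)

lemma norm_l2_has_sum: "((\<lambda>i. (norm (l2_apply x i))\<^sup>2) has_sum (norm x)\<^sup>2) UNIV"
  for x :: "('i, 'h::complex_hilbert) l2"
  by (simp add: norm_l2_sq l2_norm_summable)

lemma cinner_l2_has_sum:
  "((\<lambda>i. cinner (l2_apply x i) (l2_apply y i)) has_sum cinner x y) UNIV"
  for x y :: "('i, 'h::complex_hilbert) l2"
  by (simp add: cinner_l2_def cinner_l2_summable)

lemma l2_apply_Abs:
  "(\<lambda>i. (norm (f i))\<^sup>2) summable_on UNIV \<Longrightarrow> l2_apply (Abs_l2 f) = f"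
  by (simp add: Abs_l2_inverse)

lemmas l2_apply_simps = plus_l2.rep_eq minus_l2.rep_eq uminus_l2.rep_eq zero_l2.rep_eq
  scaleC_l2.rep_eq scaleR_l2.rep_eq

lemma l2_apply_sum: "l2_apply (\<Sum>i\<in>I. f i) j = (\<Sum>i\<in>I. l2_apply (f i) j)"
  by (induction I rule: infinite_finite_induct) (simp_all add: l2_apply_simps)

lemma cinner_ket: "cinner x (ket v) = l2_apply x v"
proof -
  have "((\<lambda>i. cinner (l2_apply x i) (l2_apply (ket v) i)) has_sum l2_apply x v) UNIV
     \<longleftrightarrow> ((\<lambda>i. l2_apply x i) has_sum l2_apply x v) {v}"
    by (rule has_sum_cong_neutral) (auto simp: ket.rep_eq cinner_complex_def)
  then show ?thesis
    using has_sum_finite[of "{v}" "l2_apply x"] has_sum_unique[OF cinner_l2_has_sum] by simp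
qed

text \<open>The squared norm of a remainder is the squared norm of \<open>x\<close> minus a partial
  sum. As a consequence operators are determined by their values on
  \<open>ket i \<otimes>\<^sub>v h\<close>.\<close>

lemma l2_ket_has_sum:
  "((\<lambda>i. ket i \<otimes>\<^sub>v l2_apply x i) has_sum x) UNIV" for x :: "('i, 'h::complex_hilbert) l2"
proof -
  define s where "s F = (\<Sum>i\<in>F. ket i \<otimes>\<^sub>v l2_apply x i)" for F
  have ap: "l2_apply (s F) j = (if j \<in> F then l2_apply x j else 0)" if "finite F" for F j
  proof -
    have "l2_apply (s F) j = (\<Sum>i\<in>F. if i = j then l2_apply x i else 0)"
      unfolding s_def l2_apply_sum tensor_vec.rep_eq ket.rep_eq by (rule sum.cong) auto
    then show ?thesis using that by simp
  qed
  have nm: "(norm (x - s F))\<^sup>2 = (norm x)\<^sup>2 - (\<Sum>i\<in>F. (norm (l2_apply x i))\<^sup>2)" if F: "finite F" for F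
  proof -
    have "((\<lambda>i. (norm (l2_apply x i))\<^sup>2) has_sum (norm x)\<^sup>2 - (\<Sum>i\<in>F. (norm (l2_apply x i))\<^sup>2)) (UNIV - F)"
      by (rule has_sum_Diff[OF norm_l2_has_sum]) (use F in auto)
    moreover have "((\<lambda>i. (norm (l2_apply (x - s F) i))\<^sup>2) has_sum S) UNIV
        \<longleftrightarrow> ((\<lambda>i. (norm (l2_apply x i))\<^sup>2) has_sum S) (UNIV - F)" for S
      by (rule has_sum_cong_neutral) (auto simp: l2_apply_simps ap F)
    ultimately show ?thesis using has_sum_unique[OF norm_l2_has_sum] by blast
  qed
  have "((\<lambda>F. (norm (x - s F))\<^sup>2) \<longlongrightarrow> (norm x)\<^sup>2 - (norm x)\<^sup>2) (finite_subsets_at_top UNIV)"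
  proof (rule Lim_transform_eventually)
    show "((\<lambda>F. (norm x)\<^sup>2 - (\<Sum>i\<in>F. (norm (l2_apply x i))\<^sup>2)) \<longlongrightarrow> (norm x)\<^sup>2 - (norm x)\<^sup>2) (finite_subsets_at_top UNIV)"
      by (intro tendsto_diff tendsto_const) (use norm_l2_has_sum[of x] in \<open>simp add: has_sum_def\<close>)
    show "\<forall>\<^sub>F F in finite_subsets_at_top UNIV. (norm x)\<^sup>2 - (\<Sum>i\<in>F. (norm (l2_apply x i))\<^sup>2) = (norm (x - s F))\<^sup>2"
      by (rule eventually_finite_subsets_at_top_weakI) (simp add: nm)
  qed
  then have "((\<lambda>F. norm (x - s F)) \<longlongrightarrow> 0) (finite_subsets_at_top UNIV)"
    using tendsto_real_sqrt by fastforce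
  then have "((\<lambda>F. x - s F) \<longlongrightarrow> 0) (finite_subsets_at_top UNIV)"
    by (rule tendsto_norm_zero_cancel)
  from tendsto_diff[OF tendsto_const[of x] this] show ?thesis
    by (simp add: has_sum_def s_def)
qed

lemma bop_l2_eqI:
  fixes S T :: "(('i, 'a::complex_hilbert) l2, 'b::complex_hilbert) bop"
  assumes "\<And>i h. S \<cdot> (ket i \<otimes>\<^sub>v h) = T \<cdot> (ket i \<otimes>\<^sub>v h)"
  shows "S = T"
proof (rule bop_eqI)
  fix x
  show "S \<cdot> x = T \<cdot> x"
    using has_sum_unique[OF has_sum_bounded_linear[OF bounded_linear_bop l2_ket_has_sum]
        has_sum_bounded_linear[OF bounded_linear_bop[of T] l2_ket_has_sum, of x, unfolded assms[symmetric]]] .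
qed

lemma ket_tensor_complex: "ket i \<otimes>\<^sub>v c = c *\<^sub>C ket i"
  by (rule l2_eqI) (simp add: tensor_vec.rep_eq l2_apply_simps scaleC_complex_def)

lemma bop_ket_eqI: "(\<And>i. S \<cdot> ket i = T \<cdot> ket i) \<Longrightarrow> S = T"
  by (rule bop_l2_eqI) (simp add: ket_tensor_complex bop_scaleC_right)

section \<open>Column operators\<close>

text \<open>The common source of \<open>diag_op\<close>, \<open>slices\<close>,
  \<open>Phi_col\<close>, \<open>W_adj\<close> and the kernel. The description denotes the intended
  operator under the square-sum bound of \<open>col_op_apply\<close>.\<close>

definition col_op :: "('i \<Rightarrow> ('a::complex_hilbert, 'b::complex_hilbert) bop) \<Rightarrow> ('a, ('i, 'b) l2) bop" where
  "col_op T = (THE V. \<forall>x i. l2_apply (V \<cdot> x) i = T i \<cdot> x)"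

lemma col_op_unique:
  assumes "\<And>x i. l2_apply (V \<cdot> x) i = T i \<cdot> x"
  shows "col_op T = V"
  unfolding col_op_def
proof (rule the_equality)
  show "\<forall>x i. l2_apply (V \<cdot> x) i = T i \<cdot> x" using assms by blast
  show "V' = V" if "\<forall>x i. l2_apply (V' \<cdot> x) i = T i \<cdot> x" for V'
    by (rule bop_eqI, rule l2_eqI) (simp add: that assms)
qed

lemma col_op_apply:
  fixes T :: "'i \<Rightarrow> ('a::complex_hilbert, 'b::complex_hilbert) bop"
  assumes bound: "\<And>F x. finite F \<Longrightarrow> (\<Sum>i\<in>F. (norm (T i \<cdot> x))\<^sup>2) \<le> C * (norm x)\<^sup>2"
  shows "l2_apply (col_op T \<cdot> x) i = T i \<cdot> x"
proof -
  have summ: "(\<lambda>i. (norm (T i \<cdot> x))\<^sup>2) summable_on UNIV" for x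
    by (rule nonneg_bdd_above_summable_on) (auto simp: bdd_above_def intro!: bound)
  define g where "g x = Abs_l2 (\<lambda>i. T i \<cdot> x)" for x
  have g: "l2_apply (g x) i = T i \<cdot> x" for x i
    by (simp add: g_def l2_apply_Abs[OF summ])
  have "bounded_linear g"
  proof (rule bounded_linear_intro[where K = "sqrt \<bar>C\<bar>"])
    show "norm (g x) \<le> norm x * sqrt \<bar>C\<bar>" for x
    proof (rule power2_le_imp_le)
      have "(norm (g x))\<^sup>2 \<le> C * (norm x)\<^sup>2"
        by (rule has_sum_le_finite_sums[OF norm_l2_has_sum]) (simp add: g bound)
      also have "\<dots> \<le> \<bar>C\<bar> * (norm x)\<^sup>2" by (intro mult_right_mono) auto
      finally show "(norm (g x))\<^sup>2 \<le> (norm x * sqrt \<bar>C\<bar>)\<^sup>2" by (simp add: power_mult_distrib mult.commute)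
    qed simp
  qed (rule l2_eqI, simp add: g l2_apply_simps bop_add_right bop_scaleR_right)+
  moreover have "g (c *\<^sub>C x) = c *\<^sub>C g x" for c x
    by (rule l2_eqI) (simp add: g l2_apply_simps bop_scaleC_right)
  ultimately obtain V where "\<And>x. V \<cdot> x = g x" using ex_bop by blast
  then have V: "l2_apply (V \<cdot> x) i = T i \<cdot> x" for x i by (simp add: g)
  show ?thesis unfolding col_op_unique[of V T, OF V] by (rule V)
qed

definition l2_coord :: "'i \<Rightarrow> (('i, 'a::complex_hilbert) l2, 'a) bop" where
  "l2_coord i = (SOME T. \<forall>x. T \<cdot> x = l2_apply x i)"

lemma l2_coord_apply [simp]:
  fixes x :: "('i, 'a::complex_hilbert) l2"
  shows "l2_coord i \<cdot> x = l2_apply x i"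
proof -
  have "\<exists>T :: (('i, 'a) l2, 'a) bop. \<forall>x. T \<cdot> x = l2_apply x i"
    by (rule ex_bop) (auto intro!: bounded_linear_intro[where K = 1] simp: l2_apply_simps norm_l2_apply_le)
  from someI_ex[OF this] show ?thesis by (simp add: l2_coord_def)
qed

definition bra :: "'a \<Rightarrow> ('a::complex_hilbert, complex) bop" where
  "bra h = (SOME T. \<forall>x. T \<cdot> x = cinner x h)"

lemma bra_apply [simp]: "bra h \<cdot> x = cinner x h"
proof -
  have "\<exists>T :: ('a, complex) bop. \<forall>x. T \<cdot> x = cinner x h"
    by (rule ex_bop) (auto intro: bounded_linear_cinner_left simp: cinner_scaleC_left scaleC_complex_def)
  from someI_ex[OF this] show ?thesis by (simp add: bra_def)
qed

text \<open>This is \<open>I \<otimes> Y\<close>.\<close>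

definition diag_op :: "('a::complex_hilbert, 'b::complex_hilbert) bop \<Rightarrow> (('i, 'a) l2, ('i, 'b) l2) bop" where
  "diag_op Y = col_op (\<lambda>i. Y \<bullet>\<^sub>o l2_coord i)"

lemma diag_op_apply [simp]:
  fixes Y :: "('a::complex_hilbert, 'b::complex_hilbert) bop" and x :: "('i, 'a) l2"
  shows "l2_apply (diag_op Y \<cdot> x) i = Y \<cdot> l2_apply x i"
proof -
  have "(\<Sum>i\<in>F. (norm ((Y \<bullet>\<^sub>o l2_coord i) \<cdot> x))\<^sup>2) \<le> (bop_norm Y)\<^sup>2 * (norm x)\<^sup>2" if "finite F" for F and x :: "('i, 'a) l2"
  proof -
    have "(\<Sum>i\<in>F. (norm ((Y \<bullet>\<^sub>o l2_coord i) \<cdot> x))\<^sup>2) \<le> (\<Sum>i\<in>F. (bop_norm Y)\<^sup>2 * (norm (l2_apply x i))\<^sup>2)"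
      by (rule sum_mono) (simp add: power_mult_distrib[symmetric] norm_bop_le power_mono)
    also have "\<dots> \<le> (bop_norm Y)\<^sup>2 * (norm x)\<^sup>2"
      unfolding sum_distrib_left[symmetric] by (intro mult_left_mono sum_le_norm_l2 that) simp
    finally show ?thesis .
  qed
  from col_op_apply[of "\<lambda>i. Y \<bullet>\<^sub>o l2_coord i", OF this] show ?thesis by (simp add: diag_op_def)
qed

lemma adj_diag_op: "adj (diag_op Y) = diag_op (adj Y)"
proof (rule adj_unique)
  fix x y
  show "cinner (diag_op Y \<cdot> x) y = cinner x (diag_op (adj Y) \<cdot> y)"
    using has_sum_unique[OF cinner_l2_has_sum[of "diag_op Y \<cdot> x" y]]
      cinner_l2_has_sum[of x "diag_op (adj Y) \<cdot> y"] by (simp add: cinner_adj_right)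
qed

text \<open>Contraction of the second tensor factor against \<open>h\<close>, that is
  \<open>I \<otimes> bra h\<close>.\<close>

definition slice :: "'h \<Rightarrow> (('i, 'h::complex_hilbert) l2, ('i, complex) l2) bop" where
  "slice h = diag_op (bra h)"

lemma slice_apply [simp]: "l2_apply (slice h \<cdot> x) i = cinner (l2_apply x i) h"
  by (simp add: slice_def)

lemma slice_tensor: "slice h \<cdot> (x \<otimes>\<^sub>v g) = cinner g h *\<^sub>C x"
  by (rule l2_eqI) (simp add: tensor_vec.rep_eq l2_apply_simps cinner_scaleC_left scaleC_complex_def mult.commute)

section \<open>Parseval sequences and operators \<open>T \<otimes> I\<close>\<close>

text \<open>Indexed by the naturals to match the sequences that define \<open>wstar\<close>. Zero
  vectors may occur, which lets a sequence serve in finite dimension as well.\<close>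

definition parseval_seq :: "(nat \<Rightarrow> 'h::complex_hilbert) \<Rightarrow> bool" where
  "parseval_seq e \<longleftrightarrow> (\<forall>h. ((\<lambda>n. (cmod (cinner h (e n)))\<^sup>2) has_sum (norm h)\<^sup>2) UNIV)"

text \<open>For a Parseval sequence this is an isometry that interchanges the tensor factors, so
  that \<open>T \<otimes> I\<close> becomes the diagonal operator
  \<open>I \<otimes> T\<close>.\<close>

definition slices :: "(nat \<Rightarrow> 'h) \<Rightarrow> (('i, 'h::complex_hilbert) l2, (nat, ('i, complex) l2) l2) bop" where
  "slices e = col_op (\<lambda>n. slice (e n))"

context
  fixes e :: "nat \<Rightarrow> 'h::complex_hilbert"
  assumes e: "parseval_seq e"
begin

lemma slice_has_sum: "((\<lambda>n. (norm (slice (e n) \<cdot> x))\<^sup>2) has_sum (norm x)\<^sup>2) UNIV"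
proof (rule has_sum_nonneg_swap[OF _ norm_l2_has_sum])
  show "((\<lambda>n. (cmod (cinner (l2_apply x i) (e n)))\<^sup>2) has_sum (norm (l2_apply x i))\<^sup>2) UNIV" for i
    using e by (simp add: parseval_seq_def)
  show "((\<lambda>i. (cmod (cinner (l2_apply x i) (e n)))\<^sup>2) has_sum (norm (slice (e n) \<cdot> x))\<^sup>2) UNIV" for n
    using norm_l2_has_sum[of "slice (e n) \<cdot> x"] by simp
qed simp

lemma slices_apply [simp]: "l2_apply (slices e \<cdot> x) n = slice (e n) \<cdot> x"
  unfolding slices_def
  by (rule col_op_apply[where C = 1]) (use finite_sum_le_has_sum[OF slice_has_sum] in auto)

lemma norm_slices: "norm (slices e \<cdot> x) = norm x"
proof -
  have "(norm (slices e \<cdot> x))\<^sup>2 = (norm x)\<^sup>2"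
    using has_sum_unique[OF norm_l2_has_sum[of "slices e \<cdot> x"]] slice_has_sum[of x] by simp
  then show ?thesis by (simp add: power2_eq_iff_nonneg)
qed

lemma slices_isometry: "adj (slices e) \<bullet>\<^sub>o slices e = (bop_id :: (('i, 'h) l2, _) bop)"
  by (rule bop_eqI_quadratic) (simp add: cinner_adj_left cinner_self norm_slices)

text \<open>On elementary tensors \<open>diag_op T\<close> stays in the range of the isometry
  \<open>slices e\<close>, so its adjoint recovers the expected tensor. Uniqueness holds because
  elementary tensors determine an operator.\<close>

lemma tensor_id_eq: "tensor_id T = adj (slices e) \<bullet>\<^sub>o diag_op T \<bullet>\<^sub>o slices e"
  unfolding tensor_id_def
proof (rule the_equality)
  define S where "S = adj (slices e) \<bullet>\<^sub>o diag_op T \<bullet>\<^sub>o slices e"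
  have S: "S \<cdot> (x \<otimes>\<^sub>v h) = (T \<cdot> x) \<otimes>\<^sub>v h" for x h
  proof -
    have "diag_op T \<cdot> (slices e \<cdot> (x \<otimes>\<^sub>v h)) = slices e \<cdot> ((T \<cdot> x) \<otimes>\<^sub>v h)"
      by (rule l2_eqI) (simp add: slice_tensor bop_scaleC_right)
    then have "S \<cdot> (x \<otimes>\<^sub>v h) = (adj (slices e) \<bullet>\<^sub>o slices e) \<cdot> ((T \<cdot> x) \<otimes>\<^sub>v h)"
      by (simp add: S_def)
    then show ?thesis by (simp add: slices_isometry)
  qed
  then show "\<forall>x h. (adj (slices e) \<bullet>\<^sub>o diag_op T \<bullet>\<^sub>o slices e) \<cdot> (x \<otimes>\<^sub>v h) = (T \<cdot> x) \<otimes>\<^sub>v h"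
    by (simp add: S_def)
  show "S' = adj (slices e) \<bullet>\<^sub>o diag_op T \<bullet>\<^sub>o slices e" if "\<forall>x h. S' \<cdot> (x \<otimes>\<^sub>v h) = (T \<cdot> x) \<otimes>\<^sub>v h" for S'
    unfolding S_def[symmetric] by (rule bop_l2_eqI) (simp add: that S)
qed

end

text \<open>As \<open>sgn 0 = 0\<close>, a vector depending linearly on its predecessors contributes \<open>0\<close>: the sequence
  is orthogonal with norms \<open>0\<close> or \<open>1\<close>, and no case distinction on the dimension is needed.\<close>

fun gram_schmidt :: "(nat \<Rightarrow> 'h::complex_hilbert) \<Rightarrow> nat \<Rightarrow> 'h" where
  "gram_schmidt d n = sgn (d n - (\<Sum>i\<in>set [0..<n]. if i < n then cinner (d n) (gram_schmidt d i) *\<^sub>C gram_schmidt d i else 0))"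

declare gram_schmidt.simps [simp del]

text \<open>The recursion without the guard \<open>i < n\<close>, which the definition carries for
  the sake of termination.\<close>

lemma gram_schmidt_eq:
  "gram_schmidt d n = sgn (d n - (\<Sum>i<n. cinner (d n) (gram_schmidt d i) *\<^sub>C gram_schmidt d i))"
  by (subst gram_schmidt.simps) (simp add: atLeast0LessThan)

text \<open>Holds because the norm is 0 or 1, and replaces the normalization of an orthonormal
  sequence in the projection formula.\<close>

lemma gram_schmidt_scale:
  "(norm (gram_schmidt d n))\<^sup>2 *\<^sub>R gram_schmidt d n = gram_schmidt d n"
  unfolding gram_schmidt_eq[of d n] norm_sgn by simp

lemma gram_schmidt_proj:
  fixes d :: "nat \<Rightarrow> 'h::complex_hilbert" and h :: 'h
  assumes orth: "\<And>i j. i < n \<Longrightarrow> j < n \<Longrightarrow> i \<noteq> j \<Longrightarrow> cinner (gram_schmidt d i) (gram_schmidt d j) = 0"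
    and j: "j < n"
  shows "cinner (h - (\<Sum>i<n. cinner h (gram_schmidt d i) *\<^sub>C gram_schmidt d i)) (gram_schmidt d j) = 0"
proof -
  let ?e = "gram_schmidt d"
  have "(\<Sum>i<n. cinner (cinner h (?e i) *\<^sub>C ?e i) (?e j)) = (\<Sum>i<n. if i = j then cinner h (?e j) * cinner (?e j) (?e j) else 0)"
    by (rule sum.cong) (use orth j in \<open>auto simp: cinner_scaleC_left\<close>)
  also have "\<dots> = cinner h (?e j) * of_real ((norm (?e j))\<^sup>2)"
    using j by (simp add: cinner_self)
  also have "\<dots> = cinner h ((norm (?e j))\<^sup>2 *\<^sub>R ?e j)"
    by (simp only: cinner_scaleR_right mult.commute)
  finally show ?thesis by (simp only: gram_schmidt_scale cinner_diff_left cinner_sum_left diff_self)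
qed

lemma gram_schmidt_orth:
  "i \<noteq> j \<Longrightarrow> cinner (gram_schmidt d i) (gram_schmidt d j) = 0"
proof -
  have lt: "cinner (gram_schmidt d n) (gram_schmidt d j) = 0" if "j < n" for n j
    using that
  proof (induction n arbitrary: j rule: less_induct)
    case (less n)
    have "cinner (gram_schmidt d i) (gram_schmidt d j) = 0" if "i < n" "j < n" "i \<noteq> j" for i j
      using that less.IH[of i j] less.IH[of j i] by (metis cinner_eq_zero_commute linorder_neqE_nat)
    from gram_schmidt_proj[OF this less.prems, of "d n"] show ?case
      unfolding gram_schmidt_eq[of d n] sgn_div_norm by (simp add: cinner_scaleR_left)
  qed
  show "i \<noteq> j \<Longrightarrow> cinner (gram_schmidt d i) (gram_schmidt d j) = 0"
    using lt cinner_eq_zero_commute by (metis linorder_neqE_nat)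
qed

definition gs_rest :: "(nat \<Rightarrow> 'h::complex_hilbert) \<Rightarrow> nat \<Rightarrow> 'h \<Rightarrow> 'h" where
  "gs_rest d n h = h - (\<Sum>i<n. cinner h (gram_schmidt d i) *\<^sub>C gram_schmidt d i)"

lemma gs_rest_orth: "j < n \<Longrightarrow> cinner (gs_rest d n h) (gram_schmidt d j) = 0"
  unfolding gs_rest_def by (rule gram_schmidt_proj) (auto intro: gram_schmidt_orth)

lemma gs_rest_diff: "gs_rest d n (g - h) = gs_rest d n g - gs_rest d n h"
  by (simp add: gs_rest_def cinner_diff_left complex_vec.scale_left_diff_distrib sum_subtractf algebra_simps)

text \<open>Pythagoras. The rest therefore decreases in norm with \<open>n\<close>, and Parseval for
  \<open>h\<close> amounts to its tending to 0.\<close>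

lemma gs_rest_norm:
  "(norm (gs_rest d n h))\<^sup>2 = (norm h)\<^sup>2 - (\<Sum>i<n. (cmod (cinner h (gram_schmidt d i)))\<^sup>2)"
proof -
  let ?e = "gram_schmidt d"
  have z: "cinner (gs_rest d n h) (\<Sum>i<n. cinner h (?e i) *\<^sub>C ?e i) = 0"
    unfolding cinner_sum_right by (rule sum.neutral) (simp add: cinner_scaleC_right gs_rest_orth)
  have "cinner (gs_rest d n h) (gs_rest d n h) = cinner (gs_rest d n h) h"
    using z by (simp add: gs_rest_def cinner_diff_right)
  also have "\<dots> = of_real ((norm h)\<^sup>2) - (\<Sum>i<n. cinner h (?e i) * cinner (?e i) h)"
    by (simp add: gs_rest_def cinner_diff_left cinner_sum_left cinner_scaleC_left cinner_self)
  also have "(\<Sum>i<n. cinner h (?e i) * cinner (?e i) h) = of_real (\<Sum>i<n. (cmod (cinner h (?e i)))\<^sup>2)"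
    unfolding of_real_sum by (rule sum.cong) (auto simp: complex_norm_square cinner_commute[of _ h] simp del: of_real_power)
  finally show ?thesis by (simp only: cinner_self of_real_diff[symmetric] of_real_eq_iff)
qed

text \<open>The vector \<open>d n\<close> lies in the span of the first \<open>n + 1\<close> members
  of the sequence; further members cannot increase the rest.\<close>

lemma gs_rest_vanish: "n < N \<Longrightarrow> gs_rest d N (d n) = 0"
proof -
  let ?e = "gram_schmidt d"
  define v where "v = gs_rest d n (d n)"
  have e: "?e n = sgn v" unfolding gram_schmidt_eq[of d n] v_def gs_rest_def ..
  have ce: "cinner (d n) (?e n) = of_real (norm v)"
  proof -
    have "d n = v + (\<Sum>i<n. cinner (d n) (?e i) *\<^sub>C ?e i)" by (simp add: v_def gs_rest_def)
    then have "cinner (d n) (?e n) = cinner (v + (\<Sum>i<n. cinner (d n) (?e i) *\<^sub>C ?e i)) (?e n)" by simp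
    also have "\<dots> = cinner v (?e n)"
      unfolding cinner_add_left cinner_sum_left by (simp add: cinner_scaleC_left gram_schmidt_orth)
    also have "\<dots> = of_real (norm v)"
      unfolding e sgn_div_norm cinner_scaleR_right cinner_self
      by (cases "v = 0") (simp_all add: power2_eq_square)
    finally show ?thesis .
  qed
  have z: "gs_rest d (Suc n) (d n) = 0"
  proof -
    have "gs_rest d (Suc n) (d n) = v - cinner (d n) (?e n) *\<^sub>C ?e n"
      by (simp add: gs_rest_def v_def)
    then have "gs_rest d (Suc n) (d n) = v - of_real (norm v) *\<^sub>C ?e n" unfolding ce .
    then show ?thesis unfolding e sgn_div_norm
      by (cases "v = 0") (simp_all flip: scaleR_scaleC)
  qed
  have "(norm (gs_rest d N (d n)))\<^sup>2 \<le> (norm (gs_rest d (Suc n) (d n)))\<^sup>2" if "n < N"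
    unfolding gs_rest_norm using that
    by (intro diff_left_mono sum_mono2) auto
  with z show "n < N \<Longrightarrow> gs_rest d N (d n) = 0" by simp
qed

text \<open>Orthogonalize a dense sequence. Taking rests is linear and contractive, and the rest of
  each \<open>d n\<close> is eventually 0; approximating \<open>h\<close> by some \<open>d n\<close>
  makes the rest of \<open>h\<close> arbitrarily small.\<close>

lemma parseval_seq_ex:
  assumes "separable_space (euclidean :: 'h::complex_hilbert topology)"
  shows "\<exists>e :: nat \<Rightarrow> 'h. parseval_seq e"
proof -
  obtain C :: "'h set" where C: "countable C" "closure C = UNIV"
    using assms by (auto simp: separable_space_def)
  then have "C \<noteq> {}" by auto
  then obtain d :: "nat \<Rightarrow> 'h" where d: "range d = C"
    using range_from_nat_into[OF _ C(1)] by blast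
  have "((\<lambda>n. (cmod (cinner h (gram_schmidt d n)))\<^sup>2) has_sum (norm h)\<^sup>2) UNIV" for h
  proof (rule norm_summable_imp_has_sum)
    have le: "norm (gs_rest d n x) \<le> norm x" for n x
    proof (rule power2_le_imp_le)
      show "(norm (gs_rest d n x))\<^sup>2 \<le> (norm x)\<^sup>2" unfolding gs_rest_norm by (simp add: sum_nonneg)
    qed simp
    have "(\<lambda>n. gs_rest d n h) \<longlonglongrightarrow> 0"
    proof (rule LIMSEQ_I)
      fix r :: real assume "0 < r"
      then obtain c where "c \<in> C" "dist c h < r" using C(2) closure_approachable[of h C] by auto
      then obtain n where n: "dist (d n) h < r" using d by auto
      have "norm (gs_rest d N h) < r" if "n < N" for N
        using le[of N "h - d n"] n that by (simp add: gs_rest_diff gs_rest_vanish dist_norm norm_minus_commute)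
      then show "\<exists>no. \<forall>N\<ge>no. norm (gs_rest d N h - 0) < r" by (intro exI[of _ "Suc n"]) auto
    qed
    then have "(\<lambda>n. (norm h)\<^sup>2 - (norm (gs_rest d n h))\<^sup>2) \<longlonglongrightarrow> (norm h)\<^sup>2 - (norm (0::'h))\<^sup>2"
      by (intro tendsto_intros)
    then show sums: "(\<lambda>n. (cmod (cinner h (gram_schmidt d n)))\<^sup>2) sums (norm h)\<^sup>2"
      by (simp add: gs_rest_norm sums_def)
    then show "summable (\<lambda>n. norm ((cmod (cinner h (gram_schmidt d n)))\<^sup>2))"
      by (simp add: sums_iff)
  qed
  then show ?thesis unfolding parseval_seq_def by blast
qed

section \<open>The weak and the weak* topology\<close>

lemma tendsto_fun_iff:
  fixes f :: "'a \<Rightarrow> 'b \<Rightarrow> 'c::topological_space"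
  shows "(f \<longlongrightarrow> l) F \<longleftrightarrow> (\<forall>x. ((\<lambda>a. f a x) \<longlongrightarrow> l x) F)"
  using limitin_componentwise[of "\<lambda>_. euclidean" UNIV f l F]
  by (simp add: limitin_canonical_iff euclidean_product_topology)

lemma limitin_pullback:
  fixes f :: "'a \<Rightarrow> 'b::topological_space"
  shows "limitin (pullback_topology UNIV f euclidean) g l F \<longleftrightarrow> ((\<lambda>a. f (g a)) \<longlongrightarrow> f l) F"
proof
  assume "limitin (pullback_topology UNIV f euclidean) g l F"
  from continuous_map_limit[OF continuous_map_pullback[OF continuous_map_id] this]
  show "((\<lambda>a. f (g a)) \<longlongrightarrow> f l) F" by (simp add: limitin_canonical_iff o_def)
next
  assume *: "((\<lambda>a. f (g a)) \<longlongrightarrow> f l) F"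
  show "limitin (pullback_topology UNIV f euclidean) g l F"
    unfolding limitin_def topspace_pullback_topology openin_pullback_topology
    using topological_tendstoD[OF *] by auto
qed

lemma continuous_map_into_pullback:
  fixes f :: "'a \<Rightarrow> 'b::topological_space"
  shows "continuous_map X (pullback_topology UNIV f euclidean) g \<longleftrightarrow> continuous_map X euclidean (\<lambda>z. f (g z))"
proof
  assume "continuous_map X (pullback_topology UNIV f euclidean) g"
  from continuous_map_compose[OF this continuous_map_pullback[OF continuous_map_id]]
  show "continuous_map X euclidean (\<lambda>z. f (g z))" by (simp add: o_def)
qed (auto intro!: continuous_map_pullback' simp: o_def)

lemma continuous_map_into_fun:
  fixes f :: "'a \<Rightarrow> 'b \<Rightarrow> 'c::topological_space"
  shows "continuous_map X euclidean f \<longleftrightarrow> (\<forall>i. continuous_map X euclidean (\<lambda>z. f z i))"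
  using continuous_map_componentwise_UNIV[of X "\<lambda>_. euclidean" f]
  by (simp add: euclidean_product_topology)

text \<open>Weak* functionals of \<open>T\<close> are vector functionals of the amplification
  \<open>diag_op T\<close>. All continuity proofs below move operators across this inner
  product.\<close>

lemma wstar_eq:
  "wstar = pullback_topology UNIV
     (\<lambda>T (x :: (nat, 'a::complex_hilbert) l2, y :: (nat, 'b::complex_hilbert) l2). cinner (diag_op T \<cdot> x) y) euclidean"
  by (simp add: wstar_def cinner_l2_def)

lemma topspace_wstar [simp]: "topspace wstar = UNIV"
  by (simp add: wstar_def topspace_pullback_topology)

lemma limitin_wot_iff:
  "limitin wot T L F \<longleftrightarrow> (\<forall>x y. ((\<lambda>a. cinner (T a \<cdot> x) y) \<longlongrightarrow> cinner (L \<cdot> x) y) F)"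
  unfolding wot_def limitin_pullback tendsto_fun_iff by auto

lemma limitin_wstar_iff:
  "limitin wstar T L F \<longleftrightarrow>
     (\<forall>x :: (nat, 'a::complex_hilbert) l2. \<forall>y :: (nat, 'b::complex_hilbert) l2.
        ((\<lambda>a. cinner (diag_op (T a) \<cdot> x) y) \<longlongrightarrow> cinner (diag_op L \<cdot> x) y) F)"
  unfolding wstar_eq limitin_pullback tendsto_fun_iff by auto

lemma continuous_map_into_wstar:
  "continuous_map X wstar g \<longleftrightarrow>
     (\<forall>x :: (nat, 'a::complex_hilbert) l2. \<forall>y :: (nat, 'b::complex_hilbert) l2.
        continuous_map X euclidean (\<lambda>z. cinner (diag_op (g z) \<cdot> x) y))"
  unfolding wstar_eq continuous_map_into_pullback continuous_map_into_fun by auto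

lemma continuous_map_wstar_functional:
  fixes x :: "(nat, 'a::complex_hilbert) l2" and y :: "(nat, 'b::complex_hilbert) l2"
  shows "continuous_map wstar euclidean (\<lambda>T. cinner (diag_op T \<cdot> x) y)"
  using iffD1[OF continuous_map_into_wstar continuous_map_id, THEN spec, THEN spec, of x y] by simp

lemma continuous_map_euclidean_compose:
  "continuous_on UNIV g \<Longrightarrow> continuous_map X euclidean f \<Longrightarrow> continuous_map X euclidean (\<lambda>z. g (f z))"
  using continuous_map_compose[of X euclidean f euclidean g] by (simp add: o_def continuous_map_iff_continuous2)

lemma cinner_ket_tensor: "cinner (ket i \<otimes>\<^sub>v h) x = cinner h (l2_apply x i)"
proof -
  have "((\<lambda>j. cinner (l2_apply (ket i \<otimes>\<^sub>v h) j) (l2_apply x j)) has_sum S) UNIV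
     \<longleftrightarrow> ((\<lambda>j. cinner h (l2_apply x j)) has_sum S) {i}" for S
    by (rule has_sum_cong_neutral) (auto simp: tensor_vec.rep_eq ket.rep_eq)
  then have "((\<lambda>j. cinner (l2_apply (ket i \<otimes>\<^sub>v h) j) (l2_apply x j)) has_sum cinner h (l2_apply x i)) UNIV"
    using has_sum_finite[of "{i}" "\<lambda>j. cinner h (l2_apply x j)"] by simp
  then show ?thesis by (rule has_sum_unique[OF cinner_l2_has_sum])
qed

lemma diag_op_ket_tensor: "diag_op T \<cdot> (ket i \<otimes>\<^sub>v h) = ket i \<otimes>\<^sub>v (T \<cdot> h)"
  by (rule l2_eqI) (simp add: tensor_vec.rep_eq bop_scaleC_right)

text \<open>A sequence supported at index 0 realizes a single vector functional, so the weak*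
  topology refines \<open>wot\<close>.\<close>

lemma wstar_functional_vector:
  "cinner (T \<cdot> x) y = cinner (diag_op T \<cdot> (ket (0::nat) \<otimes>\<^sub>v x)) (ket 0 \<otimes>\<^sub>v y)"
  by (simp add: diag_op_ket_tensor cinner_ket_tensor tensor_vec.rep_eq ket.rep_eq)

lemma limitin_wstar_imp_wot: "limitin wstar T L F \<Longrightarrow> limitin wot T L F"
  unfolding limitin_wot_iff limitin_wstar_iff
  by (subst (1 2) wstar_functional_vector) blast

lemma Hausdorff_wstar: "Hausdorff_space (wstar :: ('a::complex_hilbert, 'b::complex_hilbert) bop topology)"
proof (rule Hausdorff_space_injective_preimage)
  let ?f = "\<lambda>(T :: ('a, 'b) bop) (x :: (nat, 'a) l2, y :: (nat, 'b) l2). cinner (diag_op T \<cdot> x) y"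
  show "Hausdorff_space (euclidean :: ((nat, 'a) l2 \<times> (nat, 'b) l2 \<Rightarrow> complex) topology)"
    using Hausdorff_space_product_topology[of "\<lambda>_. euclidean :: complex topology" "UNIV :: ((nat, 'a) l2 \<times> (nat, 'b) l2) set"]
    by (simp add: euclidean_product_topology)
  show "continuous_map wstar euclidean ?f"
    using iffD1[OF continuous_map_into_pullback, OF continuous_map_id[of wstar, unfolded wstar_eq id_def]]
    by (simp add: wstar_eq)
  show "inj_on ?f (topspace wstar)"
  proof (rule inj_onI)
    fix S T assume *: "?f S = ?f T"
    have "cinner (diag_op S \<cdot> x) y = cinner (diag_op T \<cdot> x) y" for x :: "(nat, 'a) l2" and y :: "(nat, 'b) l2"
      using fun_cong[OF *, of "(x, y)"] by simp
    then show "S = T"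
      by (intro bop_eqI_cinner) (subst (1 2) wstar_functional_vector, simp)
  qed
qed

section \<open>Weak* continuity of sums, multiples and compressions\<close>

lemma diag_op_add: "diag_op (S + T) = diag_op S + diag_op T"
  by (rule bop_eqI, rule l2_eqI) (simp add: bop_apply_simps l2_apply_simps)

lemma diag_op_scaleC: "diag_op (c *\<^sub>C T) = c *\<^sub>C diag_op T"
  by (rule bop_eqI, rule l2_eqI) (simp add: bop_apply_simps l2_apply_simps)

lemma diag_op_comp: "diag_op (S \<bullet>\<^sub>o T) = diag_op S \<bullet>\<^sub>o diag_op T"
  by (rule bop_eqI, rule l2_eqI) simp

lemma diag_op_zero [simp]: "diag_op 0 = 0"
  by (rule bop_eqI, rule l2_eqI) (simp add: l2_apply_simps)

lemma continuous_map_wstar_add: "continuous_map wstar wstar (\<lambda>S. S + T)"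
  unfolding continuous_map_into_wstar diag_op_add bop_apply_plus cinner_add_left
  by (intro allI continuous_map_add continuous_map_wstar_functional) simp

lemma continuous_map_wstar_scaleC: "continuous_map wstar wstar (\<lambda>S. c *\<^sub>C S)"
  unfolding continuous_map_into_wstar diag_op_scaleC bop_apply_scaleC cinner_scaleC_left
  by (intro allI continuous_map_euclidean_compose[of "\<lambda>z. c * z"] continuous_map_wstar_functional continuous_intros)

lemma continuous_map_wstar_compress: "continuous_map wstar wstar (\<lambda>Y. S \<bullet>\<^sub>o Y \<bullet>\<^sub>o T)"
proof -
  have "cinner (diag_op (S \<bullet>\<^sub>o Y \<bullet>\<^sub>o T) \<cdot> x) y = cinner (diag_op Y \<cdot> (diag_op T \<cdot> x)) (diag_op (adj S) \<cdot> y)"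
    for Y and x :: "(nat, _) l2" and y
    by (simp add: diag_op_comp adj_diag_op[symmetric] cinner_adj_right)
  then show ?thesis
    unfolding continuous_map_into_wstar by (simp add: continuous_map_wstar_functional)
qed

section \<open>Double sequences and amplifications\<close>

lemma l2_l2_summable:
  fixes z :: "('i, ('j, 'b::complex_hilbert) l2) l2"
  shows "((\<lambda>(i, j). (norm (l2_apply (l2_apply z i) j))\<^sup>2) has_sum (norm z)\<^sup>2) UNIV"
  using has_sum_nonneg_Sigma[of UNIV "\<lambda>i j. (norm (l2_apply (l2_apply z i) j))\<^sup>2", OF norm_l2_has_sum norm_l2_has_sum]
  by simp

lemma l2_l2_cinner_has_sum:
  fixes z w :: "('i, ('j, 'b::complex_hilbert) l2) l2"
  shows "((\<lambda>(i, j). cinner (l2_apply (l2_apply z i) j) (l2_apply (l2_apply w i) j)) has_sum cinner z w) UNIV"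
proof -
  let ?f = "\<lambda>(i, j). cinner (l2_apply (l2_apply z i) j) (l2_apply (l2_apply w i) j)"
  have summ: "?f summable_on UNIV"
  proof (rule abs_summable_summable, rule summable_on_dominated)
    show "(\<lambda>p. (case p of (i, j) \<Rightarrow> (norm (l2_apply (l2_apply z i) j))\<^sup>2) + (case p of (i, j) \<Rightarrow> (norm (l2_apply (l2_apply w i) j))\<^sup>2)) summable_on UNIV"
      by (intro summable_on_add has_sum_imp_summable[OF l2_l2_summable])
    fix p :: "'i \<times> 'j"
    obtain i j where p: "p = (i, j)" by fastforce
    let ?x = "l2_apply (l2_apply z i) j" and ?y = "l2_apply (l2_apply w i) j"
    have "cmod (cinner ?x ?y) \<le> norm ?x * norm ?y" by (rule cmod_cinner_le)
    also have "\<dots> \<le> (norm ?x)\<^sup>2 + (norm ?y)\<^sup>2"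
    proof -
      have "0 \<le> norm ?x * norm ?y" by simp
      then show ?thesis using sum_squares_bound[of "norm ?x" "norm ?y"] unfolding mult.assoc by linarith
    qed
    finally show "cmod (?f p) \<le> (case p of (i, j) \<Rightarrow> (norm (l2_apply (l2_apply z i) j))\<^sup>2) + (case p of (i, j) \<Rightarrow> (norm (l2_apply (l2_apply w i) j))\<^sup>2)"
      by (simp add: p)
  qed simp
  have "(?f has_sum cinner z w) (UNIV \<times> UNIV)"
    by (rule has_sum_SigmaI[OF _ cinner_l2_has_sum]) (use summ cinner_l2_has_sum in auto)
  then show ?thesis by simp
qed

text \<open>Cantor pairing turns a sequence of sequences into one sequence. An amplified
  amplification thereby becomes a single amplification, to which the functionals of
  \<open>wstar\<close> apply.\<close>

definition l2_flatten :: "(nat, (nat, 'b::complex_hilbert) l2) l2 \<Rightarrow> (nat, 'b) l2" where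
  "l2_flatten z = Abs_l2 (\<lambda>k. l2_apply (l2_apply z (fst (prod_decode k))) (snd (prod_decode k)))"

lemma has_sum_prod_decode:
  "((\<lambda>(i, j). f i j) has_sum S) UNIV \<Longrightarrow> ((\<lambda>k. f (fst (prod_decode k)) (snd (prod_decode k))) has_sum S) UNIV"
  using has_sum_reindex_bij_betw[OF bij_prod_decode, of "\<lambda>(i, j). f i j" S] by (simp add: case_prod_unfold)

lemma l2_flatten_apply:
  "l2_apply (l2_flatten z) k = l2_apply (l2_apply z (fst (prod_decode k))) (snd (prod_decode k))"
  unfolding l2_flatten_def
  by (subst l2_apply_Abs) (rule has_sum_imp_summable[OF has_sum_prod_decode[OF l2_l2_summable]], rule refl)

lemma cinner_l2_flatten: "cinner (l2_flatten z) (l2_flatten w) = cinner z w"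
  by (rule has_sum_unique[OF cinner_l2_has_sum])
     (use has_sum_prod_decode[OF l2_l2_cinner_has_sum[of z w]] in \<open>simp add: l2_flatten_apply\<close>)

lemma diag_op_flatten: "diag_op T \<cdot> l2_flatten z = l2_flatten (diag_op (diag_op T) \<cdot> z)"
  by (rule l2_eqI) (simp add: l2_flatten_apply)

text \<open>Amplifying the image moves \<open>diag_op V\<close> onto both vectors; flattening these
  leaves a weak* functional of \<open>T\<close>.\<close>

lemma continuous_map_wstar_amplify:
  fixes V :: "('h::complex_hilbert, (nat, 'a::complex_hilbert) l2) bop"
  shows "continuous_map wstar wstar (\<lambda>T. adj V \<bullet>\<^sub>o diag_op T \<bullet>\<^sub>o V)"
proof -
  have "cinner (diag_op (adj V \<bullet>\<^sub>o diag_op T \<bullet>\<^sub>o V) \<cdot> x) y =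
      cinner (diag_op T \<cdot> l2_flatten (diag_op V \<cdot> x)) (l2_flatten (diag_op V \<cdot> y))"
    for T and x :: "(nat, _) l2" and y
    by (simp add: diag_op_flatten cinner_l2_flatten diag_op_comp adj_diag_op[symmetric] cinner_adj_left)
  then show ?thesis
    unfolding continuous_map_into_wstar by (simp add: continuous_map_wstar_functional)
qed

text \<open>Polarization followed by the parallelogram law. The bound does not depend on
  \<open>Y\<close>, as domination in \<open>wstar_limit_zero\<close> requires.\<close>

lemma pos_form_le:
  assumes pos: "\<And>x. cinner (Y \<cdot> x) x = of_real (q x)" and q: "\<And>x. 0 \<le> q x" "\<And>x. q x \<le> (norm x)\<^sup>2"
  shows "cmod (cinner (Y \<cdot> x) y) \<le> (norm x)\<^sup>2 + (norm y)\<^sup>2"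
proof -
  have "4 * cmod (cinner (Y \<cdot> x) y) = cmod (4 * cinner (Y \<cdot> x) y)" by (simp add: norm_mult)
  also have "\<dots> \<le> q (x + y) + q (x - y) + q (x + \<i> *\<^sub>C y) + q (x - \<i> *\<^sub>C y)"
    unfolding bop_form_polarization pos
    by (intro order_trans[OF norm_triangle_ineq4] order_trans[OF norm_triangle_ineq] add_mono)
       (simp_all add: norm_mult q)
  also have "\<dots> \<le> (norm (x + y))\<^sup>2 + (norm (x - y))\<^sup>2 + (norm (x + \<i> *\<^sub>C y))\<^sup>2 + (norm (x - \<i> *\<^sub>C y))\<^sup>2"
    by (intro add_mono q)
  also have "\<dots> = 4 * (norm x)\<^sup>2 + 4 * (norm y)\<^sup>2" by (rule parallelogram4)
  finally show ?thesis by simp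
qed

text \<open>Polarization gives convergence of each matrix coefficient. The uniform bound of
  \<open>pos_form_le\<close> dominates the series of a weak* functional, so Tannery's theorem passes
  to the limit termwise.\<close>

lemma wstar_limit_zero:
  fixes Y :: "nat \<Rightarrow> ('a::complex_hilbert, 'a) bop"
  assumes pos: "\<And>s x. cinner (Y s \<cdot> x) x = of_real (q s x)" and q: "\<And>s x. 0 \<le> q s x" "\<And>s x. q s x \<le> (norm x)\<^sup>2"
    and lim: "\<And>x. (\<lambda>s. q s x) \<longlonglongrightarrow> 0"
  shows "limitin wstar Y 0 sequentially"
  unfolding limitin_wstar_iff
proof (intro allI)
  fix x :: "(nat, 'a) l2" and y :: "(nat, 'a) l2"
  have l0: "(\<lambda>s. cinner (Y s \<cdot> u) v) \<longlonglongrightarrow> 0" for u v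
  proof -
    have "(\<lambda>s. 4 * cinner (Y s \<cdot> u) v) \<longlonglongrightarrow> of_real 0 - of_real 0 + \<i> * of_real 0 - \<i> * of_real 0"
      unfolding bop_form_polarization pos by (intro tendsto_intros lim)
    then have "(\<lambda>s. (1/4) * (4 * cinner (Y s \<cdot> u) v)) \<longlonglongrightarrow> (1/4) * 0" by (intro tendsto_mult) auto
    then show ?thesis by simp
  qed
  have bnd: "cmod (cinner (Y s \<cdot> u) v) \<le> (norm u)\<^sup>2 + (norm v)\<^sup>2" for s u v
    by (rule pos_form_le[of _ "q s"]) (use pos q in auto)
  have "(\<lambda>s. suminf (\<lambda>k. cinner (Y s \<cdot> l2_apply x k) (l2_apply y k))) \<longlonglongrightarrow> suminf (\<lambda>k. 0)"
  proof (rule tannerys_theorem[THEN conjunct2, THEN conjunct2])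
    show "summable (\<lambda>k. (norm (l2_apply x k))\<^sup>2 + (norm (l2_apply y k))\<^sup>2)"
      by (intro summable_add summable_on_imp_summable l2_norm_summable)
    show "\<forall>\<^sub>F (k, s) in sequentially \<times>\<^sub>F sequentially. cmod (cinner (Y s \<cdot> l2_apply x k) (l2_apply y k))
        \<le> (norm (l2_apply x k))\<^sup>2 + (norm (l2_apply y k))\<^sup>2"
      by (rule always_eventually) (simp add: bnd split_beta)
  qed (use l0 in auto)
  moreover have "suminf (\<lambda>k. cinner (Y s \<cdot> l2_apply x k) (l2_apply y k)) = cinner (diag_op (Y s) \<cdot> x) y" for s
    using has_sum_imp_sums[OF cinner_l2_has_sum[of "diag_op (Y s) \<cdot> x" y]] by (simp add: sums_iff)
  ultimately show "(\<lambda>s. cinner (diag_op (Y s) \<cdot> x) y) \<longlonglongrightarrow> cinner (diag_op 0 \<cdot> x) y" by simp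
qed

section \<open>The maps \<open>\<Phi>\<close>\<close>

abbreviation adj_word :: "(nat \<Rightarrow> ('a::complex_hilbert, 'a) bop) \<Rightarrow> nat list \<Rightarrow> ('a, 'a) bop" where
  "adj_word X \<alpha> \<equiv> adj (word_op bop_id X \<alpha>)"

abbreviation Phi_part ::
  "(nat list \<Rightarrow> real) \<Rightarrow> (nat \<Rightarrow> ('a::complex_hilbert, 'a) bop) \<Rightarrow> ('a, 'a) bop \<Rightarrow> nat list set \<Rightarrow> ('a, 'a) bop" where
  "Phi_part a X Y F \<equiv> \<Sum>\<alpha>\<in>F. a \<alpha> *\<^sub>R (word_op bop_id X \<alpha> \<bullet>\<^sub>o Y \<bullet>\<^sub>o adj_word X \<alpha>)"

text \<open>What well-definedness at the identity amounts to: a uniform bound for the finite partial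
  sums, which is exactly the input of \<open>col_op_apply\<close>.\<close>

definition Phi_bounded ::
  "nat \<Rightarrow> (nat list \<Rightarrow> real) \<Rightarrow> (nat \<Rightarrow> ('a::complex_hilbert, 'a) bop) \<Rightarrow> bool" where
  "Phi_bounded n a X \<longleftrightarrow> (\<exists>C. \<forall>F x. finite F \<and> F \<subseteq> words n \<longrightarrow>
     (\<Sum>\<alpha>\<in>F. a \<alpha> * (norm (adj_word X \<alpha> \<cdot> x))\<^sup>2) \<le> C * (norm x)\<^sup>2)"

text \<open>A Stinespring column for \<Phi>, since
  \<open>\<Phi>(Y) = adj V (I \<otimes> Y) V\<close> with \<open>V\<close> this operator.
  Coordinates outside the monoid are set to 0.\<close>

definition Phi_col ::
  "nat \<Rightarrow> (nat list \<Rightarrow> real) \<Rightarrow> (nat \<Rightarrow> ('a::complex_hilbert, 'a) bop) \<Rightarrow> ('a, (nat list, 'a) l2) bop" where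
  "Phi_col n a X = col_op (\<lambda>\<alpha>. if \<alpha> \<in> words n then sqrt (a \<alpha>) *\<^sub>R adj_word X \<alpha> else 0)"

locale phi_map =
  fixes n :: nat and a :: "nat list \<Rightarrow> real" and X :: "nat \<Rightarrow> ('a::complex_hilbert, 'a) bop"
  assumes nonneg: "\<And>\<alpha>. \<alpha> \<in> words n \<Longrightarrow> 0 \<le> a \<alpha>" and bounded: "Phi_bounded n a X"
begin

lemma Phi_col_apply:
  "l2_apply (Phi_col n a X \<cdot> x) \<alpha> = (if \<alpha> \<in> words n then sqrt (a \<alpha>) *\<^sub>R (adj_word X \<alpha> \<cdot> x) else 0)"
proof -
  obtain C where C: "\<And>F x. finite F \<Longrightarrow> F \<subseteq> words n \<Longrightarrow>
     (\<Sum>\<alpha>\<in>F. a \<alpha> * (norm (adj_word X \<alpha> \<cdot> x))\<^sup>2) \<le> C * (norm x)\<^sup>2"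
    using bounded unfolding Phi_bounded_def by blast
  have "(\<Sum>\<alpha>\<in>F. (norm ((if \<alpha> \<in> words n then sqrt (a \<alpha>) *\<^sub>R adj_word X \<alpha> else 0) \<cdot> x))\<^sup>2) \<le> C * (norm x)\<^sup>2"
    if F: "finite F" for F x
  proof -
    have "(\<Sum>\<alpha>\<in>F. (norm ((if \<alpha> \<in> words n then sqrt (a \<alpha>) *\<^sub>R adj_word X \<alpha> else 0) \<cdot> x))\<^sup>2)
        = (\<Sum>\<alpha>\<in>F \<inter> words n. a \<alpha> * (norm (adj_word X \<alpha> \<cdot> x))\<^sup>2)"
      unfolding sum.inter_restrict[OF F]
      by (rule sum.cong) (auto simp: bop_apply_simps power_mult_distrib nonneg)
    also have "\<dots> \<le> C * (norm x)\<^sup>2" using F by (intro C) auto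
    finally show ?thesis .
  qed
  from col_op_apply[of "\<lambda>\<alpha>. if \<alpha> \<in> words n then sqrt (a \<alpha>) *\<^sub>R adj_word X \<alpha> else 0", OF this]
  show ?thesis by (simp add: Phi_col_def bop_apply_simps)
qed

lemma Phi_partial_sum_form:
  assumes "F \<subseteq> words n"
  shows "cinner ((Phi_part a X Y F) \<cdot> x) y =
    (\<Sum>\<alpha>\<in>F. cinner (Y \<cdot> l2_apply (Phi_col n a X \<cdot> x) \<alpha>) (l2_apply (Phi_col n a X \<cdot> y) \<alpha>))"
  unfolding bop_apply_sum cinner_sum_left
proof (rule sum.cong)
  fix \<alpha> assume "\<alpha> \<in> F"
  with assms have "\<alpha> \<in> words n" by blast
  then show "cinner ((a \<alpha> *\<^sub>R (word_op bop_id X \<alpha> \<bullet>\<^sub>o Y \<bullet>\<^sub>o adj_word X \<alpha>)) \<cdot> x) y =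
      cinner (Y \<cdot> l2_apply (Phi_col n a X \<cdot> x) \<alpha>) (l2_apply (Phi_col n a X \<cdot> y) \<alpha>)"
    using nonneg[of \<alpha>]
    by (simp add: Phi_col_apply bop_apply_simps bop_scaleR_right cinner_simps cinner_adj_right mult.assoc[symmetric]
        flip: of_real_mult)
qed simp

text \<open>A weak* functional of the limit is an absolutely convergent double series over sequence
  index and word; summing over the index first exhibits it as the limit of the functionals of the
  partial sums. The stronger topology is needed to push the sum through a weak* continuous
  map.\<close>

lemma Phi_sums_wstar:
  "limitin wstar (\<lambda>F. Phi_part a X Y F)
     (adj (Phi_col n a X) \<bullet>\<^sub>o diag_op Y \<bullet>\<^sub>o Phi_col n a X) (finite_subsets_at_top (words n))"
  unfolding limitin_wstar_iff
proof (intro allI)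
  fix x y :: "(nat, 'a) l2"
  let ?V = "Phi_col n a X"
  let ?f = "\<lambda>i \<alpha>. cinner (Y \<cdot> l2_apply (?V \<cdot> l2_apply x i) \<alpha>) (l2_apply (?V \<cdot> l2_apply y i) \<alpha>)"
  have joint: "((\<lambda>(i, \<alpha>). ?f i \<alpha>) has_sum cinner (diag_op (adj ?V \<bullet>\<^sub>o diag_op Y \<bullet>\<^sub>o ?V) \<cdot> x) y) UNIV"
    using l2_l2_cinner_has_sum[of "diag_op (diag_op Y) \<cdot> (diag_op ?V \<cdot> x)" "diag_op ?V \<cdot> y"]
    by (simp add: diag_op_comp adj_diag_op[symmetric] cinner_adj_left)
  then have sw: "((\<lambda>(\<alpha>, i). ?f i \<alpha>) has_sum cinner (diag_op (adj ?V \<bullet>\<^sub>o diag_op Y \<bullet>\<^sub>o ?V) \<cdot> x) y) (UNIV \<times> UNIV)"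
    using has_sum_swap[where f = "\<lambda>(i, \<alpha>). ?f i \<alpha>" and A = UNIV and B = UNIV] by simp
  define g where "g \<alpha> = (\<Sum>\<^sub>\<infinity>i. ?f i \<alpha>)" for \<alpha>
  have col: "((\<lambda>i. ?f i \<alpha>) has_sum g \<alpha>) UNIV" for \<alpha>
  proof -
    have "(\<lambda>i. ?f i \<alpha>) summable_on UNIV"
      using cinner_l2_summable[of "diag_op (Y \<bullet>\<^sub>o l2_coord \<alpha> \<bullet>\<^sub>o ?V) \<cdot> x" "diag_op (l2_coord \<alpha> \<bullet>\<^sub>o ?V) \<cdot> y"] by simp
    then show ?thesis by (simp add: g_def)
  qed
  have "(g has_sum cinner (diag_op (adj ?V \<bullet>\<^sub>o diag_op Y \<bullet>\<^sub>o ?V) \<cdot> x) y) UNIV"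
    by (rule has_sum_SigmaD[OF sw]) (use col in auto)
  moreover have "g \<alpha> = 0" if "\<alpha> \<notin> words n" for \<alpha>
    using that by (simp add: g_def Phi_col_apply)
  ultimately have g_sum: "(g has_sum cinner (diag_op (adj ?V \<bullet>\<^sub>o diag_op Y \<bullet>\<^sub>o ?V) \<cdot> x) y) (words n)"
    by (subst has_sum_cong_neutral[where T = UNIV and g = g]) auto
  have eq: "sum g F = cinner (diag_op (Phi_part a X Y F) \<cdot> x) y"
    if "finite F" "F \<subseteq> words n" for F
  proof (rule has_sum_unique)
    show "((\<lambda>i. \<Sum>\<alpha>\<in>F. ?f i \<alpha>) has_sum sum g F) UNIV"
      using that(1) by (induction F) (auto intro: has_sum_add col)
    show "((\<lambda>i. \<Sum>\<alpha>\<in>F. ?f i \<alpha>) has_sum cinner (diag_op (Phi_part a X Y F) \<cdot> x) y) UNIV"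
      using cinner_l2_has_sum[of "diag_op (Phi_part a X Y F) \<cdot> x" y]
      by (simp only: diag_op_apply Phi_partial_sum_form[OF that(2)])
  qed
  show "((\<lambda>F. cinner (diag_op (Phi_part a X Y F) \<cdot> x) y)
      \<longlongrightarrow> cinner (diag_op (adj ?V \<bullet>\<^sub>o diag_op Y \<bullet>\<^sub>o ?V) \<cdot> x) y) (finite_subsets_at_top (words n))"
    using g_sum unfolding has_sum_def
    by (rule Lim_transform_eventually) (rule eventually_finite_subsets_at_top_weakI, rule eq)
qed

lemma Phi_eq: "Phi n a X Y = adj (Phi_col n a X) \<bullet>\<^sub>o diag_op Y \<bullet>\<^sub>o Phi_col n a X"
  unfolding Phi_def
proof (rule the_equality)
  let ?L = "adj (Phi_col n a X) \<bullet>\<^sub>o diag_op Y \<bullet>\<^sub>o Phi_col n a X"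
  show s: "Phi_sums_to n a X Y ?L"
    unfolding Phi_sums_to_def by (rule limitin_wstar_imp_wot[OF Phi_sums_wstar])
  show "L = ?L" if "Phi_sums_to n a X Y L" for L
    using s that unfolding Phi_sums_to_def limitin_wot_iff
    by (intro bop_eqI_cinner) (blast intro: tendsto_unique[OF finite_subsets_at_top_neq_bot])
qed

lemma Phi_wstar_limit:
  "limitin wstar (\<lambda>F. Phi_part a X Y F)
     (Phi n a X Y) (finite_subsets_at_top (words n))"
  unfolding Phi_eq by (rule Phi_sums_wstar)

lemma Phi_has_sum:
  "((\<lambda>\<alpha>. a \<alpha> *\<^sub>R cinner (Y \<cdot> (adj_word X \<alpha> \<cdot> x)) (adj_word X \<alpha> \<cdot> y))
     has_sum cinner (Phi n a X Y \<cdot> x) y) (words n)"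
proof -
  have "((\<lambda>\<alpha>. cinner (Y \<cdot> l2_apply (Phi_col n a X \<cdot> x) \<alpha>) (l2_apply (Phi_col n a X \<cdot> y) \<alpha>))
      has_sum cinner (Phi n a X Y \<cdot> x) y) UNIV"
    using cinner_l2_has_sum[of "diag_op Y \<cdot> (Phi_col n a X \<cdot> x)" "Phi_col n a X \<cdot> y"]
    by (simp add: Phi_eq cinner_adj_left)
  then show ?thesis
    by (subst has_sum_cong_neutral[where T = UNIV])
       (auto simp: Phi_col_apply bop_scaleR_right cinner_simps nonneg scaleR_conv_of_real mult.assoc[symmetric] simp flip: of_real_mult)
qed

lemma Phi_has_sum_Re:
  "((\<lambda>\<alpha>. a \<alpha> * qform Y (adj_word X \<alpha> \<cdot> x))
     has_sum qform (Phi n a X Y) x) (words n)"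
  using has_sum_Re[OF Phi_has_sum[of Y x x]] by simp

lemma pos_op_Phi: "pos_op Y \<Longrightarrow> pos_op (Phi n a X Y)"
proof -
  assume Y: "pos_op Y"
  have "cinner (Phi n a X Y \<cdot> x) x = cinner (diag_op Y \<cdot> (Phi_col n a X \<cdot> x)) (Phi_col n a X \<cdot> x)" for x
    by (simp add: Phi_eq cinner_adj_left)
  moreover have "adj (diag_op Y) = diag_op Y" by (simp add: adj_diag_op pos_op_selfadj[OF Y])
  ultimately have "cinner (Phi n a X Y \<cdot> x) x = of_real (qform (Phi n a X Y) x)" for x
    using selfadj_cinner_real[of "diag_op Y"] by metis
  moreover have "0 \<le> qform (Phi n a X Y) x" for x
    by (rule has_sum_nonneg[OF Phi_has_sum_Re]) (simp add: nonneg pos_op_Re[OF Y])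
  ultimately show ?thesis unfolding pos_op_iff by blast
qed

lemma Phi_mono:
  assumes "\<And>x. qform Y x \<le> qform Z x"
  shows "qform (Phi n a X Y) x \<le> qform (Phi n a X Z) x"
  by (rule has_sum_mono[OF Phi_has_sum_Re Phi_has_sum_Re]) (simp add: nonneg assms mult_left_mono)

end

text \<open>At the identity the partial sums have nonnegative terms, so each lies below the
  quadratic form of the limit \<open>L\<close>.\<close>

lemma phi_map_well_defined:
  assumes "\<And>\<alpha>. \<alpha> \<in> words n \<Longrightarrow> 0 \<le> a \<alpha>" and "Phi_well_defined n a X"
  shows "phi_map n a X"
proof
  show "Phi_bounded n a X"
  proof -
    obtain L where L: "Phi_sums_to n a X bop_id L" using assms(2) by (auto simp: Phi_well_defined_def)
    have lim: "((\<lambda>F. \<Sum>\<alpha>\<in>F. a \<alpha> * (norm (adj_word X \<alpha> \<cdot> x))\<^sup>2) \<longlongrightarrow> qform L x)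
        (finite_subsets_at_top (words n))" for x
    proof -
      have "((\<lambda>F. qform (Phi_part a X bop_id F) x)
          \<longlongrightarrow> qform L x) (finite_subsets_at_top (words n))"
        using L by (intro tendsto_Re) (simp add: Phi_sums_to_def limitin_wot_iff)
      moreover have "qform (Phi_part a X bop_id F) x
          = (\<Sum>\<alpha>\<in>F. a \<alpha> * (norm (adj_word X \<alpha> \<cdot> x))\<^sup>2)" for F
      proof -
        have "cinner (word_op bop_id X \<alpha> \<cdot> (adj_word X \<alpha> \<cdot> x)) x = of_real ((norm (adj_word X \<alpha> \<cdot> x))\<^sup>2)" for \<alpha>
          by (simp only: cinner_self[symmetric] cinner_adj_right)
        then show ?thesis by (simp add: bop_apply_simps cinner_sum_left cinner_scaleR_left)
      qed
      ultimately show ?thesis by simp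
    qed
    have "(\<Sum>\<alpha>\<in>F. a \<alpha> * (norm (adj_word X \<alpha> \<cdot> x))\<^sup>2) \<le> bop_norm L * (norm x)\<^sup>2"
      if "finite F" "F \<subseteq> words n" for F x
    proof -
      have "(\<Sum>\<alpha>\<in>F. a \<alpha> * (norm (adj_word X \<alpha> \<cdot> x))\<^sup>2) \<le> qform L x"
        by (rule finite_sum_le_has_sum[where A = "words n"])
           (use lim that assms(1) in \<open>auto simp: has_sum_def\<close>)
      also have "\<dots> \<le> bop_norm L * (norm x)\<^sup>2" by (rule Re_cinner_bop_le)
      finally show ?thesis .
    qed
    then show ?thesis unfolding Phi_bounded_def by blast
  qed
qed (use assms in auto)

section \<open>Coefficients of powers of \<open>1 / (1 - f)\<close>\<close>

text \<open>The Cauchy product of formal power series in noncommuting indeterminates. The recursion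
  on the word, with \<open>c\<close> shifted, makes associativity a short induction.\<close>

fun conv :: "('a list \<Rightarrow> real) \<Rightarrow> ('a list \<Rightarrow> real) \<Rightarrow> 'a list \<Rightarrow> real" where
  "conv c d [] = c [] * d []"
| "conv c d (x # \<alpha>) = c [] * d (x # \<alpha>) + conv (\<lambda>\<beta>. c (x # \<beta>)) d \<alpha>"

lemma conv_eq_sum: "conv c d \<alpha> = (\<Sum>i\<le>length \<alpha>. c (take i \<alpha>) * d (drop i \<alpha>))"
  by (induction \<alpha> arbitrary: c) (simp_all add: sum.atMost_Suc_shift del: sum.atMost_Suc)

lemma conv_add_left: "conv (\<lambda>\<beta>. c \<beta> + c' \<beta>) d \<alpha> = conv c d \<alpha> + conv c' d \<alpha>"
  by (simp add: conv_eq_sum algebra_simps sum.distrib)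

lemma conv_mult_left: "conv (\<lambda>\<beta>. r * c \<beta>) d \<alpha> = r * conv c d \<alpha>"
  by (simp add: conv_eq_sum sum_distrib_left mult.assoc)

lemma conv_sum_right: "conv c (\<lambda>\<beta>. \<Sum>p\<in>P. u p * d p \<beta>) \<alpha> = (\<Sum>p\<in>P. u p * conv c (d p) \<alpha>)"
proof -
  have "conv c (\<lambda>\<beta>. \<Sum>p\<in>P. u p * d p \<beta>) \<alpha> = (\<Sum>i\<le>length \<alpha>. \<Sum>p\<in>P. u p * (c (take i \<alpha>) * d p (drop i \<alpha>)))"
    unfolding conv_eq_sum sum_distrib_left by (intro sum.cong refl) (rule mult.left_commute)
  also have "\<dots> = (\<Sum>p\<in>P. u p * conv c (d p) \<alpha>)"
    unfolding conv_eq_sum sum_distrib_left by (rule sum.swap)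
  finally show ?thesis .
qed

lemma conv_assoc: "conv (conv c d) e \<alpha> = conv c (conv d e) \<alpha>"
  by (induction \<alpha> arbitrary: c) (simp_all add: conv_add_left conv_mult_left algebra_simps)

definition unit_coeff :: "'a list \<Rightarrow> real" where
  "unit_coeff \<alpha> = (if \<alpha> = [] then 1 else 0)"

lemma conv_unit_left [simp]: "conv unit_coeff d \<alpha> = d \<alpha>"
proof (cases \<alpha>)
  case (Cons x \<beta>)
  have "conv (\<lambda>\<gamma>. unit_coeff (x # \<gamma>)) d \<beta> = 0" by (simp add: conv_eq_sum unit_coeff_def)
  with Cons show ?thesis by (simp add: unit_coeff_def)
qed (simp add: unit_coeff_def)

lemma conv_cong: "(\<And>i. i \<le> length \<alpha> \<Longrightarrow> d (drop i \<alpha>) = d' (drop i \<alpha>)) \<Longrightarrow> conv c d \<alpha> = conv c d' \<alpha>"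
  unfolding conv_eq_sum by (rule sum.cong) auto

primrec conv_pow :: "('a list \<Rightarrow> real) \<Rightarrow> nat \<Rightarrow> 'a list \<Rightarrow> real" where
  "conv_pow a 0 = unit_coeff"
| "conv_pow a (Suc p) = conv a (conv_pow a p)"

lemma conv_drop_first:
  assumes "a [] = 0"
  shows "conv a d \<alpha> = (\<Sum>i=1..length \<alpha>. a (take i \<alpha>) * d (drop i \<alpha>))"
proof -
  have "{..length \<alpha>} = insert 0 {1..length \<alpha>}" by auto
  then show ?thesis using assms by (simp add: conv_eq_sum)
qed

lemma conv_pow_eq_0: "a [] = 0 \<Longrightarrow> length \<alpha> < p \<Longrightarrow> conv_pow a p \<alpha> = 0"
proof (induction p arbitrary: \<alpha>)
  case (Suc p)
  then show ?case by (auto simp: conv_drop_first intro!: sum.neutral)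
qed simp

text \<open>The coefficient of \<open>t^p\<close> in \<open>(1 - t)^(-q)\<close>, with
  \<open>q = 0\<close> included as the unit.\<close>

definition binom_coeff :: "nat \<Rightarrow> nat \<Rightarrow> real" where
  "binom_coeff q p = (if q = 0 then if p = 0 then 1 else 0 else real ((p + q - 1) choose (q - 1)))"

lemma binom_coeff_nonneg [simp]: "0 \<le> binom_coeff q p"
  by (simp add: binom_coeff_def)

lemma binom_coeff_0 [simp]: "binom_coeff q 0 = 1"
  by (simp add: binom_coeff_def)

text \<open>Pascal's rule, expressing
  \<open>(1 - t) (1 - t)^(-(q + 1)) = (1 - t)^(-q)\<close>.\<close>

lemma binom_coeff_Suc: "binom_coeff (Suc q) (Suc p) = binom_coeff (Suc q) p + binom_coeff q (Suc p)"
  by (cases q) (auto simp: binom_coeff_def)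

text \<open>\<open>bq a q\<close> agrees with \<open>b_coeff a q\<close> for \<open>q \<ge> 1\<close>. For \<open>q = 0\<close> it is the unit, whereas the truncated
  subtraction in \<open>b_coeff\<close> gives \<open>b_coeff a 0 = b_coeff a 1\<close>.\<close>

definition bq :: "('a list \<Rightarrow> real) \<Rightarrow> nat \<Rightarrow> 'a list \<Rightarrow> real" where
  "bq a q \<alpha> = (\<Sum>p\<le>length \<alpha>. binom_coeff q p * conv_pow a p \<alpha>)"

lemma bq_0: "bq a 0 \<alpha> = unit_coeff \<alpha>"
proof -
  have "bq a 0 \<alpha> = (\<Sum>p\<le>length \<alpha>. if p = 0 then unit_coeff \<alpha> else 0)"
    unfolding bq_def by (rule sum.cong) (auto simp: binom_coeff_def)
  then show ?thesis by simp
qed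

context
  fixes a :: "'a list \<Rightarrow> real"
  assumes a0: "a [] = 0"
begin

lemma bq_eq_sum: "length \<alpha> \<le> N \<Longrightarrow> bq a q \<alpha> = (\<Sum>p\<le>N. binom_coeff q p * conv_pow a p \<alpha>)"
  unfolding bq_def by (rule sum.mono_neutral_left) (auto simp: conv_pow_eq_0 a0)

lemma conv_bq: "length \<alpha> \<le> N \<Longrightarrow> conv a (bq a q) \<alpha> = (\<Sum>p\<le>N. binom_coeff q p * conv_pow a (Suc p) \<alpha>)"
proof -
  assume N: "length \<alpha> \<le> N"
  have "conv a (bq a q) \<alpha> = conv a (\<lambda>\<beta>. \<Sum>p\<le>N. binom_coeff q p * conv_pow a p \<beta>) \<alpha>"
    by (rule conv_cong) (use N in \<open>auto intro!: bq_eq_sum\<close>)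
  then show ?thesis by (simp add: conv_sum_right)
qed

text \<open>The identity \<open>(1 - a) * (1 - a)^(-(q + 1)) = (1 - a)^(-q)\<close> for
  coefficients: one application of \<open>id - \<Phi>\<close> lowers the exponent by one.\<close>

lemma bq_Suc: "bq a (Suc q) \<alpha> = bq a q \<alpha> + conv a (bq a (Suc q)) \<alpha>"
proof -
  let ?N = "length \<alpha>"
  \<comment> \<open>The range reaches one beyond the length, where the power contributes 0, so that
    the index shift leaves sums up to the length.\<close>
  have "bq a (Suc q) \<alpha> = (\<Sum>p\<le>Suc ?N. binom_coeff (Suc q) p * conv_pow a p \<alpha>)"
    by (rule bq_eq_sum) simp
  also have "\<dots> = unit_coeff \<alpha> + (\<Sum>p\<le>?N. binom_coeff (Suc q) (Suc p) * conv_pow a (Suc p) \<alpha>)"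
    by (simp add: sum.atMost_Suc_shift del: sum.atMost_Suc)
  also have "\<dots> = (unit_coeff \<alpha> + (\<Sum>p\<le>?N. binom_coeff q (Suc p) * conv_pow a (Suc p) \<alpha>))
      + (\<Sum>p\<le>?N. binom_coeff (Suc q) p * conv_pow a (Suc p) \<alpha>)"
    by (simp add: binom_coeff_Suc distrib_right sum.distrib)
  also have "unit_coeff \<alpha> + (\<Sum>p\<le>?N. binom_coeff q (Suc p) * conv_pow a (Suc p) \<alpha>)
      = (\<Sum>p\<le>Suc ?N. binom_coeff q p * conv_pow a p \<alpha>)"
    by (simp add: sum.atMost_Suc_shift del: sum.atMost_Suc)
  also have "\<dots> = bq a q \<alpha>" by (rule bq_eq_sum[symmetric]) simp
  also have "(\<Sum>p\<le>?N. binom_coeff (Suc q) p * conv_pow a (Suc p) \<alpha>) = conv a (bq a (Suc q)) \<alpha>"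
    by (rule conv_bq[symmetric]) simp
  finally show ?thesis .
qed

text \<open>Without a constant term in \<open>a\<close>, the convolution at \<alpha> involves only
  proper suffixes of \<alpha>, and induction on the length applies.\<close>

lemma conv_fixpoint_unique:
  assumes x: "\<And>\<alpha>. x \<alpha> = y \<alpha> + conv a x \<alpha>" and x': "\<And>\<alpha>. x' \<alpha> = y \<alpha> + conv a x' \<alpha>"
  shows "x \<alpha> = x' \<alpha>"
proof (induction \<alpha> rule: length_induct)
  case (1 \<alpha>)
  have "conv a x \<alpha> = conv a x' \<alpha>"
    unfolding conv_drop_first[where a = a, OF a0] by (rule sum.cong) (use 1 in auto)
  with x x' show ?case by simp
qed

text \<open>Both sides solve \<open>x = bq a q + a * x\<close>, whose solution is unique since \<open>a [] = 0\<close>.\<close>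

lemma bq_Suc_conv: "bq a (Suc q) \<alpha> = conv (bq a 1) (bq a q) \<alpha>"
proof (rule conv_fixpoint_unique)
  show "bq a (Suc q) \<alpha> = bq a q \<alpha> + conv a (bq a (Suc q)) \<alpha>" for \<alpha> by (rule bq_Suc)
  show "conv (bq a 1) (bq a q) \<alpha> = bq a q \<alpha> + conv a (conv (bq a 1) (bq a q)) \<alpha>" for \<alpha>
  proof -
    have "bq a 1 = (\<lambda>\<beta>. unit_coeff \<beta> + conv a (bq a 1) \<beta>)"
      using bq_Suc[of 0] by (simp add: fun_eq_iff bq_0)
    then have "conv (bq a 1) (bq a q) \<alpha> = conv (\<lambda>\<beta>. unit_coeff \<beta> + conv a (bq a 1) \<beta>) (bq a q) \<alpha>"
      by (rule arg_cong)
    then show ?thesis by (simp add: conv_add_left conv_assoc)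
  qed
qed

end

text \<open>Splitting off the first block matches compositions into \<open>p + 1\<close> parts with
  a cut position and a composition of the remaining suffix. Finiteness travels along because
  regrouping the sum requires it.\<close>

lemma compositions_sum:
  assumes "a [] = 0"
  shows "finite {\<gamma>. length \<gamma> = p \<and> concat \<gamma> = \<alpha> \<and> (\<forall>\<beta>\<in>set \<gamma>. length \<beta> \<ge> 1)} \<and>
    (\<Sum>\<gamma> | length \<gamma> = p \<and> concat \<gamma> = \<alpha> \<and> (\<forall>\<beta>\<in>set \<gamma>. length \<beta> \<ge> 1). (\<Prod>\<beta>\<leftarrow>\<gamma>. a \<beta>)) = conv_pow a p \<alpha>"
proof (induction p arbitrary: \<alpha>)
  case 0
  have "{\<gamma>. length \<gamma> = 0 \<and> concat \<gamma> = \<alpha> \<and> (\<forall>\<beta>\<in>set \<gamma>. length \<beta> \<ge> 1)} = (if \<alpha> = [] then {[]} else {})" by auto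
  then show ?case by (simp add: unit_coeff_def)
next
  case (Suc p)
  define G where "G p \<alpha> = {\<gamma>. length \<gamma> = p \<and> concat \<gamma> = \<alpha> \<and> (\<forall>\<beta>\<in>set \<gamma>. length \<beta> \<ge> 1)}" for p and \<alpha> :: "'a list"
  have fin: "finite (G p \<beta>)" and IH: "(\<Sum>\<gamma>\<in>G p \<beta>. (\<Prod>\<beta>\<leftarrow>\<gamma>. a \<beta>)) = conv_pow a p \<beta>" for \<beta>
    using Suc.IH by (auto simp: G_def)
  have G: "G (Suc p) \<alpha> = (\<lambda>(i, \<gamma>). take i \<alpha> # \<gamma>) ` (SIGMA i:{1..length \<alpha>}. G p (drop i \<alpha>))"
  proof (intro set_eqI iffI)
    fix \<gamma> assume "\<gamma> \<in> G (Suc p) \<alpha>"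
    then obtain \<beta> \<delta> where "\<gamma> = \<beta> # \<delta>" "length \<delta> = p" "\<beta> @ concat \<delta> = \<alpha>" "length \<beta> \<ge> 1" "\<forall>\<beta>\<in>set \<delta>. length \<beta> \<ge> 1"
      by (cases \<gamma>) (auto simp: G_def)
    then show "\<gamma> \<in> (\<lambda>(i, \<gamma>). take i \<alpha> # \<gamma>) ` (SIGMA i:{1..length \<alpha>}. G p (drop i \<alpha>))"
      by (intro image_eqI[of _ _ "(length \<beta>, \<delta>)"]) (auto simp: G_def)
  qed (auto simp: G_def Suc_le_eq)
  have inj: "inj_on (\<lambda>(i, \<gamma>). take i \<alpha> # \<gamma>) (SIGMA i:{1..length \<alpha>}. G p (drop i \<alpha>))"
    by (auto simp: inj_on_def) (metis length_take min.absorb2)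
  have "(\<Sum>\<gamma>\<in>G (Suc p) \<alpha>. (\<Prod>\<beta>\<leftarrow>\<gamma>. a \<beta>)) = (\<Sum>(i, \<gamma>)\<in>(SIGMA i:{1..length \<alpha>}. G p (drop i \<alpha>)). a (take i \<alpha>) * (\<Prod>\<beta>\<leftarrow>\<gamma>. a \<beta>))"
    unfolding G sum.reindex[OF inj] by (rule sum.cong) auto
  also have "\<dots> = (\<Sum>i=1..length \<alpha>. a (take i \<alpha>) * conv_pow a p (drop i \<alpha>))"
    using fin by (subst sum.Sigma[symmetric]) (simp_all add: sum_distrib_left[symmetric] IH)
  also have "\<dots> = conv_pow a (Suc p) \<alpha>" by (simp add: conv_drop_first[where a = a, OF assms])
  finally have "(\<Sum>\<gamma>\<in>G (Suc p) \<alpha>. (\<Prod>\<beta>\<leftarrow>\<gamma>. a \<beta>)) = conv_pow a (Suc p) \<alpha>" .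
  moreover have "finite (G (Suc p) \<alpha>)" unfolding G using fin by auto
  ultimately show ?case by (simp only: G_def simp_thms)
qed

lemma b_coeff_eq_bq:
  assumes a0: "a [] = 0" and m: "1 \<le> m"
  shows "b_coeff a m \<alpha> = bq a m \<alpha>"
proof (cases "\<alpha> = []")
  case True
  then show ?thesis by (simp add: b_coeff_def bq_def unit_coeff_def)
next
  case False
  have "b_coeff a m \<alpha> = (\<Sum>p=1..length \<alpha>. binom_coeff m p * conv_pow a p \<alpha>)"
    using False m compositions_sum[where a = a, OF a0]
    by (simp add: b_coeff_def sum_distrib_right[symmetric] binom_coeff_def mult.commute)
  also have "\<dots> = bq a m \<alpha>"
  proof -
    have "{..length \<alpha>} = insert 0 {1..length \<alpha>}" by auto
    then show ?thesis using False by (simp add: bq_def unit_coeff_def)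
  qed
  finally show ?thesis .
qed

section \<open>Order properties of positive regular coefficients\<close>

lemma words_Nil [simp]: "[] \<in> words n"
  and words_Cons [simp]: "j # \<alpha> \<in> words n \<longleftrightarrow> j < n \<and> \<alpha> \<in> words n"
  and words_append [simp]: "\<alpha> @ \<beta> \<in> words n \<longleftrightarrow> \<alpha> \<in> words n \<and> \<beta> \<in> words n"
  by (auto simp: words_def)

lemma words_take [simp]: "\<alpha> \<in> words n \<Longrightarrow> take i \<alpha> \<in> words n"
  and words_drop [simp]: "\<alpha> \<in> words n \<Longrightarrow> drop i \<alpha> \<in> words n"
  by (auto simp: words_def dest: in_set_takeD in_set_dropD)

lemma conv_mono:
  assumes "\<And>\<beta>. \<beta> \<in> words n \<Longrightarrow> 0 \<le> c \<beta>" "\<And>\<beta>. \<beta> \<in> words n \<Longrightarrow> d \<beta> \<le> d' \<beta>" "\<alpha> \<in> words n"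
  shows "conv c d \<alpha> \<le> conv c d' \<alpha>"
  unfolding conv_eq_sum by (intro sum_mono mult_left_mono) (use assms in auto)

lemma conv_nonneg:
  assumes "\<And>\<beta>. \<beta> \<in> words n \<Longrightarrow> 0 \<le> c \<beta>" "\<And>\<beta>. \<beta> \<in> words n \<Longrightarrow> 0 \<le> d \<beta>" "\<alpha> \<in> words n"
  shows "0 \<le> conv c d \<alpha>"
  unfolding conv_eq_sum by (intro sum_nonneg mult_nonneg_nonneg) (use assms in auto)

locale reg_coeff =
  fixes n :: nat and a :: "nat list \<Rightarrow> real"
  assumes regular: "positive_regular n a"
begin

lemma a_nonneg: "\<alpha> \<in> words n \<Longrightarrow> 0 \<le> a \<alpha>" and a_Nil [simp]: "a [] = 0" and a_pos: "j < n \<Longrightarrow> 0 < a [j]"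
  using regular by (auto simp: positive_regular_def)

lemma conv_pow_nonneg: "\<alpha> \<in> words n \<Longrightarrow> 0 \<le> conv_pow a p \<alpha>"
  by (induction p arbitrary: \<alpha>) (auto simp: unit_coeff_def intro: conv_nonneg a_nonneg)

lemma bq_nonneg: "\<alpha> \<in> words n \<Longrightarrow> 0 \<le> bq a q \<alpha>"
  unfolding bq_def by (intro sum_nonneg mult_nonneg_nonneg) (auto simp: conv_pow_nonneg)

lemma conv_bq_le: "\<alpha> \<in> words n \<Longrightarrow> conv a (bq a (Suc q)) \<alpha> \<le> bq a (Suc q) \<alpha>"
  using bq_Suc[where a = a, OF a_Nil, of q \<alpha>] bq_nonneg[of \<alpha> q] by linarith

text \<open>Among the nonnegative terms of the convolution only the one with the single-letter
  prefix is kept. The estimate bounds the weights of the shifts \<open>W\<close>.\<close>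

lemma bq_Cons_ge:
  assumes "j < n" "\<alpha> \<in> words n"
  shows "a [j] * bq a (Suc q) \<alpha> \<le> bq a (Suc q) (j # \<alpha>)"
proof -
  have "a [j] * bq a (Suc q) \<alpha> \<le> conv (\<lambda>\<beta>. a (j # \<beta>)) (bq a (Suc q)) \<alpha>"
  proof -
    have "(\<Sum>i\<in>{0}. a (j # take i \<alpha>) * bq a (Suc q) (drop i \<alpha>)) \<le> conv (\<lambda>\<beta>. a (j # \<beta>)) (bq a (Suc q)) \<alpha>"
      unfolding conv_eq_sum
      by (rule sum_mono2) (use assms in \<open>auto intro!: mult_nonneg_nonneg a_nonneg bq_nonneg\<close>)
    then show ?thesis by simp
  qed
  also have "\<dots> = conv a (bq a (Suc q)) (j # \<alpha>)" by simp
  also have "\<dots> \<le> bq a (Suc q) (j # \<alpha>)" using assms by (intro conv_bq_le) simp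
  finally show ?thesis .
qed

lemma bq_pos: "\<alpha> \<in> words n \<Longrightarrow> 0 < bq a (Suc q) \<alpha>"
proof (induction \<alpha>)
  case (Cons j \<alpha>)
  then have "0 < a [j] * bq a (Suc q) \<alpha>" by (auto intro: mult_pos_pos a_pos)
  also have "\<dots> \<le> bq a (Suc q) (j # \<alpha>)" using Cons by (intro bq_Cons_ge) auto
  finally show ?case .
qed (simp add: bq_def unit_coeff_def)

text \<open>Convolution with \<open>a\<close> is monotone and lowers \<open>bq a (Suc q)\<close>;
  the upper bound later dominates the iterates of \<Phi> on the model.\<close>

lemma conv_iter_bounds:
  "\<alpha> \<in> words n \<Longrightarrow> 0 \<le> (conv a ^^ s) (bq a (Suc q)) \<alpha> \<and> (conv a ^^ s) (bq a (Suc q)) \<alpha> \<le> bq a (Suc q) \<alpha>"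
proof (induction s arbitrary: \<alpha>)
  case (Suc s)
  have "conv a ((conv a ^^ s) (bq a (Suc q))) \<alpha> \<le> conv a (bq a (Suc q)) \<alpha>"
    by (rule conv_mono[where n = n]) (use Suc a_nonneg in auto)
  also have "\<dots> \<le> bq a (Suc q) \<alpha>" by (rule conv_bq_le) (rule Suc)
  finally show ?case using Suc a_nonneg by (auto intro: conv_nonneg)
qed (simp add: bq_nonneg)

text \<open>Each convolution consumes at least one letter. This is the source of purity of the
  model.\<close>

lemma conv_iter_eq_0: "length \<alpha> < s \<Longrightarrow> (conv a ^^ s) d \<alpha> = 0"
proof (induction s arbitrary: \<alpha>)
  case (Suc s)
  then show ?case by (auto simp: conv_drop_first intro!: sum.neutral)
qed simp

end

section \<open>Words in commuting families\<close>

lemma word_op_Nil [simp]: "word_op E X [] = E"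
  and word_op_Cons [simp]: "word_op E X (j # \<alpha>) = X j \<bullet>\<^sub>o word_op E X \<alpha>"
  by (simp_all add: word_op_def)

lemma mwords_length: "w \<in> mwords k n \<Longrightarrow> length w = k"
  and mwords_nth: "w \<in> mwords k n \<Longrightarrow> i < k \<Longrightarrow> w ! i \<in> words (n i)"
  by (auto simp: mwords_def)

lemma mwords_update: "w \<in> mwords k n \<Longrightarrow> i < k \<Longrightarrow> \<alpha> \<in> words (n i) \<Longrightarrow> w[i := \<alpha>] \<in> mwords k n"
  by (auto simp: mwords_def nth_list_update)

lemma mwords_empty: "replicate k [] \<in> mwords k n"
  by (simp add: mwords_def)

text \<open>An operator that commutes with all other factors slides from either end of the product
  to the factor at \<open>i\<close>, where it is absorbed.\<close>

lemma foldr_comp_update: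
  fixes Z :: "('a::complex_hilbert, 'a) bop"
  assumes i: "i < k" and comm: "\<And>l. l < k \<Longrightarrow> l \<noteq> i \<Longrightarrow> Z \<bullet>\<^sub>o G l = G l \<bullet>\<^sub>o Z"
  shows "Z \<bullet>\<^sub>o foldr (\<lambda>l T. G l \<bullet>\<^sub>o T) [0..<k] Y = foldr (\<lambda>l T. (G(i := Z \<bullet>\<^sub>o G i)) l \<bullet>\<^sub>o T) [0..<k] Y"
    and "foldr (\<lambda>l T. G l \<bullet>\<^sub>o T) [0..<k] (Z \<bullet>\<^sub>o Y) = foldr (\<lambda>l T. (G(i := G i \<bullet>\<^sub>o Z)) l \<bullet>\<^sub>o T) [0..<k] Y"
proof -
  let ?F = "\<lambda>G. foldr (\<lambda>l T. G l \<bullet>\<^sub>o T)"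
  have split: "[0..<k] = [0..<i] @ i # [Suc i..<k]"
    using i by (metis less_imp_add_positive upt_add_eq_append upt_conv_Cons zero_le)
  have move: "?F G xs (Z \<bullet>\<^sub>o T) = Z \<bullet>\<^sub>o ?F G xs T" if "set xs \<subseteq> {..<k} - {i}" for xs T
    using that
  proof (induction xs)
    case (Cons l xs)
    then have "Z \<bullet>\<^sub>o (G l \<bullet>\<^sub>o ?F G xs T) = G l \<bullet>\<^sub>o (Z \<bullet>\<^sub>o ?F G xs T)"
      using comm[of l] by (simp add: bop_comp_assoc[symmetric])
    with Cons show ?case by simp
  qed simp
  have upd: "?F (G(i := U)) xs T = ?F G xs T" if "i \<notin> set xs" for U xs T
    using that by (induction xs) auto
  show "Z \<bullet>\<^sub>o ?F G [0..<k] Y = ?F (G(i := Z \<bullet>\<^sub>o G i)) [0..<k] Y"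
    unfolding split foldr_append foldr.simps comp_apply
    using move[of "[0..<i]" "G i \<bullet>\<^sub>o ?F G [Suc i..<k] Y"] i
    by (simp add: upd subset_eq del: fun_upd_apply) (simp add: bop_comp_assoc)
  show "?F G [0..<k] (Z \<bullet>\<^sub>o Y) = ?F (G(i := G i \<bullet>\<^sub>o Z)) [0..<k] Y"
    unfolding split foldr_append foldr.simps comp_apply
    by (simp add: upd move subset_eq i del: fun_upd_apply) (simp add: bop_comp_assoc)
qed

text \<open>\<open>E\<close> is the identity of the algebra in which words are evaluated:
  \<open>bop_id\<close> for \<open>W\<close> and \<open>A\<close>, and the projection
  \<open>P\<close> for the compressions \<open>S\<close>.\<close>

locale commuting_family =
  fixes E :: "('a::complex_hilbert, 'a) bop" and k n and X :: "nat \<Rightarrow> nat \<Rightarrow> ('a, 'a) bop"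
  assumes E_idem: "E \<bullet>\<^sub>o E = E"
    and E_left: "\<And>i j. i < k \<Longrightarrow> j < n i \<Longrightarrow> E \<bullet>\<^sub>o X i j = X i j"
    and E_right: "\<And>i j. i < k \<Longrightarrow> j < n i \<Longrightarrow> X i j \<bullet>\<^sub>o E = X i j"
    and comm: "commuting_tuple k n X"
begin

lemma letter_word_commute:
  assumes "i < k" "j < n i" "l < k" "l \<noteq> i" "\<alpha> \<in> words (n l)"
  shows "X i j \<bullet>\<^sub>o word_op E (X l) \<alpha> = word_op E (X l) \<alpha> \<bullet>\<^sub>o X i j"
  using assms(5)
proof (induction \<alpha>)
  case (Cons x \<alpha>)
  have "X i j \<bullet>\<^sub>o X l x = X l x \<bullet>\<^sub>o X i j"
    using comm assms(1-4) Cons by (auto simp: commuting_tuple_def)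
  then have "X i j \<bullet>\<^sub>o (X l x \<bullet>\<^sub>o word_op E (X l) \<alpha>) = X l x \<bullet>\<^sub>o (X i j \<bullet>\<^sub>o word_op E (X l) \<alpha>)"
    by (simp add: bop_comp_assoc[symmetric])
  with Cons show ?case by (simp add: bop_comp_assoc)
qed (simp add: E_left E_right assms)

lemma letter_mword:
  assumes "i < k" "j < n i" "w \<in> mwords k n"
  shows "X i j \<bullet>\<^sub>o mword_op E k X w = mword_op E k X (w[i := j # w ! i])"
proof -
  have "X i j \<bullet>\<^sub>o mword_op E k X w =
      foldr (\<lambda>l T. ((\<lambda>l. word_op E (X l) (w ! l))(i := X i j \<bullet>\<^sub>o word_op E (X i) (w ! i))) l \<bullet>\<^sub>o T) [0..<k] E"
    unfolding mword_op_def
    by (rule foldr_comp_update(1)) (use assms in \<open>auto intro!: letter_word_commute simp: mwords_nth\<close>)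
  also have "\<dots> = mword_op E k X (w[i := j # w ! i])"
    unfolding mword_op_def by (rule foldr_cong) (use mwords_length[OF assms(3)] in auto)
  finally show ?thesis .
qed

lemma word_mword:
  assumes "i < k" "\<alpha> \<in> words (n i)" "w \<in> mwords k n"
  shows "word_op bop_id (X i) \<alpha> \<bullet>\<^sub>o mword_op E k X w = mword_op E k X (w[i := \<alpha> @ w ! i])"
  using assms(2)
proof (induction \<alpha>)
  case (Cons j \<alpha>)
  have "X i j \<bullet>\<^sub>o mword_op E k X (w[i := \<alpha> @ w ! i]) = mword_op E k X (w[i := \<alpha> @ w ! i, i := j # (w[i := \<alpha> @ w ! i]) ! i])"
    using Cons assms by (intro letter_mword mwords_update) (auto simp: mwords_nth)
  with Cons show ?case using assms mwords_length[of w] by (simp add: bop_comp_assoc)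
qed simp

lemma mword_empty: "mword_op E k X (replicate k []) = E"
proof -
  have "foldr (\<lambda>i T. word_op E (X i) (replicate k [] ! i) \<bullet>\<^sub>o T) xs E = E" if "set xs \<subseteq> {..<k}" for xs
    using that by (induction xs) (auto simp: E_idem)
  from this[of "[0..<k]"] show ?thesis unfolding mword_op_def by (simp add: atLeast0LessThan)
qed

end

lemma intertwine_word:
  assumes "\<And>j. j < n \<Longrightarrow> L \<bullet>\<^sub>o adj (X j) = adj (Y j) \<bullet>\<^sub>o L" "\<alpha> \<in> words n" "adj E \<bullet>\<^sub>o L = L"
  shows "L \<bullet>\<^sub>o adj_word X \<alpha> = adj (word_op E Y \<alpha>) \<bullet>\<^sub>o L"
  using assms(2)
proof (induction \<alpha>)
  case (Cons j \<alpha>)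
  have "L \<bullet>\<^sub>o adj_word X (j # \<alpha>) = (L \<bullet>\<^sub>o adj_word X \<alpha>) \<bullet>\<^sub>o adj (X j)"
    by (simp add: bop_comp_assoc)
  also have "\<dots> = adj (word_op E Y \<alpha>) \<bullet>\<^sub>o (L \<bullet>\<^sub>o adj (X j))" using Cons by (simp add: bop_comp_assoc)
  also have "\<dots> = adj (word_op E Y (j # \<alpha>)) \<bullet>\<^sub>o L" using Cons assms(1)[of j] by (simp add: bop_comp_assoc)
  finally show ?case .
qed (simp add: assms)

text \<open>The two sides may live in algebras with different identities: the slices of the kernel
  are intertwined with \<open>W\<close>, where \<open>E = bop_id\<close>, and with \<open>S\<close>,
  where \<open>E = P\<close>.\<close>

lemma intertwine_mword:
  assumes "\<And>i j. i < k \<Longrightarrow> j < n i \<Longrightarrow> L \<bullet>\<^sub>o adj (X i j) = adj (Y i j) \<bullet>\<^sub>o L"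
    and w: "w \<in> mwords k n" and E: "adj E \<bullet>\<^sub>o L = L"
  shows "L \<bullet>\<^sub>o adj (mword_op bop_id k X w) = adj (mword_op E k Y w) \<bullet>\<^sub>o L"
proof -
  have "L \<bullet>\<^sub>o adj (foldr (\<lambda>i T. word_op bop_id (X i) (w ! i) \<bullet>\<^sub>o T) xs bop_id)
      = adj (foldr (\<lambda>i T. word_op E (Y i) (w ! i) \<bullet>\<^sub>o T) xs E) \<bullet>\<^sub>o L" if "set xs \<subseteq> {..<k}" for xs
    using that
  proof (induction xs)
    case (Cons i xs)
    have i: "L \<bullet>\<^sub>o adj_word (X i) (w ! i) = adj (word_op E (Y i) (w ! i)) \<bullet>\<^sub>o L"
      by (rule intertwine_word[where n = "n i"]) (use Cons.prems assms mwords_nth[OF w] in auto)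
    let ?R = "\<lambda>E Y. foldr (\<lambda>i T. word_op E (Y i) (w ! i) \<bullet>\<^sub>o T) xs E"
    have "L \<bullet>\<^sub>o adj (word_op bop_id (X i) (w ! i) \<bullet>\<^sub>o ?R bop_id X)
        = (L \<bullet>\<^sub>o adj (?R bop_id X)) \<bullet>\<^sub>o adj_word (X i) (w ! i)" by (simp add: bop_comp_assoc)
    also have "\<dots> = adj (?R E Y) \<bullet>\<^sub>o (L \<bullet>\<^sub>o adj_word (X i) (w ! i))" using Cons by (simp add: bop_comp_assoc)
    also have "\<dots> = adj (word_op E (Y i) (w ! i) \<bullet>\<^sub>o ?R E Y) \<bullet>\<^sub>o L" unfolding i by (simp add: bop_comp_assoc)
    finally show ?case by simp
  qed (simp add: E)
  from this[of "[0..<k]"] show ?thesis unfolding mword_op_def by (simp add: atLeast0LessThan)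
qed

section \<open>The universal model\<close>

locale model =
  fixes k :: nat and n m :: "nat \<Rightarrow> nat" and f :: "nat \<Rightarrow> nat list \<Rightarrow> real"
  assumes m_ge: "\<And>i. i < k \<Longrightarrow> 1 \<le> m i" and regular: "\<And>i. i < k \<Longrightarrow> positive_regular (n i) (f i)"
begin

abbreviation b :: "nat \<Rightarrow> nat list \<Rightarrow> real" where
  "b i \<equiv> b_coeff (f i) (m i)"

abbreviation W :: "nat \<Rightarrow> nat \<Rightarrow> (fock, fock) bop" where
  "W \<equiv> W_op k n m f"

lemma reg: "i < k \<Longrightarrow> reg_coeff (n i) (f i)"
  by (simp add: reg_coeff_def regular)

lemma b_eq: "i < k \<Longrightarrow> b i = bq (f i) (m i)"
  using m_ge[of i] reg_coeff.a_Nil[OF reg, of i] by (intro ext b_coeff_eq_bq)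

lemma m_Suc: "i < k \<Longrightarrow> \<exists>q. m i = Suc q"
  using m_ge[of i] by (cases "m i") auto

lemma b_pos: "i < k \<Longrightarrow> \<alpha> \<in> words (n i) \<Longrightarrow> 0 < b i \<alpha>"
  using reg_coeff.bq_pos[OF reg] m_Suc[of i] b_eq[of i] by force

lemma b_Cons_ge: "i < k \<Longrightarrow> j < n i \<Longrightarrow> \<alpha> \<in> words (n i) \<Longrightarrow> f i [j] * b i \<alpha> \<le> b i (j # \<alpha>)"
  using reg_coeff.bq_Cons_ge[OF reg] m_Suc[of i] b_eq[of i] by force

text \<open>The weighted backward shift. In coordinates it is a column operator, so it is
  constructed before \<open>W\<close>, which is obtained as its adjoint.\<close>

definition W_adj :: "nat \<Rightarrow> nat \<Rightarrow> (fock, fock) bop" where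
  "W_adj i j = col_op (\<lambda>w. if w \<in> mwords k n
     then sqrt (b i (w ! i) / b i (j # w ! i)) *\<^sub>R l2_coord (w[i := j # w ! i]) else 0)"

lemma inj_on_prepend: "i < k \<Longrightarrow> inj_on (\<lambda>w. w[i := \<alpha> @ w ! i]) (mwords k n)"
proof (rule inj_onI)
  fix v w assume i: "i < k" and v: "v \<in> mwords k n" and w: "w \<in> mwords k n" and eq: "v[i := \<alpha> @ v ! i] = w[i := \<alpha> @ w ! i]"
  show "v = w"
  proof (rule nth_equalityI)
    show "length v = length w" using v w by (simp add: mwords_length)
    fix l assume "l < length v"
    then show "v ! l = w ! l"
      using arg_cong[OF eq, of "\<lambda>u. u ! l"] i v w by (cases "l = i") (auto simp: mwords_length)
  qed
qed

text \<open>The squared weights are at most \<open>1 / f i [j]\<close> by \<open>b_Cons_ge\<close>,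
  and prepending a letter is injective on multi-words, so the square sums are bounded.\<close>

lemma W_adj_apply:
  assumes "i < k" "j < n i"
  shows "l2_apply (W_adj i j \<cdot> x) w =
    (if w \<in> mwords k n then sqrt (b i (w ! i) / b i (j # w ! i)) *\<^sub>R l2_apply x (w[i := j # w ! i]) else 0)"
proof -
  let ?T = "\<lambda>w. if w \<in> mwords k n
     then sqrt (b i (w ! i) / b i (j # w ! i)) *\<^sub>R l2_coord (w[i := j # w ! i]) else 0 :: (fock, complex) bop"
  have aj: "0 < f i [j]" using reg_coeff.a_pos[OF reg] assms by blast
  have "(\<Sum>w\<in>F. (norm (?T w \<cdot> x))\<^sup>2) \<le> (1 / f i [j]) * (norm x)\<^sup>2" if F: "finite F" for F x
  proof -
    have "(\<Sum>w\<in>F. (norm (?T w \<cdot> x))\<^sup>2) = (\<Sum>w\<in>F \<inter> mwords k n. (norm (?T w \<cdot> x))\<^sup>2)"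
      using F by (intro sum.mono_neutral_right) auto
    also have "\<dots> \<le> (\<Sum>w\<in>F \<inter> mwords k n. (1 / f i [j]) * (norm (l2_apply x (w[i := [j] @ w ! i])))\<^sup>2)"
    proof (rule sum_mono)
      fix w assume w: "w \<in> F \<inter> mwords k n"
      then have wi: "w ! i \<in> words (n i)" using assms by (auto simp: mwords_nth)
      have "b i (w ! i) / b i (j # w ! i) \<le> 1 / f i [j]"
        using b_Cons_ge[OF assms wi] aj b_pos[OF assms(1), of "j # w ! i"] wi assms
        by (simp add: divide_le_eq le_divide_eq mult.commute)
      moreover have "0 \<le> b i (w ! i) / b i (j # w ! i)"
        using b_pos[OF assms(1)] wi assms by (simp add: less_imp_le)
      ultimately show "(norm (?T w \<cdot> x))\<^sup>2 \<le> (1 / f i [j]) * (norm (l2_apply x (w[i := [j] @ w ! i])))\<^sup>2"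
        using w by (simp add: bop_apply_simps power_mult_distrib mult_right_mono del: times_divide_eq_left)
    qed
    also have "\<dots> = (1 / f i [j]) * (\<Sum>w\<in>(\<lambda>w. w[i := [j] @ w ! i]) ` (F \<inter> mwords k n). (norm (l2_apply x w))\<^sup>2)"
      using inj_on_subset[OF inj_on_prepend[OF assms(1), of "[j]"]]
      by (subst sum.reindex) (auto simp: sum_distrib_left)
    also have "\<dots> \<le> (1 / f i [j]) * (norm x)\<^sup>2"
      using aj F by (intro mult_left_mono sum_le_norm_l2) auto
    finally show ?thesis .
  qed
  from col_op_apply[of ?T, OF this] show ?thesis by (simp add: W_adj_def bop_apply_simps)
qed

lemma W_eq:
  assumes "i < k" "j < n i"
  shows "W i j = adj (W_adj i j)"
proof -
  have *: "adj (W_adj i j) \<cdot> ket w = (if w \<in> mwords k n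
      then sqrt (b i (w ! i) / b i (j # w ! i)) *\<^sub>R ket (w[i := j # w ! i]) else 0)" for w
  proof (rule cinner_ext_right)
    fix z
    show "cinner z (adj (W_adj i j) \<cdot> ket w) = cinner z (if w \<in> mwords k n
      then sqrt (b i (w ! i) / b i (j # w ! i)) *\<^sub>R ket (w[i := j # w ! i]) else 0)"
      by (simp add: cinner_adj_right cinner_ket W_adj_apply[OF assms] cinner_scaleR_right scaleR_conv_of_real)
  qed
  show ?thesis unfolding W_op_def
    by (rule the_equality) (use * in \<open>auto intro!: bop_ket_eqI\<close>)
qed

lemma adj_W_apply:
  assumes "i < k" "j < n i"
  shows "l2_apply (adj (W i j) \<cdot> x) w =
    (if w \<in> mwords k n then sqrt (b i (w ! i) / b i (j # w ! i)) *\<^sub>R l2_apply x (w[i := j # w ! i]) else 0)"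
  by (simp add: W_eq[OF assms] W_adj_apply[OF assms])

lemma adj_W_commute:
  assumes "s < k" "t < k" "s \<noteq> t" "i < n s" "j < n t"
  shows "adj (W s i) \<cdot> (adj (W t j) \<cdot> x) = adj (W t j) \<cdot> (adj (W s i) \<cdot> x)"
proof (rule l2_eqI)
  fix w
  show "l2_apply (adj (W s i) \<cdot> (adj (W t j) \<cdot> x)) w = l2_apply (adj (W t j) \<cdot> (adj (W s i) \<cdot> x)) w"
  proof (cases "w \<in> mwords k n")
    case True
    then have "w[s := i # w ! s] \<in> mwords k n" "w[t := j # w ! t] \<in> mwords k n"
      using assms by (auto intro!: mwords_update simp: mwords_nth)
    then show ?thesis
      using True assms by (simp add: adj_W_apply mwords_length list_update_swap mult.commute)
  qed (simp add: adj_W_apply assms)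
qed

sublocale W_family: commuting_family bop_id k n W
proof
  show "commuting_tuple k n W"
    unfolding commuting_tuple_def
  proof (intro allI impI)
    fix s t i j assume "s < k" "t < k" "s \<noteq> t" "i < n s" "j < n t"
    then have "adj (W s i \<bullet>\<^sub>o W t j) = adj (W t j \<bullet>\<^sub>o W s i)"
      by (intro bop_eqI) (simp add: adj_W_commute)
    then show "W s i \<bullet>\<^sub>o W t j = W t j \<bullet>\<^sub>o W s i" using adj_adj by metis
  qed
qed simp_all

end

section \<open>The space \<open>N\<close> and the compressed shifts \<open>S\<close>\<close>

lemma orth_closure_cspan:
  "(\<forall>y\<in>closure (cspan G). cinner x y = 0) \<longleftrightarrow> (\<forall>y\<in>G. cinner x y = 0)"
proof safe
  fix y assume "\<forall>y\<in>closure (cspan G). cinner x y = 0" "y \<in> G"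
  then show "cinner x y = 0" using closure_subset complex_vec.span_base by blast
next
  fix y assume G: "\<forall>y\<in>G. cinner x y = 0" and y: "y \<in> closure (cspan G)"
  have "closed {y. cinner x y = 0}"
    by (intro closed_Collect_eq continuous_on_const bounded_linear.continuous_on[OF bounded_linear_cinner_right] continuous_on_id)
  moreover have "cspan G \<subseteq> {y. cinner x y = 0}"
    by (rule complex_vec.span_minimal) (use G in \<open>auto simp: complex_vec.subspace_def cinner_simps\<close>)
  ultimately show "cinner x y = 0" using closure_minimal y by blast
qed

locale variety = model +
  fixes Q :: "(nat list list \<Rightarrow>\<^sub>0 complex) set"
begin

abbreviation N :: "fock set" where
  "N \<equiv> N_space k n m f Q"

abbreviation P :: "(fock, fock) bop" where
  "P \<equiv> ortho_proj N"

abbreviation S :: "nat \<Rightarrow> nat \<Rightarrow> (fock, fock) bop" where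
  "S \<equiv> S_op k n m f Q"

definition M_gen :: "fock set" where
  "M_gen = {mword_op bop_id k W \<alpha> \<cdot> poly_op k W q \<cdot> mword_op bop_id k W \<beta> \<cdot> ket (replicate k []) | \<alpha> \<beta> q.
      \<alpha> \<in> mwords k n \<and> \<beta> \<in> mwords k n \<and> q \<in> Q}"

lemma N_iff: "x \<in> N \<longleftrightarrow> (\<forall>w. w \<notin> mwords k n \<longrightarrow> l2_apply x w = 0) \<and> (\<forall>g\<in>M_gen. cinner x g = 0)"
  unfolding N_space_def M_space_def orth_closure_cspan M_gen_def fock_tensor_def by blast

lemma N_subspace: "complex_vec.subspace N"
  unfolding complex_vec.subspace_def by (auto simp: N_iff cinner_simps l2_apply_simps)

lemma N_closed: "closed N"
proof -
  have "closed {x :: fock. l2_coord w \<cdot> x = 0}" for w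
    by (intro closed_Collect_eq continuous_on_const bounded_linear.continuous_on[OF bounded_linear_bop] continuous_on_id)
  moreover have "closed {x :: fock. cinner x g = 0}" for g
    by (intro closed_Collect_eq continuous_on_const bounded_linear.continuous_on[OF bounded_linear_cinner_left] continuous_on_id)
  moreover have "N = (\<Inter>w\<in>- mwords k n. {x. l2_coord w \<cdot> x = 0}) \<inter> (\<Inter>g\<in>M_gen. {x. cinner x g = 0})"
    by (auto simp: N_iff)
  ultimately show ?thesis by (metis (no_types, lifting) closed_INT closed_Int)
qed

lemmas P_in = ortho_proj_in[OF N_subspace N_closed]
  and P_id = ortho_proj_id[OF N_subspace N_closed]
  and P_idem [simp] = ortho_proj_idem[OF N_subspace N_closed]
  and adj_P [simp] = ortho_proj_selfadj[OF N_subspace N_closed]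
  and norm_P_le = norm_ortho_proj_le[OF N_subspace N_closed]

lemma P_P [simp]: "P \<cdot> (P \<cdot> x) = P \<cdot> x"
  by (simp add: P_id P_in)

text \<open>\<open>W i j\<close> maps generators of the orthogonal complement to generators: it
  prepends a letter to their left factor.\<close>

lemma adj_W_in_N:
  assumes "i < k" "j < n i" "x \<in> N"
  shows "adj (W i j) \<cdot> x \<in> N"
  unfolding N_iff
proof (intro conjI ballI allI impI)
  show "l2_apply (adj (W i j) \<cdot> x) w = 0" if "w \<notin> mwords k n" for w
    using that by (simp add: adj_W_apply assms)
  fix g assume "g \<in> M_gen"
  then obtain \<alpha> \<beta> q where g: "g = mword_op bop_id k W \<alpha> \<cdot> poly_op k W q \<cdot> mword_op bop_id k W \<beta> \<cdot> ket (replicate k [])"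
    and mem: "\<alpha> \<in> mwords k n" "\<beta> \<in> mwords k n" "q \<in> Q" unfolding M_gen_def by blast
  have "W i j \<cdot> g = mword_op bop_id k W (\<alpha>[i := j # \<alpha> ! i]) \<cdot> poly_op k W q \<cdot> mword_op bop_id k W \<beta> \<cdot> ket (replicate k [])"
    unfolding g W_family.letter_mword[OF assms(1,2) mem(1), symmetric] by simp
  moreover have "\<alpha>[i := j # \<alpha> ! i] \<in> mwords k n"
    using mem assms by (intro mwords_update) (auto simp: mwords_nth)
  ultimately have "W i j \<cdot> g \<in> M_gen" using mem unfolding M_gen_def by blast
  then show "cinner (adj (W i j) \<cdot> x) g = 0" using assms(3) by (simp add: cinner_adj_left N_iff)
qed

lemma adj_S: "i < k \<Longrightarrow> j < n i \<Longrightarrow> adj (S i j) = adj (W i j) \<bullet>\<^sub>o P"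
  by (rule bop_eqI) (simp add: S_op_def P_id adj_W_in_N P_in)

lemma adj_S_apply: "i < k \<Longrightarrow> j < n i \<Longrightarrow> x \<in> N \<Longrightarrow> adj (S i j) \<cdot> x = adj (W i j) \<cdot> x"
  by (simp add: adj_S P_id)

sublocale S_family: commuting_family P k n S
proof
  show "P \<bullet>\<^sub>o S i j = S i j" "S i j \<bullet>\<^sub>o P = S i j" for i j
    by (rule bop_eqI; simp add: S_op_def)+
  show "commuting_tuple k n S"
    unfolding commuting_tuple_def
  proof (intro allI impI)
    fix s t i j assume st: "s < k" "t < k" "s \<noteq> t" "i < n s" "j < n t"
    then have "adj (S s i \<bullet>\<^sub>o S t j) = adj (S t j \<bullet>\<^sub>o S s i)"
      by (intro bop_eqI) (simp add: adj_S P_id adj_W_in_N P_in adj_W_commute)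
    then show "S s i \<bullet>\<^sub>o S t j = S t j \<bullet>\<^sub>o S s i" using adj_adj by metis
  qed
qed simp

text \<open>The weights telescope along the word. Membership in \<open>N\<close> is proved
  simultaneously because on \<open>N\<close>, and only there, \<open>adj (S i j)\<close> is replaced
  by \<open>adj (W i j)\<close>.\<close>

lemma adj_S_word:
  assumes i: "i < k" and "\<alpha> \<in> words (n i)" "x \<in> N"
  shows "adj_word (S i) \<alpha> \<cdot> x \<in> N \<and>
    (\<forall>w\<in>mwords k n. l2_apply (adj_word (S i) \<alpha> \<cdot> x) w =
       sqrt (b i (w ! i) / b i (\<alpha> @ w ! i)) *\<^sub>R l2_apply x (w[i := \<alpha> @ w ! i]))"
  using assms(2,3)
proof (induction \<alpha> arbitrary: x)
  case Nil
  have "sqrt (b i (w ! i) / b i (w ! i)) = 1" if "w \<in> mwords k n" for w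
    using b_pos[OF i mwords_nth[OF that i]] by simp
  with Nil show ?case by simp
next
  case (Cons j \<alpha>)
  then have ja: "j < n i" "\<alpha> \<in> words (n i)" by auto
  have in_N: "adj (W i j) \<cdot> x \<in> N" using i ja Cons by (intro adj_W_in_N)
  have eq: "adj_word (S i) (j # \<alpha>) \<cdot> x = adj_word (S i) \<alpha> \<cdot> (adj (W i j) \<cdot> x)"
    using Cons i ja by (simp add: adj_S_apply)
  show ?case unfolding eq
  proof (intro conjI ballI)
    show "adj_word (S i) \<alpha> \<cdot> (adj (W i j) \<cdot> x) \<in> N" using Cons.IH[OF ja(2) in_N] by blast
    fix w assume w: "w \<in> mwords k n"
    have wi: "w ! i \<in> words (n i)" using mwords_nth[OF w i] .
    have w': "w[i := \<alpha> @ w ! i] \<in> mwords k n" using w i wi ja by (intro mwords_update) auto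
    have pos: "0 < b i (w ! i)" "0 < b i (\<alpha> @ w ! i)" "0 < b i (j # \<alpha> @ w ! i)"
      using b_pos[OF i] wi ja by auto
    have "l2_apply (adj_word (S i) \<alpha> \<cdot> (adj (W i j) \<cdot> x)) w
        = sqrt (b i (w ! i) / b i (\<alpha> @ w ! i)) *\<^sub>R l2_apply (adj (W i j) \<cdot> x) (w[i := \<alpha> @ w ! i])"
      using Cons.IH[OF ja(2) in_N] w by blast
    also have "\<dots> = (sqrt (b i (w ! i) / b i (\<alpha> @ w ! i)) * sqrt (b i (\<alpha> @ w ! i) / b i (j # \<alpha> @ w ! i)))
        *\<^sub>R l2_apply x (w[i := (j # \<alpha>) @ w ! i])"
      using w' i mwords_length[OF w] by (simp add: adj_W_apply i ja)
    also have "sqrt (b i (w ! i) / b i (\<alpha> @ w ! i)) * sqrt (b i (\<alpha> @ w ! i) / b i (j # \<alpha> @ w ! i))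
        = sqrt (b i (w ! i) / b i ((j # \<alpha>) @ w ! i))"
      using pos by (simp add: real_sqrt_mult[symmetric])
    finally show "l2_apply (adj_word (S i) \<alpha> \<cdot> (adj (W i j) \<cdot> x)) w =
        sqrt (b i (w ! i) / b i ((j # \<alpha>) @ w ! i)) *\<^sub>R l2_apply x (w[i := (j # \<alpha>) @ w ! i])" .
  qed
qed

end

section \<open>Diagonal quadratic forms of the model\<close>

text \<open>A pair of a prefix and a multi-word corresponds to the extended multi-word together with
  a cut position in its component \<open>i\<close>.\<close>

lemma has_sum_split_words:
  fixes G :: "nat list list \<Rightarrow> real"
  assumes i: "i < k"
  shows "((\<lambda>(\<alpha>, w). c \<alpha> * d w * G (w[i := \<alpha> @ w ! i])) has_sum S) (words (n i) \<times> mwords k n) \<longleftrightarrow>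
    ((\<lambda>(\<gamma>, t). c (take t (\<gamma> ! i)) * d (\<gamma>[i := drop t (\<gamma> ! i)]) * G \<gamma>) has_sum S)
      (SIGMA \<gamma>:mwords k n. {..length (\<gamma> ! i)})"
proof (rule has_sum_reindex_bij_witness)
  let ?j = "\<lambda>(\<alpha>, w). (w[i := \<alpha> @ w ! i], length \<alpha>)"
  let ?i = "\<lambda>(\<gamma>, t). (take t (\<gamma> ! i), \<gamma>[i := drop t (\<gamma> ! i)])"
  fix a assume a: "a \<in> words (n i) \<times> mwords k n"
  obtain \<alpha> w where aw: "a = (\<alpha>, w)" by fastforce
  have len: "length w = k" and wi: "w ! i \<in> words (n i)" "\<alpha> \<in> words (n i)"
    using a aw i by (auto simp: mwords_length mwords_nth)
  show "?i (?j a) = a" using len i by (simp add: aw)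
  show "?j a \<in> (SIGMA \<gamma>:mwords k n. {..length (\<gamma> ! i)})"
    using a aw i len wi by (auto intro!: mwords_update)
  show "(case ?j a of (\<gamma>, t) \<Rightarrow> c (take t (\<gamma> ! i)) * d (\<gamma>[i := drop t (\<gamma> ! i)]) * G \<gamma>)
      = (case a of (\<alpha>, w) \<Rightarrow> c \<alpha> * d w * G (w[i := \<alpha> @ w ! i]))"
    using len i by (simp add: aw)
next
  let ?j = "\<lambda>(\<alpha>, w). (w[i := \<alpha> @ w ! i], length \<alpha>)"
  let ?i = "\<lambda>(\<gamma>, t). (take t (\<gamma> ! i), \<gamma>[i := drop t (\<gamma> ! i)])"
  fix b assume b: "b \<in> (SIGMA \<gamma>:mwords k n. {..length (\<gamma> ! i)})"
  obtain \<gamma> t where bg: "b = (\<gamma>, t)" by fastforce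
  have len: "length \<gamma> = k" and wi: "\<gamma> ! i \<in> words (n i)" "t \<le> length (\<gamma> ! i)" "\<gamma> \<in> mwords k n"
    using b bg i by (auto simp: mwords_length mwords_nth)
  show "?j (?i b) = b" using len i wi by (simp add: bg min.absorb2)
  show "?i b \<in> words (n i) \<times> mwords k n" using i wi by (auto simp: bg intro!: mwords_update)
qed simp

definition prod_coeff :: "nat \<Rightarrow> (nat \<Rightarrow> nat list \<Rightarrow> real) \<Rightarrow> nat list list \<Rightarrow> real" where
  "prod_coeff k c w = (\<Prod>i<k. c i (w ! i))"

lemma prod_coeff_remove: "i < k \<Longrightarrow> prod_coeff k c w = c i (w ! i) * (\<Prod>l\<in>{..<k} - {i}. c l (w ! l))"
  unfolding prod_coeff_def by (rule prod.remove) auto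

lemma prod_coeff_update:
  "i < k \<Longrightarrow> length w = k \<Longrightarrow> prod_coeff k c (w[i := \<beta>]) = c i \<beta> * (\<Prod>l\<in>{..<k} - {i}. c l (w ! l))"
  by (subst prod_coeff_remove) (auto intro!: prod.cong simp: nth_list_update)

lemma prod_coeff_fun_upd:
  "i < k \<Longrightarrow> prod_coeff k (c(i := u)) w = u (w ! i) * (\<Prod>l\<in>{..<k} - {i}. c l (w ! l))"
  by (subst prod_coeff_remove) (auto intro!: prod.cong)

lemma conv_prod_coeff:
  assumes "i < k" "length \<gamma> = k"
  shows "(\<Sum>t\<le>length (\<gamma> ! i). a (take t (\<gamma> ! i)) * prod_coeff k c (\<gamma>[i := drop t (\<gamma> ! i)]))
    = prod_coeff k (c(i := conv a (c i))) \<gamma>"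
  using assms by (simp add: prod_coeff_update prod_coeff_fun_upd conv_eq_sum sum_distrib_right mult.assoc)

lemma prod_coeff_nonneg:
  "(\<And>l \<alpha>. l < k \<Longrightarrow> \<alpha> \<in> words (n l) \<Longrightarrow> 0 \<le> c l \<alpha>) \<Longrightarrow> w \<in> mwords k n \<Longrightarrow> 0 \<le> prod_coeff k c w"
  unfolding prod_coeff_def by (rule prod_nonneg) (auto simp: mwords_nth)

lemma adj_minus: "adj (S - T) = adj S - adj T"
  by (rule adj_unique) (simp add: bop_apply_simps cinner_simps cinner_adj_right)

lemma bop_comp_minus: "S \<bullet>\<^sub>o (T - U) = S \<bullet>\<^sub>o T - S \<bullet>\<^sub>o U" "(T' - U') \<bullet>\<^sub>o S' = T' \<bullet>\<^sub>o S' - U' \<bullet>\<^sub>o S'"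
  by (rule bop_eqI; simp add: bop_apply_simps bop_diff_right)+

context variety
begin

abbreviation PhiS :: "nat \<Rightarrow> (fock, fock) bop \<Rightarrow> (fock, fock) bop" where
  "PhiS i \<equiv> Phi (n i) (f i) (S i)"

abbreviation B :: "nat list list \<Rightarrow> real" where
  "B \<equiv> prod_coeff k b"

lemma B_pos: "w \<in> mwords k n \<Longrightarrow> 0 < B w"
  unfolding prod_coeff_def by (rule prod_pos) (auto intro: b_pos mwords_nth)

abbreviation sq :: "fock \<Rightarrow> nat list list \<Rightarrow> real" where
  "sq x w \<equiv> (cmod (l2_apply x w))\<^sup>2 / B w"

text \<open>Dividing by \<open>B\<close> absorbs the weights: only component \<open>i\<close> of the
  index changes, and the ratio of the two values of \<open>b i\<close> is the squared
  weight.\<close>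

lemma adj_S_word_sq:
  assumes "i < k" "\<alpha> \<in> words (n i)" "x \<in> N" "w \<in> mwords k n"
  shows "sq (adj_word (S i) \<alpha> \<cdot> x) w = sq x (w[i := \<alpha> @ w ! i])"
proof -
  have wi: "w ! i \<in> words (n i)" using assms by (simp add: mwords_nth)
  have pos: "0 < b i (w ! i)" "0 < b i (\<alpha> @ w ! i)" using b_pos[OF assms(1)] wi assms by auto
  have R: "0 < (\<Prod>l\<in>{..<k} - {i}. b l (w ! l))"
    by (rule prod_pos) (use assms b_pos mwords_nth in auto)
  have "(cmod (l2_apply (adj_word (S i) \<alpha> \<cdot> x) w))\<^sup>2
      = b i (w ! i) / b i (\<alpha> @ w ! i) * (cmod (l2_apply x (w[i := \<alpha> @ w ! i])))\<^sup>2"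
    using adj_S_word[OF assms(1-3)] assms(4) pos by (simp add: power_mult_distrib)
  then show ?thesis
    using assms(1) mwords_length[OF assms(4)] pos R
    by (simp add: prod_coeff_update prod_coeff_remove[of i k b w])
qed

text \<open>The quadratic form of \<open>Y\<close> on \<open>N\<close> is diagonal with entries \<open>(\<Prod>i. c i (w ! i)) / B w\<close>. With
  this normalization the map \<open>\<Phi>\<close> of the \<open>i\<close>-th coordinate convolves \<open>c i\<close> with \<open>f i\<close>.\<close>

definition diag_form :: "(fock, fock) bop \<Rightarrow> (nat \<Rightarrow> nat list \<Rightarrow> real) \<Rightarrow> bool" where
  "diag_form Y c \<longleftrightarrow> adj Y = Y \<and> P \<bullet>\<^sub>o Y \<bullet>\<^sub>o P = Y \<and>
     (\<forall>x\<in>N. ((\<lambda>w. prod_coeff k c w * sq x w) has_sum qform Y x) (mwords k n))"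

lemma N_norm_has_sum:
  assumes "x \<in> N"
  shows "((\<lambda>w. (cmod (l2_apply x w))\<^sup>2) has_sum (norm x)\<^sup>2) (mwords k n)"
  using norm_l2_has_sum[of x] assms
  by (subst has_sum_cong_neutral[where T = UNIV]) (auto simp: N_iff)

lemma diag_form_P: "diag_form P b"
  unfolding diag_form_def
proof (intro conjI ballI)
  fix x assume x: "x \<in> N"
  have "((\<lambda>w. B w * sq x w) has_sum (norm x)\<^sup>2) (mwords k n)"
    using N_norm_has_sum[OF x] by (rule has_sum_cong[THEN iffD1, rotated]) (use B_pos in force)
  then show "((\<lambda>w. B w * sq x w) has_sum qform P x) (mwords k n)"
    by (simp add: P_id x cinner_self)
qed (simp_all add: bop_comp_assoc[symmetric])

text \<open>The empty word evaluates to the identity of the ambient Fock space instead of \<open>P\<close>; this does no harm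
  in \<open>\<Phi>\<close> because the constant coefficient of \<open>f i\<close> vanishes.\<close>

lemma adj_S_word_P:
  assumes "i < k" "\<alpha> \<in> words (n i)" "\<alpha> \<noteq> []"
  shows "adj_word (S i) \<alpha> \<cdot> x = adj_word (S i) \<alpha> \<cdot> (P \<cdot> x)"
proof (cases \<alpha>)
  case (Cons j \<beta>)
  have "adj (S i j) = adj (S i j) \<bullet>\<^sub>o P"
    using arg_cong[OF S_family.E_left[of i j], of adj] assms Cons by auto
  then have "adj (S i j) \<cdot> (P \<cdot> x) = adj (S i j) \<cdot> x" by (metis bop_apply_comp)
  then show ?thesis by (simp add: Cons)
qed (use assms in simp)

text \<open>Both directions are used. From right to left, with nonnegativity, it makes the double
  series summable and so bounds \<Phi>; from left to right it reads off the new diagonal once \<Phi>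
  is known to exist.\<close>

lemma split_form_has_sum:
  assumes i: "i < k" and x: "x \<in> N" and c: "\<And>l \<alpha>. l < k \<Longrightarrow> \<alpha> \<in> words (n l) \<Longrightarrow> 0 \<le> c l \<alpha>"
  shows "((\<lambda>(\<alpha>, w). f i \<alpha> * (prod_coeff k c w * sq (adj_word (S i) \<alpha> \<cdot> x) w)) has_sum T) (words (n i) \<times> mwords k n)
    \<longleftrightarrow> ((\<lambda>w. prod_coeff k (c(i := conv (f i) (c i))) w * sq x w) has_sum T) (mwords k n)" (is "?L \<longleftrightarrow> ?R")
proof -
  let ?h = "\<lambda>\<gamma> t. f i (take t (\<gamma> ! i)) * prod_coeff k c (\<gamma>[i := drop t (\<gamma> ! i)]) * sq x \<gamma>"
  have L: "?L \<longleftrightarrow> ((\<lambda>(\<gamma>, t). ?h \<gamma> t) has_sum T) (SIGMA \<gamma>:mwords k n. {..length (\<gamma> ! i)})"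
    unfolding has_sum_split_words[OF i, of "f i" "prod_coeff k c" "sq x", symmetric]
    by (rule has_sum_cong, clarify) (simp only: prod.case adj_S_word_sq[OF i _ x] mult.assoc)
  have inner: "(?h \<gamma> has_sum prod_coeff k (c(i := conv (f i) (c i))) \<gamma> * sq x \<gamma>) {..length (\<gamma> ! i)}"
    if "\<gamma> \<in> mwords k n" for \<gamma>
    using has_sum_finite[of "{..length (\<gamma> ! i)}" "?h \<gamma>"]
    unfolding sum_distrib_right[symmetric] conv_prod_coeff[OF i mwords_length[OF that]] by simp
  show ?thesis unfolding L
  proof
    assume "((\<lambda>(\<gamma>, t). ?h \<gamma> t) has_sum T) (SIGMA \<gamma>:mwords k n. {..length (\<gamma> ! i)})"
    then show ?R by (rule has_sum_SigmaD) (use inner in simp)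
  next
    assume ?R
    with inner show "((\<lambda>(\<gamma>, t). ?h \<gamma> t) has_sum T) (SIGMA \<gamma>:mwords k n. {..length (\<gamma> ! i)})"
    proof (rule has_sum_nonneg_Sigma)
      fix \<gamma> t assume g: "\<gamma> \<in> mwords k n"
      then have "\<gamma>[i := drop t (\<gamma> ! i)] \<in> mwords k n" using i by (auto intro!: mwords_update simp: mwords_nth)
      with g show "0 \<le> ?h \<gamma> t"
        using i B_pos[OF g] by (intro mult_nonneg_nonneg prod_coeff_nonneg[OF c] reg_coeff.a_nonneg[OF reg]) (auto simp: mwords_nth)
    qed
  qed
qed

text \<open>On \<open>N\<close> the diagonal of the full sum is built from
  \<open>conv (f i) (b i)\<close>, which lies below \<open>b i\<close>, the diagonal of the
  identity. Hence the partial sums are bounded by the squared norm.\<close>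

lemma phi_map_S:
  assumes i: "i < k"
  shows "phi_map (n i) (f i) (S i)"
proof
  show a: "0 \<le> f i \<alpha>" if "\<alpha> \<in> words (n i)" for \<alpha> using reg_coeff.a_nonneg[OF reg[OF i] that] .
  have bound: "(\<Sum>\<alpha>\<in>F. f i \<alpha> * (norm (adj_word (S i) \<alpha> \<cdot> x))\<^sup>2) \<le> (norm x)\<^sup>2"
    if F: "finite F" "F \<subseteq> words (n i)" and x: "x \<in> N" for F x
  proof -
    let ?c = "b(i := conv (f i) (b i))"
    let ?g = "\<lambda>\<alpha> w. f i \<alpha> * (B w * sq (adj_word (S i) \<alpha> \<cdot> x) w)"
    obtain q where q: "m i = Suc q" using m_Suc[OF i] by blast
    have b0: "0 \<le> b l \<alpha>" if "l < k" "\<alpha> \<in> words (n l)" for l \<alpha> using b_pos[OF that] by simp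
    have "conv (f i) (b i) \<alpha> \<le> b i \<alpha>" if "\<alpha> \<in> words (n i)" for \<alpha>
      using reg_coeff.conv_bq_le[OF reg[OF i] that, of q] unfolding q[symmetric] b_eq[OF i] .
    then have c: "0 \<le> ?c l \<alpha> \<and> ?c l \<alpha> \<le> b l \<alpha>" if "l < k" "\<alpha> \<in> words (n l)" for l \<alpha>
      using that b0 a by (auto intro!: conv_nonneg)
    have le: "0 \<le> prod_coeff k ?c w * sq x w \<and> prod_coeff k ?c w * sq x w \<le> (cmod (l2_apply x w))\<^sup>2"
      if w: "w \<in> mwords k n" for w
    proof -
      have "0 \<le> prod_coeff k ?c w" by (rule prod_coeff_nonneg[OF _ w]) (use c in blast)
      moreover have "prod_coeff k ?c w \<le> B w"
        unfolding prod_coeff_def by (rule prod_mono) (use c mwords_nth[OF w] in blast)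
      then have "prod_coeff k ?c w * sq x w \<le> B w * sq x w" using B_pos[OF w] by (intro mult_right_mono) auto
      ultimately show ?thesis using B_pos[OF w] by simp
    qed
    have "(\<lambda>w. prod_coeff k ?c w * sq x w) summable_on mwords k n"
      by (rule summable_on_comparison_test[OF has_sum_imp_summable[OF N_norm_has_sum[OF x]]]) (use le in blast)+
    then obtain T where T: "((\<lambda>w. prod_coeff k ?c w * sq x w) has_sum T) (mwords k n)" by (auto simp: summable_on_def)
    have joint: "((\<lambda>(\<alpha>, w). ?g \<alpha> w) has_sum T) (words (n i) \<times> mwords k n)"
      using T by (subst split_form_has_sum[OF i x b0])
    have nn: "0 \<le> ?g \<alpha> w" if "\<alpha> \<in> words (n i)" "w \<in> mwords k n" for \<alpha> w
      using a[OF that(1)] B_pos[OF that(2)] by simp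
    have "((\<lambda>(\<alpha>, w). ?g \<alpha> w) has_sum (\<Sum>\<alpha>\<in>F. f i \<alpha> * qform P (adj_word (S i) \<alpha> \<cdot> x))) (F \<times> mwords k n)"
    proof (rule has_sum_nonneg_Sigma[OF has_sum_cmult_right has_sum_finite[OF F(1)]])
      show "((\<lambda>w. B w * sq (adj_word (S i) \<alpha> \<cdot> x) w) has_sum qform P (adj_word (S i) \<alpha> \<cdot> x)) (mwords k n)" if "\<alpha> \<in> F" for \<alpha>
        using diag_form_P adj_S_word[OF i _ x, of \<alpha>] that F by (auto simp: diag_form_def)
    qed (use F nn in blast)
    then have "(\<Sum>\<alpha>\<in>F. f i \<alpha> * qform P (adj_word (S i) \<alpha> \<cdot> x)) \<le> T"
      by (rule has_sum_mono2[OF _ joint]) (use F nn in auto)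
    also have "T \<le> (norm x)\<^sup>2" by (rule has_sum_mono[OF T N_norm_has_sum[OF x]]) (use le in blast)
    also have "(\<Sum>\<alpha>\<in>F. f i \<alpha> * qform P (adj_word (S i) \<alpha> \<cdot> x)) = (\<Sum>\<alpha>\<in>F. f i \<alpha> * (norm (adj_word (S i) \<alpha> \<cdot> x))\<^sup>2)"
      using F adj_S_word[OF i _ x] by (intro sum.cong) (auto simp: P_id cinner_self)
    finally show ?thesis .
  qed
  have "(\<Sum>\<alpha>\<in>F. f i \<alpha> * (norm (adj_word (S i) \<alpha> \<cdot> x))\<^sup>2) \<le> 1 * (norm x)\<^sup>2"
    if F: "finite F" "F \<subseteq> words (n i)" for F x
  proof -
    \<comment> \<open>Nonempty words see only \<open>P \<cdot> x\<close>, and the empty word has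
      coefficient 0, so the bound on \<open>N\<close> extends to the ambient space.\<close>
    have "(\<Sum>\<alpha>\<in>F. f i \<alpha> * (norm (adj_word (S i) \<alpha> \<cdot> x))\<^sup>2)
        = (\<Sum>\<alpha>\<in>F. f i \<alpha> * (norm (adj_word (S i) \<alpha> \<cdot> (P \<cdot> x)))\<^sup>2)"
    proof (rule sum.cong)
      fix \<alpha> assume "\<alpha> \<in> F"
      then show "f i \<alpha> * (norm (adj_word (S i) \<alpha> \<cdot> x))\<^sup>2 = f i \<alpha> * (norm (adj_word (S i) \<alpha> \<cdot> (P \<cdot> x)))\<^sup>2"
        using F adj_S_word_P[OF i, of \<alpha> x] reg_coeff.a_Nil[OF reg[OF i]] by (cases "\<alpha> = []") auto
    qed simp
    also have "\<dots> \<le> (norm (P \<cdot> x))\<^sup>2" by (rule bound[OF F P_in])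
    also have "\<dots> \<le> (norm x)\<^sup>2" by (simp add: norm_P_le power_mono)
    finally show ?thesis by simp
  qed
  then show "Phi_bounded (n i) (f i) (S i)" unfolding Phi_bounded_def by blast
qed

lemma Phi_S_compress:
  assumes i: "i < k"
  shows "P \<bullet>\<^sub>o PhiS i Y \<bullet>\<^sub>o P = PhiS i Y"
proof (rule bop_eqI_cinner)
  interpret phi_map "n i" "f i" "S i" by (rule phi_map_S[OF i])
  fix x y
  have "((\<lambda>\<alpha>. f i \<alpha> *\<^sub>R cinner (Y \<cdot> (adj_word (S i) \<alpha> \<cdot> x)) (adj_word (S i) \<alpha> \<cdot> y))
      has_sum cinner (PhiS i Y \<cdot> (P \<cdot> x)) (P \<cdot> y)) (words (n i))"
    using Phi_has_sum[of Y "P \<cdot> x" "P \<cdot> y"]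
  proof (rule has_sum_cong[THEN iffD1, rotated])
    fix \<alpha> assume "\<alpha> \<in> words (n i)"
    then show "f i \<alpha> *\<^sub>R cinner (Y \<cdot> (adj_word (S i) \<alpha> \<cdot> (P \<cdot> x))) (adj_word (S i) \<alpha> \<cdot> (P \<cdot> y))
      = f i \<alpha> *\<^sub>R cinner (Y \<cdot> (adj_word (S i) \<alpha> \<cdot> x)) (adj_word (S i) \<alpha> \<cdot> y)"
      using adj_S_word_P[OF i, of \<alpha> x] adj_S_word_P[OF i, of \<alpha> y] reg_coeff.a_Nil[OF reg[OF i]]
      by (cases "\<alpha> = []") auto
  qed
  from has_sum_unique[OF this Phi_has_sum]
  have "cinner (PhiS i Y \<cdot> (P \<cdot> x)) (P \<cdot> y) = cinner (PhiS i Y \<cdot> x) y" .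
  then show "cinner ((P \<bullet>\<^sub>o PhiS i Y \<bullet>\<^sub>o P) \<cdot> x) y = cinner (PhiS i Y \<cdot> x) y"
    using cinner_adj_left[of P] by simp
qed

lemma diag_form_Phi:
  assumes i: "i < k" and Y: "diag_form Y c" and c: "\<And>l \<alpha>. l < k \<Longrightarrow> \<alpha> \<in> words (n l) \<Longrightarrow> 0 \<le> c l \<alpha>"
  shows "diag_form (PhiS i Y) (c(i := conv (f i) (c i)))"
  unfolding diag_form_def
proof (intro conjI ballI)
  interpret phi_map "n i" "f i" "S i" by (rule phi_map_S[OF i])
  show "adj (PhiS i Y) = PhiS i Y"
    using Y by (simp add: Phi_eq adj_diag_op bop_comp_assoc diag_form_def)
  show "P \<bullet>\<^sub>o PhiS i Y \<bullet>\<^sub>o P = PhiS i Y" by (rule Phi_S_compress[OF i])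
  fix x assume x: "x \<in> N"
  have "((\<lambda>(\<alpha>, w). f i \<alpha> * (prod_coeff k c w * sq (adj_word (S i) \<alpha> \<cdot> x) w)) has_sum qform (PhiS i Y) x) (words (n i) \<times> mwords k n)"
  proof (rule has_sum_nonneg_Sigma[OF has_sum_cmult_right Phi_has_sum_Re])
    fix \<alpha> assume a: "\<alpha> \<in> words (n i)"
    show "((\<lambda>w. prod_coeff k c w * sq (adj_word (S i) \<alpha> \<cdot> x) w) has_sum qform Y (adj_word (S i) \<alpha> \<cdot> x)) (mwords k n)"
      using adj_S_word[OF i a x] Y by (auto simp: diag_form_def)
    show "0 \<le> f i \<alpha> * (prod_coeff k c w * sq (adj_word (S i) \<alpha> \<cdot> x) w)" if "w \<in> mwords k n" for w
      using nonneg[OF a] prod_coeff_nonneg[OF c that] B_pos[OF that] by simp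
  qed
  then show "((\<lambda>w. prod_coeff k (c(i := conv (f i) (c i))) w * sq x w) has_sum qform (PhiS i Y) x) (mwords k n)"
    by (subst split_form_has_sum[OF i x c, symmetric])
qed

text \<open>The new entries may have either sign, so the form is obtained as a difference of two
  convergent sums rather than by Tonelli.\<close>

lemma diag_form_defect:
  assumes i: "i < k" and Y: "diag_form Y c" and c: "\<And>l \<alpha>. l < k \<Longrightarrow> \<alpha> \<in> words (n l) \<Longrightarrow> 0 \<le> c l \<alpha>"
  shows "diag_form (Y - PhiS i Y) (c(i := \<lambda>\<beta>. c i \<beta> - conv (f i) (c i) \<beta>))"
  unfolding diag_form_def
proof (intro conjI ballI)
  note Y' = diag_form_Phi[OF i Y c]
  show "adj (Y - PhiS i Y) = Y - PhiS i Y"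
    using Y Y' by (simp add: adj_minus diag_form_def)
  show "P \<bullet>\<^sub>o (Y - PhiS i Y) \<bullet>\<^sub>o P = Y - PhiS i Y"
    using Y Y' by (simp add: bop_comp_minus diag_form_def)
  fix x assume x: "x \<in> N"
  have eq: "prod_coeff k (c(i := \<lambda>\<beta>. c i \<beta> - conv (f i) (c i) \<beta>)) w
      = prod_coeff k c w - prod_coeff k (c(i := conv (f i) (c i))) w" for w
    unfolding prod_coeff_fun_upd[OF i] prod_coeff_remove[OF i, of c] by (simp add: left_diff_distrib)
  have "((\<lambda>w. prod_coeff k c w * sq x w + (-1) * (prod_coeff k (c(i := conv (f i) (c i))) w * sq x w)) has_sum
      qform Y x + (-1) * qform (PhiS i Y) x) (mwords k n)"
    using Y Y' x unfolding diag_form_def by (intro has_sum_add has_sum_cmult_right) auto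
  then show "((\<lambda>w. prod_coeff k (c(i := \<lambda>\<beta>. c i \<beta> - conv (f i) (c i) \<beta>)) w * sq x w) has_sum
      qform (Y - PhiS i Y) x) (mwords k n)"
    unfolding eq by (simp add: bop_apply_simps cinner_simps left_diff_distrib diff_divide_distrib)
qed

text \<open>Each defect lowers the exponent in coordinate \<open>i\<close> by one through
  \<open>bq_Suc\<close>. As long as \<open>p \<le> q\<close> the entries stay nonnegative, which the
  next application of \<Phi> requires.\<close>

lemma diag_form_defect_pow:
  assumes i: "i < k" and Y: "diag_form Y c" and c: "\<And>l \<alpha>. l < k \<Longrightarrow> \<alpha> \<in> words (n l) \<Longrightarrow> 0 \<le> c l \<alpha>"
    and ci: "c i = bq (f i) q" and p: "p \<le> q"
  shows "diag_form (((\<lambda>Y. Y - PhiS i Y) ^^ p) Y) (c(i := bq (f i) (q - p)))"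
  using p
proof (induction p)
  case 0
  have "c(i := bq (f i) q) = c" using ci by auto
  with Y show ?case by simp
next
  case (Suc p)
  define r where "r = q - Suc p"
  have r: "q - p = Suc r" using Suc by (simp add: r_def)
  let ?c = "c(i := bq (f i) (q - p))"
  have "diag_form (((\<lambda>Y. Y - PhiS i Y) ^^ Suc p) Y) (?c(i := \<lambda>\<beta>. ?c i \<beta> - conv (f i) (?c i) \<beta>))"
    unfolding funpow.simps comp_apply
  proof (rule diag_form_defect[OF i])
    show "diag_form (((\<lambda>Y. Y - PhiS i Y) ^^ p) Y) ?c" by (rule Suc.IH) (use Suc.prems in simp)
    show "0 \<le> ?c l \<alpha>" if "l < k" "\<alpha> \<in> words (n l)" for l \<alpha>
      using that c reg_coeff.bq_nonneg[OF reg] by auto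
  qed
  moreover have "?c(i := \<lambda>\<beta>. ?c i \<beta> - conv (f i) (?c i) \<beta>) = c(i := bq (f i) r)"
    using bq_Suc[where a = "f i", OF reg_coeff.a_Nil[OF reg[OF i]], of r] by (auto simp: r fun_eq_iff)
  ultimately show ?case by (simp only: r_def)
qed

text \<open>\<open>P\<close> is the identity of the operators on \<open>N\<close>. A coordinate not
  yet treated still carries \<open>b l\<close>, which is \<open>bq\<close> with the full exponent
  \<open>m l\<close>.\<close>

lemma diag_form_Delta:
  assumes p: "\<And>i. i < k \<Longrightarrow> p i \<le> m i"
  shows "diag_form (Delta k n f S p P) (\<lambda>l. if l < k then bq (f l) (m l - p l) else b l)"
proof -
  have "diag_form (foldr (\<lambda>i G. ((\<lambda>Y. Y - PhiS i Y) ^^ p i) \<circ> G) xs id P)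
      (\<lambda>l. if l \<in> set xs then bq (f l) (m l - p l) else b l)" if "set xs \<subseteq> {..<k}" "distinct xs" for xs
    using that
  proof (induction xs)
    case (Cons i xs)
    let ?c = "\<lambda>l. if l \<in> set xs then bq (f l) (m l - p l) else b l"
    have i: "i < k" using Cons by simp
    have "diag_form (((\<lambda>Y. Y - PhiS i Y) ^^ p i)
        (foldr (\<lambda>i G. ((\<lambda>Y. Y - PhiS i Y) ^^ p i) \<circ> G) xs id P)) (?c(i := bq (f i) (m i - p i)))"
    proof (rule diag_form_defect_pow[OF i])
      show "diag_form (foldr (\<lambda>i G. ((\<lambda>Y. Y - PhiS i Y) ^^ p i) \<circ> G) xs id P) ?c"
        by (rule Cons.IH) (use Cons.prems in auto)
      show "0 \<le> ?c l \<alpha>" if "l < k" "\<alpha> \<in> words (n l)" for l \<alpha>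
        using that reg_coeff.bq_nonneg[OF reg] b_pos by (auto simp: less_imp_le)
      show "?c i = bq (f i) (m i)" using Cons b_eq[OF i] by simp
    qed (use Cons p i in auto)
    moreover have "?c(i := bq (f i) (m i - p i)) = (\<lambda>l. if l \<in> set (i # xs) then bq (f l) (m l - p l) else b l)"
      by auto
    ultimately show ?case by (simp only: foldr.simps comp_apply[of _ _ id] comp_apply[of _ _ P])
  qed (use diag_form_P in simp)
  from this[of "[0..<k]"] show ?thesis unfolding Delta_def by (simp add: atLeast0LessThan)
qed

section \<open>Positivity and purity of the model\<close>

lemma diag_form_real:
  assumes "diag_form Y c"
  shows "cinner (Y \<cdot> x) x = of_real (qform Y (P \<cdot> x))"
proof -
  have "cinner (Y \<cdot> x) x = cinner ((P \<bullet>\<^sub>o Y \<bullet>\<^sub>o P) \<cdot> x) x" using assms by (simp add: diag_form_def)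
  also have "\<dots> = cinner (Y \<cdot> (P \<cdot> x)) (P \<cdot> x)" using cinner_adj_left[of P] by simp
  also have "\<dots> = of_real (qform Y (P \<cdot> x))"
    using assms by (intro selfadj_cinner_real) (simp add: diag_form_def)
  finally show ?thesis .
qed

lemma diag_form_nonneg:
  assumes Y: "diag_form Y c" and c: "\<And>l \<alpha>. l < k \<Longrightarrow> \<alpha> \<in> words (n l) \<Longrightarrow> 0 \<le> c l \<alpha>" and x: "x \<in> N"
  shows "0 \<le> qform Y x"
proof (rule has_sum_nonneg)
  show "((\<lambda>w. prod_coeff k c w * sq x w) has_sum qform Y x) (mwords k n)"
    using Y x by (simp add: diag_form_def)
  show "0 \<le> prod_coeff k c w * sq x w" if "w \<in> mwords k n" for w
    using prod_coeff_nonneg[OF c that] B_pos[OF that] by simp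
qed

lemma diag_form_pos_op:
  assumes Y: "diag_form Y c" and c: "\<And>l \<alpha>. l < k \<Longrightarrow> \<alpha> \<in> words (n l) \<Longrightarrow> 0 \<le> c l \<alpha>"
  shows "pos_op Y"
  unfolding pos_op_iff
proof (intro allI conjI)
  fix x
  show "cinner (Y \<cdot> x) x = of_real (qform Y x)" by (subst (1 2) diag_form_real[OF Y]) simp
  show "0 \<le> qform Y x"
    unfolding diag_form_real[OF Y, of x] using diag_form_nonneg[OF Y c P_in] by simp
qed

lemma pos_op_Delta_S:
  assumes "\<And>i. i < k \<Longrightarrow> p i \<le> m i"
  shows "pos_op (Delta k n f S p P)"
  by (rule diag_form_pos_op[OF diag_form_Delta[OF assms]]) (use reg_coeff.bq_nonneg[OF reg] in auto)

text \<open>The diagonal of the iterate number \<open>s\<close> lies below that of the identity and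
  vanishes where component \<open>i\<close> is shorter than \<open>s\<close>. A finite set of
  indices carrying almost all of the norm thus stops contributing.\<close>

lemma Phi_S_iter_limit:
  assumes i: "i < k"
  shows "limitin wstar (\<lambda>s. (PhiS i ^^ s) P) 0 sequentially"
proof -
  obtain q where q: "m i = Suc q" using m_Suc[OF i] by blast
  define c where "c s = b(i := (conv (f i) ^^ s) (b i))" for s
  have ci: "0 \<le> c s l \<alpha> \<and> c s l \<alpha> \<le> b l \<alpha>" if "l < k" "\<alpha> \<in> words (n l)" for s l \<alpha>
    using that reg_coeff.conv_iter_bounds[OF reg[OF i], of \<alpha> s q] b_eq[OF i] b_pos[OF that]
    by (auto simp: c_def q less_imp_le)
  have Y: "diag_form ((PhiS i ^^ s) P) (c s)" for s
  proof (induction s)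
    case 0
    have "c 0 = b" by (auto simp: c_def)
    then show ?case using diag_form_P by simp
  next
    case (Suc s)
    have "(c s)(i := conv (f i) (c s i)) = c (Suc s)" by (auto simp: c_def)
    then show ?case using diag_form_Phi[OF i Suc] ci by auto
  qed
  define qf where "qf s x = qform ((PhiS i ^^ s) P) (P \<cdot> x)" for s x
  have qs: "((\<lambda>w. prod_coeff k (c s) w * sq (P \<cdot> x) w) has_sum qf s x) (mwords k n)" for s x
    using Y[of s] P_in[of x] unfolding diag_form_def qf_def by blast
  have term_le: "prod_coeff k (c s) w * sq y w \<le> (cmod (l2_apply y w))\<^sup>2"
    if w: "w \<in> mwords k n" for s w y
  proof -
    have "prod_coeff k (c s) w \<le> B w"
      unfolding prod_coeff_def by (rule prod_mono) (use ci mwords_nth[OF w] in auto)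
    then have "prod_coeff k (c s) w * sq y w \<le> B w * sq y w"
      using B_pos[OF w] by (intro mult_right_mono) auto
    then show ?thesis using B_pos[OF w] by simp
  qed
  show ?thesis
  proof (rule wstar_limit_zero[where q = qf])
    show "cinner ((PhiS i ^^ s) P \<cdot> x) x = of_real (qf s x)" for s x
      unfolding qf_def by (rule diag_form_real[OF Y])
    show nn: "0 \<le> qf s x" for s x
      unfolding qf_def by (rule diag_form_nonneg[OF Y _ P_in]) (use ci in auto)
    show "qf s x \<le> (norm x)\<^sup>2" for s x
    proof -
      have "qf s x \<le> (norm (P \<cdot> x))\<^sup>2"
        by (rule has_sum_mono[OF qs N_norm_has_sum[OF P_in] term_le])
      also have "\<dots> \<le> (norm x)\<^sup>2" by (simp add: norm_P_le power_mono)
      finally show ?thesis .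
    qed
    show "(\<lambda>s. qf s x) \<longlonglongrightarrow> 0" for x
    proof (rule LIMSEQ_I)
      fix r :: real assume r: "0 < r"
      let ?y = "P \<cdot> x"
      have "(sum (\<lambda>w. (cmod (l2_apply ?y w))\<^sup>2) \<longlongrightarrow> (norm ?y)\<^sup>2) (finite_subsets_at_top (mwords k n))"
        using N_norm_has_sum[OF P_in, of x] by (simp add: has_sum_def)
      then have "\<forall>\<^sub>F F in finite_subsets_at_top (mwords k n). dist (\<Sum>w\<in>F. (cmod (l2_apply ?y w))\<^sup>2) ((norm ?y)\<^sup>2) < r"
        using r by (rule tendstoD)
      then obtain F where F: "finite F" "F \<subseteq> mwords k n" "dist (\<Sum>w\<in>F. (cmod (l2_apply ?y w))\<^sup>2) ((norm ?y)\<^sup>2) < r"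
        unfolding eventually_finite_subsets_at_top by blast
      \<comment> \<open>The greatest length of component \<open>i\<close> on \<open>F\<close>;
        inserting 0 covers the empty set.\<close>
      define M where "M = Max (insert 0 ((\<lambda>w. length (w ! i)) ` F))"
      have "qf s x < r" if s: "Suc M \<le> s" for s
      proof -
        have "qf s x \<le> (norm ?y)\<^sup>2 - (\<Sum>w\<in>F. (cmod (l2_apply ?y w))\<^sup>2)"
        proof (rule has_sum_mono_neutral[OF qs])
          show "((\<lambda>w. (cmod (l2_apply ?y w))\<^sup>2) has_sum (norm ?y)\<^sup>2 - (\<Sum>w\<in>F. (cmod (l2_apply ?y w))\<^sup>2)) (mwords k n - F)"
            by (rule has_sum_Diff[OF N_norm_has_sum[OF P_in]]) (use F in auto)
          fix w assume w: "w \<in> mwords k n - (mwords k n - F)"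
          have "length (w ! i) \<le> M" unfolding M_def using w F by (intro Max_ge) auto
          then have "c s i (w ! i) = 0"
            using reg_coeff.conv_iter_eq_0[OF reg[OF i]] s by (simp add: c_def)
          then show "prod_coeff k (c s) w * sq ?y w \<le> 0"
            by (simp add: prod_coeff_remove[OF i])
        qed (use term_le in auto)
        then show ?thesis using F(3) by (simp add: dist_real_def abs_if split: if_splits)
      qed
      then show "\<exists>no. \<forall>s\<ge>no. norm (qf s x - 0) < r" using nn by (intro exI[of _ "Suc M"]) auto
    qed
  qed
qed

end

section \<open>Transfer along completely positive maps\<close>

lemma bop_comp_add: "S \<bullet>\<^sub>o (T + U) = S \<bullet>\<^sub>o T + S \<bullet>\<^sub>o U" "(T' + U') \<bullet>\<^sub>o S' = T' \<bullet>\<^sub>o S' + U' \<bullet>\<^sub>o S'"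
  by (rule bop_eqI; simp add: bop_apply_simps bop_add_right)+

lemma bop_comp_scaleC: "S \<bullet>\<^sub>o (c *\<^sub>C T) = c *\<^sub>C (S \<bullet>\<^sub>o T)" "(c *\<^sub>C T') \<bullet>\<^sub>o S' = c *\<^sub>C (T' \<bullet>\<^sub>o S')"
  by (rule bop_eqI; simp add: bop_apply_simps bop_scaleC_right)+

lemma (in commuting_family) E_mword:
  assumes "w \<in> mwords k n"
  shows "E \<bullet>\<^sub>o mword_op E k X w = mword_op E k X w"
proof (cases "k = 0")
  case False
  have "E \<bullet>\<^sub>o word_op E (X 0) (w ! 0) = word_op E (X 0) (w ! 0)"
    using mwords_nth[OF assms, of 0] False
    by (cases "w ! 0") (auto simp: E_idem E_left bop_comp_assoc[symmetric])
  then show ?thesis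
    using False by (simp add: mword_op_def upt_conv_Cons bop_comp_assoc[symmetric])
qed (simp add: mword_op_def E_idem)

context variety
begin

abbreviation Sw :: "(fock, fock) bop set" where
  "Sw \<equiv> S_wstar k n m f Q"

abbreviation Smw :: "nat list list \<Rightarrow> (fock, fock) bop" where
  "Smw \<equiv> S_mword k n m f Q"

definition S_gen :: "(fock, fock) bop set" where
  "S_gen = {Smw \<alpha> \<bullet>\<^sub>o adj (Smw \<beta>) | \<alpha> \<beta>. \<alpha> \<in> mwords k n \<and> \<beta> \<in> mwords k n}"

lemma S_gen_compress: "T \<in> cspan S_gen \<Longrightarrow> P \<bullet>\<^sub>o T \<bullet>\<^sub>o P = T"
proof -
  have "cspan S_gen \<subseteq> {T. P \<bullet>\<^sub>o T \<bullet>\<^sub>o P = T}"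
  proof (rule complex_vec.span_minimal)
    show "complex_vec.subspace {T. P \<bullet>\<^sub>o T \<bullet>\<^sub>o P = T}"
      unfolding complex_vec.subspace_def by (simp add: bop_comp_add bop_comp_scaleC)
    have "P \<bullet>\<^sub>o Smw w = Smw w" if "w \<in> mwords k n" for w
      unfolding S_mword_def by (rule S_family.E_mword[OF that])
    moreover from this have "adj (Smw w) \<bullet>\<^sub>o P = adj (Smw w)" if "w \<in> mwords k n" for w
      using that arg_cong[of _ _ adj] by (metis adj_P adj_comp)
    ultimately show "S_gen \<subseteq> {T. P \<bullet>\<^sub>o T \<bullet>\<^sub>o P = T}"
      unfolding S_gen_def by (auto simp: bop_comp_assoc) (simp add: bop_comp_assoc[symmetric])
  qed
  then show "T \<in> cspan S_gen \<Longrightarrow> P \<bullet>\<^sub>o T \<bullet>\<^sub>o P = T" by blast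
qed

text \<open>Operators fixed by compression with \<open>P\<close> form a weak* closed set, so closing
  in the ambient space adds nothing outside \<open>bops_on N\<close>.\<close>

lemma Sw_eq: "Sw = wstar closure_of cspan S_gen"
proof -
  have sub: "cspan S_gen \<subseteq> bops_on N" using S_gen_compress by (auto simp: bops_on_def)
  have "P \<bullet>\<^sub>o T \<bullet>\<^sub>o P = T" if "T \<in> wstar closure_of cspan S_gen" for T
    by (rule forall_in_closure_of_eq[OF that Hausdorff_wstar continuous_map_wstar_compress continuous_map_id[unfolded id_def]])
       (rule S_gen_compress)
  then have "wstar closure_of cspan S_gen \<subseteq> bops_on N" by (auto simp: bops_on_def)
  then show ?thesis
    unfolding S_wstar_def S_gen_def[symmetric] wstar_on_def closure_of_subtopology
    using sub by (simp add: Int_absorb1)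
qed

lemma Sw_compress: "T \<in> Sw \<Longrightarrow> P \<bullet>\<^sub>o T \<bullet>\<^sub>o P = T"
proof -
  assume "T \<in> Sw"
  then have "T \<in> bops_on N" unfolding S_wstar_def wstar_on_def closure_of_subtopology by blast
  then show ?thesis by (simp add: bops_on_def)
qed

lemma Sw_closed: "closedin wstar Sw"
  unfolding Sw_eq by simp

lemma cspan_S_gen_subset: "cspan S_gen \<subseteq> Sw"
  unfolding Sw_eq by (rule closure_of_subset) simp

text \<open>Closure argument behind all closure properties of \<open>Sw\<close>: it suffices to
  check the span of the generators.\<close>

lemma Sw_map:
  assumes "continuous_map wstar wstar h" "\<And>T. T \<in> cspan S_gen \<Longrightarrow> h T \<in> Sw" "T \<in> Sw"
  shows "h T \<in> Sw"
proof -
  have "h ` Sw \<subseteq> wstar closure_of (h ` cspan S_gen)"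
    unfolding Sw_eq by (rule continuous_map_image_closure_subset[OF assms(1)])
  also have "\<dots> \<subseteq> Sw" by (rule closure_of_minimal[OF _ Sw_closed]) (use assms(2) in blast)
  finally show ?thesis using assms(3) by blast
qed

text \<open>Separate continuity of addition suffices: translate first by an element of the span,
  then by an arbitrary element of \<open>Sw\<close>.\<close>

lemma Sw_subspace: "complex_vec.subspace Sw"
  unfolding complex_vec.subspace_def
proof (intro conjI ballI allI)
  show "0 \<in> Sw" using cspan_S_gen_subset complex_vec.span_zero by blast
  fix x assume x: "x \<in> Sw"
  show "c *\<^sub>C x \<in> Sw" for c
    by (rule Sw_map[OF continuous_map_wstar_scaleC _ x])
       (use cspan_S_gen_subset complex_vec.span_scale in blast)
  have x_add: "x + g \<in> Sw" if "g \<in> cspan S_gen" for g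
    by (rule Sw_map[OF continuous_map_wstar_add _ x])
       (use cspan_S_gen_subset complex_vec.span_add that in blast)
  show "x + y \<in> Sw" if y: "y \<in> Sw" for y
    using Sw_map[OF continuous_map_wstar_add[of x] _ y] x_add by (simp add: add.commute)
qed

lemma Sw_scaleR: "T \<in> Sw \<Longrightarrow> r *\<^sub>R T \<in> Sw"
  unfolding scaleR_scaleC using Sw_subspace by (rule complex_vec.subspace_scale)

lemma gen_in_Sw: "\<alpha> \<in> mwords k n \<Longrightarrow> \<beta> \<in> mwords k n \<Longrightarrow> Smw \<alpha> \<bullet>\<^sub>o adj (Smw \<beta>) \<in> Sw"
  by (rule subsetD[OF cspan_S_gen_subset complex_vec.span_base]) (auto simp: S_gen_def)

lemma Smw_empty: "Smw (replicate k []) = P"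
  unfolding S_mword_def by (rule S_family.mword_empty)

lemma P_in_Sw: "P \<in> Sw"
  using gen_in_Sw[OF mwords_empty mwords_empty] by (simp add: Smw_empty)

lemma compress_gen:
  assumes "i < k" "\<alpha> \<in> words (n i)" "w \<in> mwords k n" "v \<in> mwords k n"
  shows "word_op bop_id (S i) \<alpha> \<bullet>\<^sub>o (Smw w \<bullet>\<^sub>o adj (Smw v)) \<bullet>\<^sub>o adj_word (S i) \<alpha>
    = Smw (w[i := \<alpha> @ w ! i]) \<bullet>\<^sub>o adj (Smw (v[i := \<alpha> @ v ! i]))"
  unfolding S_mword_def S_family.word_mword[OF assms(1,2,3), symmetric] S_family.word_mword[OF assms(1,2,4), symmetric]
  by (simp add: bop_comp_assoc)

lemma compress_in_Sw:
  assumes "i < k" "\<alpha> \<in> words (n i)" "Y \<in> Sw"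
  shows "word_op bop_id (S i) \<alpha> \<bullet>\<^sub>o Y \<bullet>\<^sub>o adj_word (S i) \<alpha> \<in> Sw"
proof (rule Sw_map[OF continuous_map_wstar_compress _ assms(3)])
  let ?h = "\<lambda>Y. word_op bop_id (S i) \<alpha> \<bullet>\<^sub>o Y \<bullet>\<^sub>o adj_word (S i) \<alpha>"
  have "cspan S_gen \<subseteq> {Y. ?h Y \<in> Sw}"
  proof (rule complex_vec.span_minimal)
    show "complex_vec.subspace {Y. ?h Y \<in> Sw}"
      using Sw_subspace unfolding complex_vec.subspace_def by (simp add: bop_comp_add bop_comp_scaleC)
    show "S_gen \<subseteq> {Y. ?h Y \<in> Sw}"
      using assms by (auto simp: S_gen_def compress_gen mwords_nth intro!: gen_in_Sw mwords_update)
  qed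
  then show "?h T \<in> Sw" if "T \<in> cspan S_gen" for T using that by blast
qed

lemma PhiS_in_Sw:
  assumes "i < k" "Y \<in> Sw"
  shows "PhiS i Y \<in> Sw"
proof (rule limitin_closedin[OF phi_map.Phi_wstar_limit[OF phi_map_S] Sw_closed])
  show "\<forall>\<^sub>F F in finite_subsets_at_top (words (n i)).
      Phi_part (f i) (S i) Y F \<in> Sw"
    by (rule eventually_finite_subsets_at_top_weakI)
       (use assms in \<open>auto intro!: complex_vec.subspace_sum[OF Sw_subspace] Sw_scaleR compress_in_Sw\<close>)
qed (use assms in simp_all)

end

section \<open>Covariant maps attached to a tuple \<open>A\<close>\<close>

locale variety_rep = variety +
  fixes A :: "nat \<Rightarrow> nat \<Rightarrow> ('h::complex_hilbert, 'h) bop"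
  assumes Q_polys: "Q \<subseteq> polys k n"
    and A_comm: "commuting_tuple k n A"
    and A_well_defined: "\<And>i. i < k \<Longrightarrow> Phi_well_defined (n i) (f i) (A i)"
    and A_zero: "\<And>q. q \<in> Q \<Longrightarrow> poly_op k A q = 0"
begin

abbreviation PhiA :: "nat \<Rightarrow> ('h, 'h) bop \<Rightarrow> ('h, 'h) bop" where
  "PhiA i \<equiv> Phi (n i) (f i) (A i)"

lemma phi_map_A: "i < k \<Longrightarrow> phi_map (n i) (f i) (A i)"
  by (rule phi_map_well_defined) (auto simp: A_well_defined reg_coeff.a_nonneg[OF reg])

sublocale A_family: commuting_family bop_id k n A
  by unfold_locales (simp_all add: A_comm)

end

locale cp_map = variety_rep +
  fixes \<phi> :: "(fock, fock) bop \<Rightarrow> ('a, 'a) bop"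
  assumes cp: "\<phi> \<in> CP_wstar k n m f Q A"
begin

lemma \<phi>_add: "X \<in> Sw \<Longrightarrow> Y \<in> Sw \<Longrightarrow> \<phi> (X + Y) = \<phi> X + \<phi> Y"
  and \<phi>_scaleC: "X \<in> Sw \<Longrightarrow> \<phi> (c *\<^sub>C X) = c *\<^sub>C \<phi> X"
  using cp by (auto simp: CP_wstar_def clinear_map_on_def)

lemma \<phi>_scaleR: "X \<in> Sw \<Longrightarrow> \<phi> (r *\<^sub>R X) = r *\<^sub>R \<phi> X"
  by (simp add: scaleR_scaleC \<phi>_scaleC)

lemma \<phi>_zero: "\<phi> 0 = 0"
  using \<phi>_scaleC[OF P_in_Sw, of 0] by simp

lemma \<phi>_minus:
  assumes "X \<in> Sw" "Y \<in> Sw"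
  shows "\<phi> (X - Y) = \<phi> X - \<phi> Y"
proof -
  have "X - Y \<in> Sw" using assms by (rule complex_vec.subspace_diff[OF Sw_subspace])
  from \<phi>_add[OF this assms(2)] show ?thesis by simp
qed

lemma \<phi>_sum: "(\<And>i. i \<in> I \<Longrightarrow> g i \<in> Sw) \<Longrightarrow> \<phi> (\<Sum>i\<in>I. g i) = (\<Sum>i\<in>I. \<phi> (g i))"
proof (induction I rule: infinite_finite_induct)
  case (insert i I)
  then have "\<phi> (g i + sum g I) = \<phi> (g i) + \<phi> (sum g I)"
    by (intro \<phi>_add complex_vec.subspace_sum[OF Sw_subspace]) auto
  with insert show ?case by simp
qed (simp_all add: \<phi>_zero)

lemma \<phi>_cont: "continuous_map (subtopology wstar Sw) wstar \<phi>"
proof -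
  have "bops_on N \<inter> Sw = Sw" using Sw_compress by (auto simp: bops_on_def)
  then have "subtopology (wstar_on N) Sw = subtopology wstar Sw"
    by (simp add: wstar_on_def subtopology_subtopology)
  then show ?thesis using cp by (simp add: CP_wstar_def)
qed

lemma \<phi>_gen: "\<alpha> \<in> mwords k n \<Longrightarrow> \<beta> \<in> mwords k n \<Longrightarrow>
    \<phi> (Smw \<alpha> \<bullet>\<^sub>o adj (Smw \<beta>)) = mword_op bop_id k A \<alpha> \<bullet>\<^sub>o \<phi> P \<bullet>\<^sub>o adj (mword_op bop_id k A \<beta>)"
  using cp by (simp add: CP_wstar_def)

text \<open>Complete positivity for matrices of size 1.\<close>

lemma \<phi>_pos:
  assumes "T \<in> Sw" "pos_op T"
  shows "pos_op (\<phi> T)"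
proof -
  have "completely_positive_on N Sw \<phi>" using cp by (simp add: CP_wstar_def)
  moreover have "pos_matrix_on N (Suc 0) (\<lambda>_ _. T)"
    using assms by (simp add: pos_matrix_on_def pos_op_def)
  ultimately have "pos_matrix_on UNIV (Suc 0) (\<lambda>_ _. \<phi> T)"
    unfolding completely_positive_on_def
    by (elim allE[of _ "Suc 0"] allE[of _ "\<lambda>_ _. T"]) (simp add: assms)
  then have "cinner (\<phi> T \<cdot> x) x \<in> \<real>\<^sub>\<ge>\<^sub>0" for x
    unfolding pos_matrix_on_def by (auto dest: spec[of _ "\<lambda>_. x"])
  then show ?thesis by (simp add: pos_op_def)
qed

end

context variety
begin

text \<open>Agreement spreads from the generators to their span by linearity and to its closure by
  weak* continuity into a Hausdorff space. It extends covariance to all of \<open>Sw\<close> and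
  makes \<Gamma> injective.\<close>

lemma Sw_eqI:
  assumes "continuous_map (subtopology wstar Sw) wstar g" "continuous_map (subtopology wstar Sw) wstar h"
    and "\<And>X Y. X \<in> Sw \<Longrightarrow> Y \<in> Sw \<Longrightarrow> g (X + Y) = g X + g Y" "\<And>X Y. X \<in> Sw \<Longrightarrow> Y \<in> Sw \<Longrightarrow> h (X + Y) = h X + h Y"
    and "\<And>c X. X \<in> Sw \<Longrightarrow> g (c *\<^sub>C X) = c *\<^sub>C g X" "\<And>c X. X \<in> Sw \<Longrightarrow> h (c *\<^sub>C X) = c *\<^sub>C h X"
    and gen: "\<And>X. X \<in> S_gen \<Longrightarrow> g X = h X" and T: "T \<in> Sw"
  shows "g T = h T"
proof (rule forall_in_closure_of_eq[OF _ Hausdorff_wstar assms(1,2)])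
  show "T \<in> subtopology wstar Sw closure_of cspan S_gen"
    using T cspan_S_gen_subset unfolding closure_of_subtopology by (simp add: Int_absorb1 Sw_eq[symmetric])
  have "cspan S_gen \<subseteq> {X \<in> Sw. g X = h X}"
  proof (rule complex_vec.span_minimal)
    have "0 \<in> Sw" by (rule complex_vec.subspace_0[OF Sw_subspace])
    then have "g 0 = h 0" using assms(5)[of 0 0] assms(6)[of 0 0] by simp
    then show "complex_vec.subspace {X \<in> Sw. g X = h X}"
      using Sw_subspace assms(3-6) unfolding complex_vec.subspace_def by auto
    show "S_gen \<subseteq> {X \<in> Sw. g X = h X}"
      using gen cspan_S_gen_subset complex_vec.span_base by blast
  qed
  then show "g X = h X" if "X \<in> cspan S_gen" for X using that by blast
qed

end

context cp_map
begin

lemma \<phi>_compress: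
  assumes i: "i < k" and \<alpha>: "\<alpha> \<in> words (n i)" and Y: "Y \<in> Sw"
  shows "\<phi> (word_op bop_id (S i) \<alpha> \<bullet>\<^sub>o Y \<bullet>\<^sub>o adj_word (S i) \<alpha>)
    = word_op bop_id (A i) \<alpha> \<bullet>\<^sub>o \<phi> Y \<bullet>\<^sub>o adj_word (A i) \<alpha>"
proof (rule Sw_eqI[OF _ _ _ _ _ _ _ Y])
  let ?c = "\<lambda>Y. word_op bop_id (S i) \<alpha> \<bullet>\<^sub>o Y \<bullet>\<^sub>o adj_word (S i) \<alpha>"
  have c: "?c Y \<in> Sw" if "Y \<in> Sw" for Y by (rule compress_in_Sw[OF i \<alpha> that])
  have "continuous_map (subtopology wstar Sw) (subtopology wstar Sw) ?c"
    by (rule continuous_map_into_subtopology[OF continuous_map_from_subtopology[OF continuous_map_wstar_compress]])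
       (use c in auto)
  from continuous_map_compose[OF this \<phi>_cont]
  show "continuous_map (subtopology wstar Sw) wstar (\<lambda>Y. \<phi> (?c Y))" by (simp add: o_def)
  from continuous_map_compose[OF \<phi>_cont continuous_map_wstar_compress]
  show "continuous_map (subtopology wstar Sw) wstar (\<lambda>Y. word_op bop_id (A i) \<alpha> \<bullet>\<^sub>o \<phi> Y \<bullet>\<^sub>o adj_word (A i) \<alpha>)"
    by (simp add: o_def)
  show "\<phi> (?c (X + Y)) = \<phi> (?c X) + \<phi> (?c Y)" if "X \<in> Sw" "Y \<in> Sw" for X Y
    using \<phi>_add[OF c[OF that(1)] c[OF that(2)]] by (simp add: bop_comp_add)
  show "\<phi> (?c (r *\<^sub>C X)) = r *\<^sub>C \<phi> (?c X)" if "X \<in> Sw" for X r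
    using \<phi>_scaleC[OF c[OF that]] by (simp add: bop_comp_scaleC)
  show "\<phi> (?c X) = word_op bop_id (A i) \<alpha> \<bullet>\<^sub>o \<phi> X \<bullet>\<^sub>o adj_word (A i) \<alpha>" if X: "X \<in> S_gen" for X
  proof -
    obtain w v where X: "X = Smw w \<bullet>\<^sub>o adj (Smw v)" and wv: "w \<in> mwords k n" "v \<in> mwords k n"
      using X by (auto simp: S_gen_def)
    have "w[i := \<alpha> @ w ! i] \<in> mwords k n" "v[i := \<alpha> @ v ! i] \<in> mwords k n"
      using wv i \<alpha> by (auto intro!: mwords_update simp: mwords_nth)
    then show ?thesis
      unfolding X compress_gen[OF i \<alpha> wv] \<phi>_gen[OF wv]
      by (simp add: \<phi>_gen A_family.word_mword[OF i \<alpha>, symmetric] wv bop_comp_assoc)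
  qed
qed (simp_all add: \<phi>_add \<phi>_scaleC bop_comp_add bop_comp_scaleC)

text \<open>The map sends partial sums for \<open>S\<close> to partial sums for \<open>A\<close>.
  Both sides are weak* limits of the latter, and such limits are unique.\<close>

lemma \<phi>_Phi:
  assumes i: "i < k" and Y: "Y \<in> Sw"
  shows "\<phi> (PhiS i Y) = PhiA i (\<phi> Y)"
proof (rule limitin_Hausdorff_unique[OF _ _ _ Hausdorff_wstar])
  let ?F = "finite_subsets_at_top (words (n i))"
  let ?p = "\<lambda>F. Phi_part (f i) (S i) Y F"
  have p: "?p F \<in> Sw \<and> \<phi> (?p F) = (Phi_part (f i) (A i) (\<phi> Y) F)"
    if "F \<subseteq> words (n i)" for F
  proof -
    have "word_op bop_id (S i) \<alpha> \<bullet>\<^sub>o Y \<bullet>\<^sub>o adj_word (S i) \<alpha> \<in> Sw" if "\<alpha> \<in> F" for \<alpha>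
      using that \<open>F \<subseteq> _\<close> by (intro compress_in_Sw i Y) auto
    then show ?thesis
      using that by (auto intro!: complex_vec.subspace_sum[OF Sw_subspace] Sw_scaleR sum.cong
          simp: \<phi>_sum \<phi>_scaleR Sw_scaleR \<phi>_compress[OF i _ Y] subset_iff)
  qed
  have ev: "\<forall>\<^sub>F F in ?F. ?p F \<in> Sw"
    by (rule eventually_finite_subsets_at_top_weakI) (use p in blast)
  have "limitin (subtopology wstar Sw) ?p (PhiS i Y) ?F"
    unfolding limitin_subtopology
    using PhiS_in_Sw[OF i Y] ev phi_map.Phi_wstar_limit[OF phi_map_S[OF i]] by blast
  from continuous_map_limit[OF \<phi>_cont this]
  have "limitin wstar (\<phi> \<circ> ?p) (\<phi> (PhiS i Y)) ?F" .
  then show "limitin wstar (\<lambda>F. Phi_part (f i) (A i) (\<phi> Y) F)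
      (\<phi> (PhiS i Y)) ?F"
    by (rule limitin_transform_eventually[rotated])
       (rule eventually_finite_subsets_at_top_weakI, use p in auto)
  show "limitin wstar (\<lambda>F. Phi_part (f i) (A i) (\<phi> Y) F)
      (PhiA i (\<phi> Y)) ?F"
    by (rule phi_map.Phi_wstar_limit[OF phi_map_A[OF i]])
qed simp

lemma \<phi>_Phi_iter:
  assumes i: "i < k" and Y: "Y \<in> Sw"
  shows "(PhiS i ^^ s) Y \<in> Sw \<and> \<phi> ((PhiS i ^^ s) Y) = (PhiA i ^^ s) (\<phi> Y)"
  by (induction s) (auto simp: Y i \<phi>_Phi PhiS_in_Sw)

lemma \<phi>_defect_iter:
  assumes i: "i < k" and Y: "Y \<in> Sw"
  shows "((\<lambda>Y. Y - PhiS i Y) ^^ p) Y \<in> Sw \<and>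
    \<phi> (((\<lambda>Y. Y - PhiS i Y) ^^ p) Y) = ((\<lambda>Y. Y - PhiA i Y) ^^ p) (\<phi> Y)"
  by (induction p) (auto simp: Y i \<phi>_Phi \<phi>_minus PhiS_in_Sw intro!: complex_vec.subspace_diff[OF Sw_subspace])

lemma \<phi>_Delta: "Delta k n f S p P \<in> Sw \<and> \<phi> (Delta k n f S p P) = Delta k n f A p (\<phi> P)"
proof -
  have "foldr (\<lambda>i G. ((\<lambda>Y. Y - PhiS i Y) ^^ p i) \<circ> G) xs id P \<in> Sw \<and>
      \<phi> (foldr (\<lambda>i G. ((\<lambda>Y. Y - PhiS i Y) ^^ p i) \<circ> G) xs id P) =
      foldr (\<lambda>i G. ((\<lambda>Y. Y - PhiA i Y) ^^ p i) \<circ> G) xs id (\<phi> P)" if "set xs \<subseteq> {..<k}" for xs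
    using that by (induction xs) (auto simp only: foldr.simps comp_apply[of _ _ id] comp_apply[of _ _ P]
      comp_apply[of _ _ "\<phi> P"] id_apply P_in_Sw \<phi>_defect_iter set_simps insert_subset lessThan_iff)
  from this[of "[0..<k]"] show ?thesis unfolding Delta_def by (simp add: atLeast0LessThan)
qed

text \<open>Positivity and purity hold for \<open>P\<close> in the model; positivity and weak*
  continuity of the map transport them to \<open>A\<close>.\<close>

lemma \<phi>_in_cone: "\<phi> P \<in> pure_defect_cone k n m f A"
proof -
  have "pos_op (Delta k n f A p (\<phi> P))" if "\<forall>i<k. p i \<le> m i" for p
    using \<phi>_pos[of "Delta k n f S p P"] \<phi>_Delta[of p] pos_op_Delta_S[of p] that by auto
  moreover have "limitin wot (\<lambda>s. (PhiA i ^^ s) (\<phi> P)) 0 sequentially" if i: "i < k" for i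
  proof -
    have "limitin (subtopology wstar Sw) (\<lambda>s. (PhiS i ^^ s) P) 0 sequentially"
      unfolding limitin_subtopology
      using Phi_S_iter_limit[OF i] \<phi>_Phi_iter[OF i P_in_Sw] complex_vec.subspace_0[OF Sw_subspace] by auto
    from continuous_map_limit[OF \<phi>_cont this] show ?thesis
      using \<phi>_Phi_iter[OF i P_in_Sw] by (intro limitin_wstar_imp_wot) (simp add: o_def \<phi>_zero)
  qed
  moreover have "pos_op P"
    using diag_form_pos_op[OF diag_form_P] b_pos by (simp add: less_imp_le)
  ultimately show ?thesis
    using \<phi>_pos[OF P_in_Sw] by (simp add: pure_defect_cone_def defect_cone_def)
qed

end

context variety_rep
begin

text \<open>Injectivity of \<Gamma>: covariance determines the values on generators from the value
  at \<open>P\<close>, and extensionality settles the arguments outside \<open>Sw\<close>.\<close>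

lemma CP_wstar_eqI:
  assumes \<phi>: "\<phi> \<in> CP_wstar k n m f Q A" and \<psi>: "\<psi> \<in> CP_wstar k n m f Q A" and eq: "\<phi> P = \<psi> P"
  shows "\<phi> = \<psi>"
proof -
  interpret \<phi>: cp_map k n m f Q A \<phi> by unfold_locales (rule \<phi>)
  interpret \<psi>: cp_map k n m f Q A \<psi> by unfold_locales (rule \<psi>)
  have "\<phi> T = \<psi> T" if T: "T \<in> Sw" for T
    by (rule Sw_eqI[OF \<phi>.\<phi>_cont \<psi>.\<phi>_cont _ _ _ _ _ T])
       (auto simp: \<phi>.\<phi>_add \<psi>.\<phi>_add \<phi>.\<phi>_scaleC \<psi>.\<phi>_scaleC S_gen_def \<phi>.\<phi>_gen \<psi>.\<phi>_gen eq)
  moreover have "\<phi> \<in> extensional Sw" "\<psi> \<in> extensional Sw" using \<phi> \<psi> by (auto simp: CP_wstar_def)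
  ultimately show ?thesis by (blast intro: extensionalityI)
qed

end

section \<open>Recovering a pure element from its defect\<close>

text \<open>Pairs of words are regrouped by their concatenation; the finitely many cuts of a given
  word add up to the convolution.\<close>

lemma conv_has_sum:
  assumes nonneg: "\<And>\<alpha>. \<alpha> \<in> words n \<Longrightarrow> 0 \<le> c \<alpha>" "\<And>\<alpha>. \<alpha> \<in> words n \<Longrightarrow> 0 \<le> d \<alpha>" "\<And>\<alpha>. \<alpha> \<in> words n \<Longrightarrow> 0 \<le> F \<alpha>"
    and inner: "\<And>\<alpha>. \<alpha> \<in> words n \<Longrightarrow> ((\<lambda>\<beta>. d \<beta> * F (\<alpha> @ \<beta>)) has_sum g \<alpha>) (words n)"
    and outer: "((\<lambda>\<alpha>. c \<alpha> * g \<alpha>) has_sum s) (words n)"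
  shows "((\<lambda>\<gamma>. conv c d \<gamma> * F \<gamma>) has_sum s) (words n)"
proof -
  have "((\<lambda>(\<alpha>, \<beta>). c \<alpha> * (d \<beta> * F (\<alpha> @ \<beta>))) has_sum s) (words n \<times> words n)"
    by (rule has_sum_nonneg_Sigma[OF _ outer]) (auto intro!: has_sum_cmult_right inner mult_nonneg_nonneg nonneg)
  also have "?this \<longleftrightarrow> ((\<lambda>(\<gamma>, t). c (take t \<gamma>) * (d (drop t \<gamma>) * F \<gamma>)) has_sum s) (SIGMA \<gamma>:words n. {..length \<gamma>})"
    by (rule has_sum_reindex_bij_witness[of _ "\<lambda>(\<gamma>, t). (take t \<gamma>, drop t \<gamma>)" "\<lambda>(\<alpha>, \<beta>). (\<alpha> @ \<beta>, length \<alpha>)"]) auto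
  finally show ?thesis
  proof (rule has_sum_SigmaD)
    fix \<gamma> assume "\<gamma> \<in> words n"
    show "((\<lambda>t. case (\<gamma>, t) of (\<gamma>, t) \<Rightarrow> c (take t \<gamma>) * (d (drop t \<gamma>) * F \<gamma>)) has_sum conv c d \<gamma> * F \<gamma>) {..length \<gamma>}"
      using has_sum_finite[of "{..length \<gamma>}" "\<lambda>t. c (take t \<gamma>) * (d (drop t \<gamma>) * F \<gamma>)"]
      by (simp add: conv_eq_sum sum_distrib_right mult.assoc)
  qed
qed

lemma has_sum_sum_finite:
  fixes s :: "'i \<Rightarrow> 'b::topological_comm_monoid_add"
  shows "(\<And>i. i \<in> I \<Longrightarrow> (f i has_sum s i) A) \<Longrightarrow> ((\<lambda>x. \<Sum>i\<in>I. f i x) has_sum (\<Sum>i\<in>I. s i)) A"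
  by (induction I rule: infinite_finite_induct) (auto intro: has_sum_add)

lemma unit_coeff_has_sum: "((\<lambda>\<alpha>. unit_coeff \<alpha> * F \<alpha>) has_sum F []) (words n)"
proof -
  have "((\<lambda>\<alpha>. unit_coeff \<alpha> * F \<alpha>) has_sum F []) (words n) \<longleftrightarrow> (F has_sum F []) {[]}"
    by (rule has_sum_cong_neutral) (auto simp: unit_coeff_def)
  then show ?thesis using has_sum_finite[of "{[]}" F] by simp
qed

lemma diag_op_minus: "diag_op (S - T) = diag_op S - diag_op T"
  by (rule bop_eqI, rule l2_eqI) (simp add: bop_apply_simps l2_apply_simps)

locale phi_reg = phi_map n a X + reg_coeff n a for n a X
begin

abbreviation \<Phi> :: "('a, 'a) bop \<Rightarrow> ('a, 'a) bop" where
  "\<Phi> \<equiv> Phi n a X"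

lemma Phi_minus: "\<Phi> (Y - Z) = \<Phi> Y - \<Phi> Z"
  by (simp add: Phi_eq diag_op_minus bop_comp_minus)

lemma Phi_iter_minus: "(\<Phi> ^^ s) (Y - Z) = (\<Phi> ^^ s) Y - (\<Phi> ^^ s) Z"
  by (induction s) (simp_all add: Phi_minus)

lemma pos_op_Phi_iter: "pos_op Y \<Longrightarrow> pos_op ((\<Phi> ^^ s) Y)"
  by (induction s) (simp_all add: pos_op_Phi)

definition word_form :: "('a, 'a) bop \<Rightarrow> 'a \<Rightarrow> nat list \<Rightarrow> real" where
  "word_form Y x \<alpha> = qform Y (adj_word X \<alpha> \<cdot> x)"

lemma word_form_Nil: "word_form Y x [] = qform Y x"
  by (simp add: word_form_def)

lemma word_op_append: "word_op bop_id X (\<alpha> @ \<beta>) = word_op bop_id X \<alpha> \<bullet>\<^sub>o word_op bop_id X \<beta>"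
  by (induction \<alpha>) (simp_all add: bop_comp_assoc)

lemma word_form_append: "word_form Y x (\<alpha> @ \<beta>) = word_form Y (adj_word X \<alpha> \<cdot> x) \<beta>"
  by (simp add: word_form_def word_op_append)

lemma word_form_nonneg: "pos_op Y \<Longrightarrow> 0 \<le> word_form Y x \<alpha>"
  unfolding word_form_def by (rule pos_op_Re)

lemma conv_pow_has_sum:
  assumes Y: "pos_op Y"
  shows "((\<lambda>\<alpha>. conv_pow a p \<alpha> * word_form Y x \<alpha>) has_sum qform ((\<Phi> ^^ p) Y) x) (words n)"
proof (induction p arbitrary: x)
  case 0
  show ?case using unit_coeff_has_sum[of "word_form Y x"] by (simp add: word_form_Nil)
next
  case (Suc p)
  show ?case unfolding conv_pow.simps funpow.simps comp_apply
    by (rule conv_has_sum[OF _ _ _ _ Phi_has_sum_Re])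
       (use Suc in \<open>auto simp: a_nonneg conv_pow_nonneg word_form_nonneg Y word_form_append\<close>)
qed

text \<open>The sums of \<open>\<Phi>^p (D - \<Phi> D)\<close> telescope to \<open>D\<close> by
  purity. Expanding each power over words and collecting the coefficients of a word gives
  \<open>bq a 1\<close>, the coefficients of \<open>1 / (1 - a)\<close>.\<close>

lemma geometric_has_sum:
  assumes D: "pos_op D" and D1: "pos_op (D - \<Phi> D)"
    and pure: "(\<lambda>s. qform ((\<Phi> ^^ s) D) x) \<longlonglongrightarrow> 0"
  shows "((\<lambda>\<alpha>. bq a 1 \<alpha> * word_form (D - \<Phi> D) x \<alpha>) has_sum qform D x) (words n)"
proof (rule has_sum_nonneg_swap[OF conv_pow_has_sum[OF D1]])
  let ?q = "\<lambda>s. qform ((\<Phi> ^^ s) D) x"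
  have step: "qform ((\<Phi> ^^ p) (D - \<Phi> D)) x = ?q p - ?q (Suc p)" for p
    unfolding Phi_iter_minus by (simp add: bop_apply_simps cinner_simps funpow_swap1)
  have "(\<lambda>p. ?q p - ?q (Suc p)) sums (?q 0 - 0)"
    by (rule telescope_sums'[OF pure])
  then have sums: "(\<lambda>p. qform ((\<Phi> ^^ p) (D - \<Phi> D)) x) sums qform D x"
    by (simp add: step)
  have nn: "0 \<le> qform ((\<Phi> ^^ p) (D - \<Phi> D)) x" for p
    by (rule pos_op_Re[OF pos_op_Phi_iter[OF D1]])
  show "((\<lambda>p. qform ((\<Phi> ^^ p) (D - \<Phi> D)) x) has_sum qform D x) UNIV"
    by (rule norm_summable_imp_has_sum[OF _ sums]) (use sums nn in \<open>simp add: sums_iff\<close>)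
  show "0 \<le> conv_pow a p \<alpha> * word_form (D - \<Phi> D) x \<alpha>" if "\<alpha> \<in> words n" for p \<alpha>
    using that by (simp add: conv_pow_nonneg word_form_nonneg D1)
  fix \<alpha> assume "\<alpha> \<in> words n"
  have "bq a 1 \<alpha> * word_form (D - \<Phi> D) x \<alpha> = (\<Sum>p\<le>length \<alpha>. conv_pow a p \<alpha> * word_form (D - \<Phi> D) x \<alpha>)"
    by (simp add: bq_def binom_coeff_def sum_distrib_right)
  then have "((\<lambda>p. conv_pow a p \<alpha> * word_form (D - \<Phi> D) x \<alpha>) has_sum bq a 1 \<alpha> * word_form (D - \<Phi> D) x \<alpha>) {..length \<alpha>}"
    by simp
  then show "((\<lambda>p. conv_pow a p \<alpha> * word_form (D - \<Phi> D) x \<alpha>) has_sum bq a 1 \<alpha> * word_form (D - \<Phi> D) x \<alpha>) UNIV"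
    by (subst has_sum_cong_neutral[where T = "{..length \<alpha>}"]) (auto simp: conv_pow_eq_0[where a = a, OF a_Nil])
qed

text \<open>Induction on \<open>q\<close> with \<open>D\<close> replaced by
  \<open>D - \<Phi> D\<close>. The geometric expansion of \<open>D\<close> and the expansion of this
  first defect compose through \<open>bq_Suc_conv\<close>.\<close>

lemma defect_has_sum:
  assumes "\<And>p. p \<le> q \<Longrightarrow> pos_op (((\<lambda>Y. Y - \<Phi> Y) ^^ p) D)"
    and "\<And>x. (\<lambda>s. qform ((\<Phi> ^^ s) D) x) \<longlonglongrightarrow> 0"
  shows "((\<lambda>\<alpha>. bq a q \<alpha> * word_form (((\<lambda>Y. Y - \<Phi> Y) ^^ q) D) x \<alpha>) has_sum qform D x) (words n)"
  using assms
proof (induction q arbitrary: D x)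
  case 0
  show ?case using unit_coeff_has_sum[of "word_form D x"] by (simp add: word_form_Nil bq_0)
next
  case (Suc q)
  let ?D1 = "D - \<Phi> D"
  have shift: "((\<lambda>Y. Y - \<Phi> Y) ^^ Suc p) D = ((\<lambda>Y. Y - \<Phi> Y) ^^ p) ?D1" for p
    by (simp only: funpow_Suc_right comp_apply)
  have D: "pos_op D" using Suc.prems(1)[of 0] by simp
  have D1: "pos_op (((\<lambda>Y. Y - \<Phi> Y) ^^ p) ?D1)" if "p \<le> q" for p
    using Suc.prems(1)[of "Suc p"] that unfolding shift by simp
  have D1': "pos_op ?D1" using D1[of 0] by simp
  have pure1: "(\<lambda>s. qform ((\<Phi> ^^ s) ?D1) x) \<longlonglongrightarrow> 0" for x
  proof (rule tendsto_sandwich[OF _ _ tendsto_const Suc.prems(2)[of x]])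
    show "\<forall>\<^sub>F s in sequentially. 0 \<le> qform ((\<Phi> ^^ s) ?D1) x"
      by (simp add: pos_op_Re[OF pos_op_Phi_iter[OF D1']])
    have "qform ((\<Phi> ^^ s) ?D1) x \<le> qform ((\<Phi> ^^ s) D) x" for s
      using pos_op_Re[OF pos_op_Phi_iter[OF D, of "Suc s"], of x]
      unfolding Phi_iter_minus by (simp add: bop_apply_simps cinner_simps funpow_swap1)
    then show "\<forall>\<^sub>F s in sequentially. qform ((\<Phi> ^^ s) ?D1) x \<le> qform ((\<Phi> ^^ s) D) x"
      by simp
  qed
  let ?R = "((\<lambda>Y. Y - \<Phi> Y) ^^ q) ?D1"
  have "((\<lambda>\<alpha>. conv (bq a 1) (bq a q) \<alpha> * word_form ?R x \<alpha>) has_sum qform D x) (words n)"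
  proof (rule conv_has_sum)
    show "((\<lambda>\<alpha>. bq a 1 \<alpha> * word_form ?D1 x \<alpha>) has_sum qform D x) (words n)"
      by (rule geometric_has_sum[OF D D1' Suc.prems(2)])
    show "((\<lambda>\<beta>. bq a q \<beta> * word_form ?R x (\<alpha> @ \<beta>)) has_sum word_form ?D1 x \<alpha>) (words n)" for \<alpha>
      using Suc.IH[of ?D1 "adj_word X \<alpha> \<cdot> x", OF D1 pure1]
      unfolding word_form_append by (simp add: word_form_def)
  qed (auto simp: bq_nonneg word_form_nonneg D1)
  then show ?case
    unfolding shift bq_Suc_conv[where a = a, OF a_Nil] .
qed

lemma defect_le:
  assumes "\<And>p. p \<le> q \<Longrightarrow> pos_op (((\<lambda>Y. Y - \<Phi> Y) ^^ p) D)"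
  shows "qform (((\<lambda>Y. Y - \<Phi> Y) ^^ q) D) x \<le> qform D x"
  using assms
proof (induction q)
  case (Suc q)
  have "pos_op (\<Phi> (((\<lambda>Y. Y - \<Phi> Y) ^^ q) D))" using Suc.prems[of q] by (simp add: pos_op_Phi)
  from pos_op_Re[OF this, of x] Suc show ?case by (simp add: bop_apply_simps cinner_simps)
qed simp

lemma Phi_iter_mono:
  assumes "\<And>x. qform Y x \<le> qform Z x"
  shows "qform ((\<Phi> ^^ s) Y) x \<le> qform ((\<Phi> ^^ s) Z) x"
  by (induction s arbitrary: x) (auto intro: Phi_mono assms)

end

section \<open>The Berezin kernel\<close>

lemma mwords_0: "mwords 0 n = {[]}"
  by (auto simp: mwords_def)

lemma mwords_Suc_bij:
  "bij_betw (\<lambda>(\<alpha>, w). w @ [\<alpha>]) (words (n j) \<times> mwords j n) (mwords (Suc j) n)"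
proof (rule bij_betwI[where g = "\<lambda>w. (last w, butlast w)"])
  show "(\<lambda>(\<alpha>, w). w @ [\<alpha>]) \<in> words (n j) \<times> mwords j n \<rightarrow> mwords (Suc j) n"
    by (auto simp: mwords_def nth_append less_Suc_eq)
  show "(\<lambda>w. (last w, butlast w)) \<in> mwords (Suc j) n \<rightarrow> words (n j) \<times> mwords j n"
  proof
    fix w assume w: "w \<in> mwords (Suc j) n"
    then have "w \<noteq> []" by (auto simp: mwords_def)
    with w show "(last w, butlast w) \<in> words (n j) \<times> mwords j n"
      by (auto simp: mwords_def last_conv_nth nth_butlast)
  qed
qed (auto simp: mwords_def intro!: append_butlast_last_id)

context variety_rep
begin

text \<open>The adjoints appear in the order of the kernel, \<open>A\<^sub>0\<^sup>* \<dots> A\<^sub>j\<^sub>-\<^sub>1\<^sup>*\<close>, which is the reverse of that in the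
  adjoint of \<open>A\<^sub>w\<close>.\<close>

definition V_op :: "nat \<Rightarrow> nat list list \<Rightarrow> ('h, 'h) bop" where
  "V_op j w = foldr (\<lambda>i T. adj_word (A i) (w ! i) \<bullet>\<^sub>o T) [0..<j] bop_id"

lemma foldr_adj_words:
  "foldr (\<lambda>i T. adj_word (A i) (w ! i) \<bullet>\<^sub>o T) xs Z
    = foldr (\<lambda>i T. adj_word (A i) (w ! i) \<bullet>\<^sub>o T) xs bop_id \<bullet>\<^sub>o Z"
  for Z :: "('h, 'h) bop"
  by (induction xs) (simp_all add: bop_comp_assoc)

lemma V_op_snoc:
  assumes "length w = j"
  shows "V_op (Suc j) (w @ [\<alpha>]) = V_op j w \<bullet>\<^sub>o adj_word (A j) \<alpha>"
proof -
  have "foldr (\<lambda>i T. adj_word (A i) ((w @ [\<alpha>]) ! i) \<bullet>\<^sub>o T) [0..<j] bop_id = V_op j w"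
    unfolding V_op_def by (rule foldr_cong) (use assms in \<open>auto simp: nth_append\<close>)
  moreover have "(w @ [\<alpha>]) ! j = \<alpha>" using assms by (simp add: nth_append)
  ultimately show ?thesis
    by (simp add: V_op_def foldr_adj_words[of "w @ [\<alpha>]" _ "adj _"])
qed

lemma V_op_adj_letter:
  assumes "i < k" "j < n i" "w \<in> mwords k n"
  shows "V_op k w \<bullet>\<^sub>o adj (A i j) = V_op k (w[i := j # w ! i])"
proof -
  have "V_op k w \<bullet>\<^sub>o adj (A i j) = foldr (\<lambda>l T. adj_word (A l) (w ! l) \<bullet>\<^sub>o T) [0..<k] (adj (A i j) \<bullet>\<^sub>o bop_id)"
    by (simp add: V_op_def foldr_adj_words[of w _ "adj (A i j)"])
  also have "\<dots> = foldr (\<lambda>l T. ((\<lambda>l. adj_word (A l) (w ! l))(i := adj_word (A i) (w ! i) \<bullet>\<^sub>o adj (A i j))) l \<bullet>\<^sub>o T) [0..<k] bop_id"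
  proof (rule foldr_comp_update(2)[OF assms(1)])
    fix l assume "l < k" "l \<noteq> i"
    then have "A i j \<bullet>\<^sub>o word_op bop_id (A l) (w ! l) = word_op bop_id (A l) (w ! l) \<bullet>\<^sub>o A i j"
      using assms by (intro A_family.letter_word_commute) (auto simp: mwords_nth)
    from arg_cong[OF this, of adj] show "adj (A i j) \<bullet>\<^sub>o adj_word (A l) (w ! l) = adj_word (A l) (w ! l) \<bullet>\<^sub>o adj (A i j)"
      by simp
  qed
  also have "\<dots> = V_op k (w[i := j # w ! i])"
    unfolding V_op_def by (rule foldr_cong) (use mwords_length[OF assms(3)] in auto)
  finally show ?thesis .
qed

lemma phi_reg_A: "i < k \<Longrightarrow> phi_reg (n i) (f i) (A i)"
  by (simp add: phi_reg_def phi_map_A reg)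

end

section \<open>Expansion of a pure element over multi-words\<close>

locale pure_element = variety_rep +
  fixes D :: "('a, 'a) bop" and e :: "nat \<Rightarrow> 'a"
  assumes D_cone: "D \<in> pure_defect_cone k n m f A" and e: "parseval_seq e"
begin

definition R :: "('a, 'a) bop" where
  "R = Delta k n f A m D"

text \<open>Interpolates between \<open>D\<close> at \<open>j = k\<close> and \<open>R\<close> at
  \<open>j = 0\<close>: the coordinates from \<open>j\<close> on have received their full defect, in
  the order in which \<open>Delta\<close> applies them.\<close>

definition partial_defect :: "nat \<Rightarrow> ('a, 'a) bop" where
  "partial_defect j = foldr (\<lambda>i G. ((\<lambda>Y. Y - PhiA i Y) ^^ m i) \<circ> G) [j..<k] id D"

lemma partial_defect_k: "partial_defect k = D"
  by (simp add: partial_defect_def)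

lemma partial_defect_0: "partial_defect 0 = R"
  by (simp add: partial_defect_def R_def Delta_def)

lemma partial_defect_Suc:
  "j < k \<Longrightarrow> partial_defect j = ((\<lambda>Y. Y - PhiA j Y) ^^ m j) (partial_defect (Suc j))"
  by (simp add: partial_defect_def upt_conv_Cons)

lemma pos_op_Delta_A: "(\<And>i. i < k \<Longrightarrow> p i \<le> m i) \<Longrightarrow> pos_op (Delta k n f A p D)"
  using D_cone by (simp add: pure_defect_cone_def defect_cone_def)

lemma pos_op_D: "pos_op D" and pos_op_R: "pos_op R"
  using D_cone pos_op_Delta_A[of m] by (simp_all add: R_def pure_defect_cone_def defect_cone_def)

lemma pos_op_partial_defect_iter:
  assumes j: "j < k" and p: "p \<le> m j"
  shows "pos_op (((\<lambda>Y. Y - PhiA j Y) ^^ p) (partial_defect (Suc j)))"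
proof -
  \<comment> \<open>With exponent 0 below \<open>j\<close>, \<open>p\<close> at \<open>j\<close> and
    the full exponent above, the operator in question becomes a value of \<open>Delta\<close>
    covered by the cone condition.\<close>
  define p' where "p' l = (if l < j then 0 else if l = j then p else m l)" for l
  let ?g = "\<lambda>p i G. ((\<lambda>Y. Y - PhiA i Y) ^^ p i) \<circ> G"
  have split: "[0..<k] = [0..<j] @ j # [Suc j..<k]"
    using j by (metis less_imp_add_positive upt_add_eq_append upt_conv_Cons zero_le)
  have z: "foldr (?g p') xs G = G" if "set xs \<subseteq> {..<j}" for xs G
    using that by (induction xs) (auto simp: p'_def)
  have "foldr (?g p') [Suc j..<k] id = foldr (?g m) [Suc j..<k] id"
    by (rule foldr_cong) (auto simp: p'_def)
  then have "Delta k n f A p' D = ((\<lambda>Y. Y - PhiA j Y) ^^ p) (partial_defect (Suc j))"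
    unfolding Delta_def split foldr_append foldr.simps(2) comp_apply[of _ _ id]
    by (subst z) (auto simp: p'_def partial_defect_def)
  moreover have "pos_op (Delta k n f A p' D)"
    by (rule pos_op_Delta_A) (use p in \<open>auto simp: p'_def\<close>)
  ultimately show ?thesis by simp
qed

lemma partial_defect_le:
  "j \<le> k \<Longrightarrow> qform (partial_defect j) x \<le> qform D x"
proof (induction j rule: inc_induct)
  case base
  show ?case by (simp add: partial_defect_k)
next
  case (step j)
  interpret phi_reg "n j" "f j" "A j" using step by (intro phi_reg_A)
  have "qform (partial_defect j) x \<le> qform (partial_defect (Suc j)) x"
    unfolding partial_defect_Suc[OF step(2)]
    by (rule defect_le) (rule pos_op_partial_defect_iter[OF step(2)])
  with step show ?case by simp
qed

lemma partial_defect_has_sum: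
  assumes "j < k"
  shows "((\<lambda>\<alpha>. b j \<alpha> * qform (partial_defect j) (adj_word (A j) \<alpha> \<cdot> x))
     has_sum qform (partial_defect (Suc j)) x) (words (n j))"
proof -
  interpret phi_reg "n j" "f j" "A j" using assms by (rule phi_reg_A)
  have pos: "pos_op (partial_defect (Suc j))"
    using pos_op_partial_defect_iter[OF assms, of 0] by simp
  have pure: "(\<lambda>s. qform ((PhiA j ^^ s) (partial_defect (Suc j))) x) \<longlonglongrightarrow> 0" for x
  proof (rule tendsto_sandwich[OF _ _ tendsto_const])
    show "\<forall>\<^sub>F s in sequentially. 0 \<le> qform ((PhiA j ^^ s) (partial_defect (Suc j))) x"
      by (simp add: pos_op_Re[OF pos_op_Phi_iter[OF pos]])
    show "\<forall>\<^sub>F s in sequentially. qform ((PhiA j ^^ s) (partial_defect (Suc j))) x \<le> qform ((PhiA j ^^ s) D) x"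
      using Phi_iter_mono[OF partial_defect_le[of "Suc j"]] assms by simp
    have "limitin wot (\<lambda>s. (PhiA j ^^ s) D) 0 sequentially"
      using D_cone assms by (simp add: pure_defect_cone_def)
    then have "(\<lambda>s. qform ((PhiA j ^^ s) D) x) \<longlonglongrightarrow> qform 0 x"
      unfolding limitin_wot_iff by (intro tendsto_Re) blast
    then show "(\<lambda>s. qform ((PhiA j ^^ s) D) x) \<longlonglongrightarrow> 0" by simp
  qed
  show ?thesis
    using defect_has_sum[OF pos_op_partial_defect_iter[OF assms] pure]
    unfolding partial_defect_Suc[OF assms] b_eq[OF assms] word_form_def .
qed

text \<open>The last word is split off because \<open>V_op\<close> applies its adjoint to the vector
  first; this changes the vector, so the induction keeps \<open>x\<close> arbitrary.\<close>

lemma kernel_has_sum_aux: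
  "j \<le> k \<Longrightarrow> ((\<lambda>w. prod_coeff j b w * qform R (V_op j w \<cdot> x))
     has_sum qform (partial_defect j) x) (mwords j n)"
proof (induction j arbitrary: x)
  case 0
  show ?case
    using has_sum_finite[of "{[]}" "\<lambda>w. prod_coeff 0 b w * qform R (V_op 0 w \<cdot> x)"]
    by (simp add: mwords_0 prod_coeff_def V_op_def partial_defect_0)
next
  case (Suc j)
  let ?h = "\<lambda>w. prod_coeff (Suc j) b w * qform R (V_op (Suc j) w \<cdot> x)"
  let ?x = "\<lambda>\<alpha>. adj_word (A j) \<alpha> \<cdot> x"
  have j: "j < k" using Suc by simp
  have "((\<lambda>(\<alpha>, w). b j \<alpha> * (prod_coeff j b w * qform R (V_op j w \<cdot> ?x \<alpha>)))
      has_sum qform (partial_defect (Suc j)) x) (words (n j) \<times> mwords j n)"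
  proof (rule has_sum_nonneg_Sigma[OF has_sum_cmult_right[OF Suc.IH] partial_defect_has_sum[OF j]])
    show "0 \<le> b j \<alpha> * (prod_coeff j b w * qform R (V_op j w \<cdot> ?x \<alpha>))"
      if "\<alpha> \<in> words (n j)" "w \<in> mwords j n" for \<alpha> w
      using that j by (intro mult_nonneg_nonneg pos_op_Re[OF pos_op_R] prod_coeff_nonneg[where n = n])
        (auto intro!: less_imp_le[OF b_pos])
  qed (use j in simp)
  moreover have "(case z of (\<alpha>, w) \<Rightarrow> b j \<alpha> * (prod_coeff j b w * qform R (V_op j w \<cdot> ?x \<alpha>)))
      = ?h (case z of (\<alpha>, w) \<Rightarrow> w @ [\<alpha>])" if "z \<in> words (n j) \<times> mwords j n" for z
  proof -
    obtain \<alpha> w where z: "z = (\<alpha>, w)" by fastforce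
    with that have "length w = j" by (auto dest: mwords_length)
    moreover from this have "prod_coeff (Suc j) b (w @ [\<alpha>]) = b j \<alpha> * prod_coeff j b w"
      by (simp add: prod_coeff_def nth_append mult.commute)
    ultimately show ?thesis by (simp add: z V_op_snoc)
  qed
  ultimately have "((\<lambda>z. ?h (case z of (\<alpha>, w) \<Rightarrow> w @ [\<alpha>])) has_sum qform (partial_defect (Suc j)) x)
      (words (n j) \<times> mwords j n)"
    by (rule has_sum_cong[THEN iffD1, rotated])
  then show ?case
    using has_sum_reindex_bij_betw[OF mwords_Suc_bij, of ?h] by blast
qed

section \<open>The kernel, its intertwining relations and its range\<close>

definition K_coord :: "nat list list \<Rightarrow> ('a, 'a) bop" where
  "K_coord w = (if w \<in> mwords k n then (\<Prod>i<k. sqrt (b i (w ! i))) *\<^sub>R (sqrt_op R \<bullet>\<^sub>o V_op k w) else 0)"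

lemma K_coord_norm:
  assumes "w \<in> mwords k n"
  shows "(norm (K_coord w \<cdot> x))\<^sup>2 = B w * qform R (V_op k w \<cdot> x)"
proof -
  have "(\<Prod>i<k. sqrt (b i (w ! i)))\<^sup>2 = B w"
    unfolding prod_power_distrib prod_coeff_def
    by (rule prod.cong) (use b_pos mwords_nth[OF assms] in \<open>auto simp: less_imp_le\<close>)
  moreover have "(norm (sqrt_op R \<cdot> y))\<^sup>2 = qform R y" for y
    by (simp add: cinner_sqrt_op[OF pos_op_R, symmetric] cinner_self)
  ultimately show ?thesis using assms by (simp add: K_coord_def bop_apply_simps power_mult_distrib)
qed

lemma K_coord_has_sum: "((\<lambda>w. (norm (K_coord w \<cdot> x))\<^sup>2) has_sum qform D x) UNIV"
proof -
  have "((\<lambda>w. (norm (K_coord w \<cdot> x))\<^sup>2) has_sum qform D x) (mwords k n)"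
    using kernel_has_sum_aux[of k x] unfolding partial_defect_k
    by (rule has_sum_cong[THEN iffD1, rotated]) (simp_all add: K_coord_norm)
  then show ?thesis
    by (subst has_sum_cong_neutral[where T = "mwords k n"]) (auto simp: K_coord_def)
qed

abbreviation K :: "('a, (nat list list, 'a) l2) bop" where
  "K \<equiv> kernel k n m f A R"

text \<open>The expansion of \<open>D\<close> bounds the square sums of the coordinates by
  \<open>bop_norm D\<close>, so the column operator exists; its expansion in basis vectors is the
  series defining the kernel.\<close>

lemma K_apply: "l2_apply (K \<cdot> h) w = K_coord w \<cdot> h"
proof -
  have col: "l2_apply (col_op K_coord \<cdot> h) w = K_coord w \<cdot> h" for h w
  proof (rule col_op_apply)
    show "(\<Sum>w\<in>F. (norm (K_coord w \<cdot> x))\<^sup>2) \<le> bop_norm D * (norm x)\<^sup>2" if "finite F" for F x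
      by (rule order_trans[OF finite_sum_le_has_sum[OF K_coord_has_sum that] Re_cinner_bop_le]) auto
  qed
  let ?t = "\<lambda>h w. (\<Prod>i<k. sqrt (b i (w ! i))) *\<^sub>R (ket w \<otimes>\<^sub>v (sqrt_op R
      \<cdot> foldr (\<lambda>i T. adj_word (A i) (w ! i) \<bullet>\<^sub>o T) [0..<k] bop_id \<cdot> h))"
  have t: "?t h w = ket w \<otimes>\<^sub>v (K_coord w \<cdot> h)" if "w \<in> mwords k n" for h w
    by (rule l2_eqI) (simp add: that K_coord_def V_op_def tensor_vec.rep_eq l2_apply_simps bop_apply_simps scaleC_scaleR)
  have sum: "(?t h has_sum (col_op K_coord \<cdot> h)) (mwords k n)" for h
  proof -
    have "((\<lambda>w. ket w \<otimes>\<^sub>v (K_coord w \<cdot> h)) has_sum (col_op K_coord \<cdot> h)) UNIV"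
      using l2_ket_has_sum[of "col_op K_coord \<cdot> h"] by (simp add: col)
    then show ?thesis
    proof (rule has_sum_cong_neutral[THEN iffD1, rotated -1])
      show "ket w \<otimes>\<^sub>v (K_coord w \<cdot> h) = 0" if "w \<in> UNIV - mwords k n" for w
        by (rule l2_eqI) (use that in \<open>simp add: K_coord_def tensor_vec.rep_eq l2_apply_simps\<close>)
    qed (auto simp: t)
  qed
  have "K = col_op K_coord"
    unfolding kernel_def
  proof (rule the_equality)
    show "\<forall>h. (?t h has_sum (col_op K_coord \<cdot> h)) (mwords k n)" using sum by blast
    show "K' = col_op K_coord" if "\<forall>h. (?t h has_sum (K' \<cdot> h)) (mwords k n)" for K'
      by (rule bop_eqI) (use that sum has_sum_unique in blast)
  qed
  then show ?thesis by (simp add: col)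
qed

lemma norm_K: "cinner (K \<cdot> h) (K \<cdot> h) = cinner (D \<cdot> h) h"
proof -
  have "(norm (K \<cdot> h))\<^sup>2 = qform D h"
    using has_sum_unique[OF norm_l2_has_sum[of "K \<cdot> h"]] K_coord_has_sum[of h] by (simp add: K_apply)
  then show ?thesis using pos_op_D unfolding pos_op_iff cinner_self by metis
qed

text \<open>A slice of the kernel with values in Fock space. Membership of the range in the tensor
  product of \<open>N\<close> with \<open>H\<close> is expressed by these slices lying in
  \<open>N\<close>.\<close>

definition L :: "'a \<Rightarrow> ('a, fock) bop" where
  "L g = slice g \<bullet>\<^sub>o K"

lemma L_apply: "l2_apply (L g \<cdot> h) w = cinner (K_coord w \<cdot> h) g"
  by (simp add: L_def K_apply)

lemma L_adj_letter:
  assumes i: "i < k" and j: "j < n i"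
  shows "L g \<bullet>\<^sub>o adj (A i j) = adj (W i j) \<bullet>\<^sub>o L g"
proof (rule bop_eqI, rule l2_eqI)
  fix h w
  show "l2_apply ((L g \<bullet>\<^sub>o adj (A i j)) \<cdot> h) w = l2_apply ((adj (W i j) \<bullet>\<^sub>o L g) \<cdot> h) w"
  proof (cases "w \<in> mwords k n")
    case True
    let ?w = "w[i := j # w ! i]"
    have wi: "w ! i \<in> words (n i)" using True i by (rule mwords_nth)
    have w': "?w \<in> mwords k n" using True i j wi by (intro mwords_update) auto
    have pos: "0 < b i (w ! i)" "0 < b i (j # w ! i)" using b_pos[OF i] wi j by auto
    let ?c = "\<lambda>i \<alpha>. sqrt (b i \<alpha>)"
    \<comment> \<open>The weight of the backward shift cancels against the ratio of the kernel
      coefficients at the extended and the original index.\<close>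
    have "sqrt (b i (w ! i) / b i (j # w ! i)) * prod_coeff k ?c ?w = prod_coeff k ?c w"
      using pos i mwords_length[OF True]
      by (simp add: prod_coeff_update prod_coeff_remove[OF i, of ?c w] real_sqrt_divide)
    then have c: "sqrt (b i (w ! i) / b i (j # w ! i)) * (\<Prod>l<k. sqrt (b l (?w ! l))) = (\<Prod>l<k. sqrt (b l (w ! l)))"
      by (simp only: prod_coeff_def)
    have "V_op k w \<cdot> (adj (A i j) \<cdot> h) = V_op k ?w \<cdot> h"
      using V_op_adj_letter[OF i j True] by (metis bop_apply_comp)
    then show ?thesis
      using True w' unfolding bop_apply_comp adj_W_apply[OF i j] L_apply K_coord_def c[symmetric]
      by (simp add: bop_apply_simps cinner_simps scaleR_conv_of_real)
  qed (simp add: L_apply K_coord_def adj_W_apply[OF i j])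
qed

lemma adj_L_mword:
  assumes "w \<in> mwords k n"
  shows "adj (L g) \<bullet>\<^sub>o mword_op bop_id k W w = mword_op bop_id k A w \<bullet>\<^sub>o adj (L g)"
proof -
  have "L g \<bullet>\<^sub>o adj (mword_op bop_id k A w) = adj (mword_op bop_id k W w) \<bullet>\<^sub>o L g"
    by (rule intertwine_mword[where n = n]) (use assms L_adj_letter in auto)
  from arg_cong[OF this, of adj] show ?thesis by simp
qed

lemma adj_L_poly:
  assumes "q \<in> Q"
  shows "adj (L g) \<cdot> (poly_op k W q \<cdot> x) = 0"
proof -
  have keys: "Poly_Mapping.keys q \<subseteq> mwords k n" using assms Q_polys by (auto simp: polys_def)
  have mw: "adj (L g) \<cdot> (mword_op bop_id k W w \<cdot> x) = mword_op bop_id k A w \<cdot> (adj (L g) \<cdot> x)"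
    if "w \<in> Poly_Mapping.keys q" for w
    using adj_L_mword[of w g] that keys by (metis bop_apply_comp subsetD)
  have "adj (L g) \<cdot> (poly_op k W q \<cdot> x) = poly_op k A q \<cdot> (adj (L g) \<cdot> x)"
    unfolding poly_op_def bop_apply_sum bop_sum_right
    by (rule sum.cong) (simp_all add: bop_apply_simps bop_scaleC_right mw)
  then show ?thesis by (simp add: A_zero[OF assms])
qed

text \<open>\<open>adj (L g)\<close> turns words and polynomials in \<open>W\<close> into those in
  \<open>A\<close>, so it kills every generator of the complement because
  \<open>q(A) = 0\<close>.\<close>

lemma L_in_N: "L g \<cdot> h \<in> N"
  unfolding N_iff
proof (intro conjI allI impI ballI)
  show "l2_apply (L g \<cdot> h) w = 0" if "w \<notin> mwords k n" for w
    using that by (simp add: L_apply K_coord_def)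
  fix y assume "y \<in> M_gen"
  then obtain \<alpha> \<beta> q where y: "y = mword_op bop_id k W \<alpha> \<cdot> poly_op k W q \<cdot> mword_op bop_id k W \<beta> \<cdot> ket (replicate k [])"
    and mem: "\<alpha> \<in> mwords k n" "q \<in> Q" unfolding M_gen_def by blast
  have "adj (L g) \<cdot> y = mword_op bop_id k A \<alpha> \<cdot> (adj (L g) \<cdot> (poly_op k W q \<cdot> mword_op bop_id k W \<beta> \<cdot> ket (replicate k [])))"
    unfolding y using arg_cong[OF adj_L_mword[OF mem(1), of g], of "\<lambda>T. T \<cdot> z" for z] by simp
  also have "\<dots> = 0" unfolding adj_L_poly[OF mem(2)] by simp
  finally show "cinner (L g \<cdot> h) y = 0" using cinner_adj_right[of h "L g" y] by simp
qed

section \<open>The Berezin transform as a compressed amplification\<close>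

definition V :: "('a, (nat, fock) l2) bop" where
  "V = slices e \<bullet>\<^sub>o K"

lemma V_apply: "l2_apply (V \<cdot> h) i = L (e i) \<cdot> h"
  by (simp add: V_def L_def slices_apply[OF e])

lemma diag_P_V: "diag_op P \<bullet>\<^sub>o V = V"
  by (rule bop_eqI, rule l2_eqI) (simp add: V_apply P_id L_in_N)

abbreviation Bt :: "(fock, fock) bop \<Rightarrow> ('a, 'a) bop" where
  "Bt \<equiv> berezin k n m f Q A R"

text \<open>Since \<open>P\<close> fixes every slice, the projection in the constrained kernel
  disappears, and \<open>slices e\<close> turns the remaining \<open>tensor_id T\<close> into
  \<open>diag_op T\<close>.\<close>

lemma berezin_eq: "Bt T = adj V \<bullet>\<^sub>o diag_op T \<bullet>\<^sub>o V"
proof -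
  have "constrained_kernel k n m f Q A R = adj (slices e) \<bullet>\<^sub>o (diag_op P \<bullet>\<^sub>o V)"
    by (simp add: constrained_kernel_def tensor_id_eq[OF e] V_def bop_comp_assoc)
  also have "\<dots> = (adj (slices e) \<bullet>\<^sub>o slices e) \<bullet>\<^sub>o K" by (simp only: diag_P_V) (simp add: V_def bop_comp_assoc)
  also have "\<dots> = K" by (simp add: slices_isometry[OF e])
  finally show ?thesis
    by (simp add: berezin_def tensor_id_eq[OF e] V_def bop_comp_assoc)
qed

lemma adj_V_V: "adj V \<bullet>\<^sub>o V = D"
proof (rule bop_eqI_quadratic)
  fix x
  have "cinner ((adj V \<bullet>\<^sub>o V) \<cdot> x) x = cinner (((adj (slices e) \<bullet>\<^sub>o slices e) \<bullet>\<^sub>o K) \<cdot> x) (K \<cdot> x)"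
    by (simp add: V_def cinner_adj_left)
  also have "\<dots> = cinner (D \<cdot> x) x" by (simp only: slices_isometry[OF e] bop_comp_id norm_K)
  finally show "cinner ((adj V \<bullet>\<^sub>o V) \<cdot> x) x = cinner (D \<cdot> x) x" .
qed

lemma berezin_P: "Bt P = D"
  unfolding berezin_eq diag_P_V by (rule adj_V_V)

lemma diag_adj_Smw_V:
  assumes "w \<in> mwords k n"
  shows "diag_op (adj (Smw w)) \<bullet>\<^sub>o V = V \<bullet>\<^sub>o adj (mword_op bop_id k A w)"
proof (rule bop_eqI, rule l2_eqI)
  fix x i
  have PL: "P \<bullet>\<^sub>o L g = L g" for g by (rule bop_eqI) (simp add: P_id L_in_N)
  have "L (e i) \<bullet>\<^sub>o adj (mword_op bop_id k A w) = adj (mword_op P k S w) \<bullet>\<^sub>o L (e i)"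
    by (rule intertwine_mword[where n = n]) (use assms in \<open>auto simp: PL L_adj_letter adj_S bop_comp_assoc\<close>)
  then have "L (e i) \<cdot> (adj (mword_op bop_id k A w) \<cdot> x) = adj (Smw w) \<cdot> (L (e i) \<cdot> x)"
    unfolding S_mword_def by (metis bop_apply_comp)
  then show "l2_apply ((diag_op (adj (Smw w)) \<bullet>\<^sub>o V) \<cdot> x) i = l2_apply ((V \<bullet>\<^sub>o adj (mword_op bop_id k A w)) \<cdot> x) i"
    by (simp add: V_apply)
qed

lemma berezin_gen:
  assumes "\<alpha> \<in> mwords k n" "\<beta> \<in> mwords k n"
  shows "Bt (Smw \<alpha> \<bullet>\<^sub>o adj (Smw \<beta>)) = mword_op bop_id k A \<alpha> \<bullet>\<^sub>o D \<bullet>\<^sub>o adj (mword_op bop_id k A \<beta>)"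
proof -
  have "adj V \<bullet>\<^sub>o diag_op (Smw \<alpha>) = mword_op bop_id k A \<alpha> \<bullet>\<^sub>o adj V"
    using arg_cong[OF diag_adj_Smw_V[OF assms(1)], of adj] by (simp add: adj_diag_op)
  then have "Bt (Smw \<alpha> \<bullet>\<^sub>o adj (Smw \<beta>)) = (mword_op bop_id k A \<alpha> \<bullet>\<^sub>o adj V) \<bullet>\<^sub>o (diag_op (adj (Smw \<beta>)) \<bullet>\<^sub>o V)"
    unfolding berezin_eq diag_op_comp by (simp add: bop_comp_assoc[symmetric])
  also have "\<dots> = mword_op bop_id k A \<alpha> \<bullet>\<^sub>o (adj V \<bullet>\<^sub>o V) \<bullet>\<^sub>o adj (mword_op bop_id k A \<beta>)"
    unfolding diag_adj_Smw_V[OF assms(2)] by (simp add: bop_comp_assoc)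
  finally show ?thesis unfolding adj_V_V .
qed

text \<open>The form is a sum over \<open>l\<close> of forms of the given matrix at the vectors
  \<open>L (e l) \<cdot> x i\<close>. These lie in \<open>N\<close>, the only place where positivity
  of the matrix is assumed.\<close>

lemma berezin_pos_matrix:
  assumes "pos_matrix_on N r T"
  shows "pos_matrix_on UNIV r (\<lambda>i j. Bt (T i j))"
  unfolding pos_matrix_on_def
proof (intro allI impI)
  fix x :: "nat \<Rightarrow> 'a"
  let ?s = "\<Sum>i<r. \<Sum>j<r. cinner (Bt (T i j) \<cdot> x j) (x i)"
  let ?g = "\<lambda>l. \<Sum>i<r. \<Sum>j<r. cinner (T i j \<cdot> (L (e l) \<cdot> x j)) (L (e l) \<cdot> x i)"
  have sum: "(?g has_sum ?s) UNIV"
  proof -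
    have "((\<lambda>l. cinner (T i j \<cdot> (L (e l) \<cdot> x j)) (L (e l) \<cdot> x i)) has_sum cinner (Bt (T i j) \<cdot> x j) (x i)) UNIV" for i j
      using cinner_l2_has_sum[of "diag_op (T i j) \<cdot> (V \<cdot> x j)" "V \<cdot> x i"]
      by (simp add: berezin_eq cinner_adj_left V_apply)
    then show ?thesis by (intro has_sum_sum_finite)
  qed
  have nn: "?g l \<in> \<real>\<^sub>\<ge>\<^sub>0" for l
    using spec[OF assms[unfolded pos_matrix_on_def], of "\<lambda>i. L (e l) \<cdot> x i"]
    by (rule mp) (intro allI impI L_in_N)
  have "0 \<le> Re ?s" by (rule has_sum_nonneg[OF has_sum_Re[OF sum]]) (use nn in \<open>simp add: complex_nonneg_Reals_iff\<close>)
  moreover have "Im ?s = 0"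
    using has_sum_unique[OF has_sum_Im[OF sum], of 0] nn by (simp add: complex_nonneg_Reals_iff)
  ultimately show "?s \<in> \<real>\<^sub>\<ge>\<^sub>0" by (simp add: complex_nonneg_Reals_iff)
qed

lemma berezin_in_CP: "restrict Bt Sw \<in> CP_wstar k n m f Q A"
  unfolding CP_wstar_def
proof (intro CollectI conjI ballI)
  show "restrict Bt Sw \<in> extensional Sw" by simp
  show "clinear_map_on Sw (restrict Bt Sw)"
    using Sw_subspace unfolding clinear_map_on_def complex_vec.subspace_def
    by (simp add: berezin_eq diag_op_add diag_op_scaleC bop_comp_add bop_comp_scaleC)
  show "completely_positive_on N Sw (restrict Bt Sw)"
    unfolding completely_positive_on_def
  proof (intro allI impI)
    fix r T assume T: "\<forall>i<r. \<forall>j<r. T i j \<in> Sw" "pos_matrix_on N r T"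
    have "pos_matrix_on UNIV r (\<lambda>i j. Bt (T i j))" by (rule berezin_pos_matrix[OF T(2)])
    then show "pos_matrix_on UNIV r (\<lambda>i j. restrict Bt Sw (T i j))"
      using T(1) by (simp add: pos_matrix_on_def)
  qed
  have "continuous_map (subtopology wstar (bops_on N \<inter> Sw)) wstar Bt"
    unfolding berezin_eq by (intro continuous_map_from_subtopology continuous_map_wstar_amplify)
  then show "continuous_map (subtopology (wstar_on N) Sw) wstar (restrict Bt Sw)"
    unfolding wstar_on_def subtopology_subtopology by (rule continuous_map_eq) simp
  fix \<alpha> \<beta> assume "\<alpha> \<in> mwords k n" "\<beta> \<in> mwords k n"
  then show "restrict Bt Sw (Smw \<alpha> \<bullet>\<^sub>o adj (Smw \<beta>)) =
      mword_op bop_id k A \<alpha> \<bullet>\<^sub>o restrict Bt Sw P \<bullet>\<^sub>o adj (mword_op bop_id k A \<beta>)"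
    by (simp add: gen_in_Sw P_in_Sw berezin_P berezin_gen)
qed

end

theorem theorem2p7:
  fixes k :: nat and n m :: "nat \<Rightarrow> nat" and f :: "nat \<Rightarrow> nat list \<Rightarrow> real"
    and Q :: "(nat list list \<Rightarrow>\<^sub>0 complex) set"
    and A :: "nat \<Rightarrow> nat \<Rightarrow> ('h::complex_hilbert, 'h) bop"
  assumes "separable_space (euclidean :: 'h topology)"
    and "1 \<le> k" and "\<forall>i<k. 1 \<le> n i" and "\<forall>i<k. 1 \<le> m i"
    and "\<forall>i<k. positive_regular (n i) (f i)"
    and "Q \<subseteq> polys k n" and "N_space k n m f Q \<noteq> {0}"
    and "commuting_tuple k n A"
    and "\<forall>i<k. Phi_well_defined (n i) (f i) (A i)"
    and "\<forall>q\<in>Q. poly_op k A q = 0"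
  shows "bij_betw (\<lambda>\<phi>. \<phi> (ortho_proj (N_space k n m f Q)))
           (CP_wstar k n m f Q A) (pure_defect_cone k n m f A) \<and>
         (\<forall>D\<in>pure_defect_cone k n m f A.
           the_inv_into (CP_wstar k n m f Q A) (\<lambda>\<phi>. \<phi> (ortho_proj (N_space k n m f Q))) D =
           restrict (berezin k n m f Q A (Delta k n f A m D)) (S_wstar k n m f Q))"
proof -
  interpret variety_rep k n m f Q A
    by unfold_locales (use assms in auto)
  let ?\<Gamma> = "\<lambda>\<phi> :: (fock, fock) bop \<Rightarrow> ('h, 'h) bop. \<phi> (ortho_proj (N_space k n m f Q))"
  \<comment> \<open>Separability is consumed here.\<close>
  obtain e :: "nat \<Rightarrow> 'h" where e: "parseval_seq e"
    using parseval_seq_ex[OF assms(1)] by blast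
  have inj: "inj_on ?\<Gamma> (CP_wstar k n m f Q A)"
    by (rule inj_onI) (rule CP_wstar_eqI)
  \<comment> \<open>The same witness gives surjectivity and the formula for the inverse; it is
    restricted to \<open>Sw\<close> because members of \<open>CP_wstar\<close> are
    extensional.\<close>
  have inverse: "restrict (berezin k n m f Q A (Delta k n f A m D)) (S_wstar k n m f Q) \<in> CP_wstar k n m f Q A \<and>
      ?\<Gamma> (restrict (berezin k n m f Q A (Delta k n f A m D)) (S_wstar k n m f Q)) = D"
    if D: "D \<in> pure_defect_cone k n m f A" for D
  proof -
    interpret pure_element k n m f Q A D e by unfold_locales (rule D, rule e)
    show ?thesis using berezin_in_CP berezin_P P_in_Sw by (simp add: R_def)
  qed
  have "?\<Gamma> \<phi> \<in> pure_defect_cone k n m f A" if \<phi>: "\<phi> \<in> CP_wstar k n m f Q A" for \<phi>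
  proof -
    interpret cp_map k n m f Q A \<phi> by unfold_locales (rule \<phi>)
    show ?thesis by (rule \<phi>_in_cone)
  qed
  moreover have "D \<in> ?\<Gamma> ` CP_wstar k n m f Q A" if "D \<in> pure_defect_cone k n m f A" for D
    using imageI[OF conjunct1[OF inverse[OF that]], of ?\<Gamma>] unfolding conjunct2[OF inverse[OF that]] .
  ultimately have "?\<Gamma> ` CP_wstar k n m f Q A = pure_defect_cone k n m f A"
    by blast
  with inj have "bij_betw ?\<Gamma> (CP_wstar k n m f Q A) (pure_defect_cone k n m f A)"
    by (simp add: bij_betw_def)
  moreover have "the_inv_into (CP_wstar k n m f Q A) ?\<Gamma> D =
      restrict (berezin k n m f Q A (Delta k n f A m D)) (S_wstar k n m f Q)"
    if "D \<in> pure_defect_cone k n m f A" for D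
    using inverse[OF that] by (intro the_inv_into_f_eq[OF inj]) auto
  ultimately show ?thesis by blast
qed

end
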